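(* Let $(f_n)_{n\in\mathbb N}$ be a sequence of admissible functions and suppose that: (i) for every $n\in\mathbb N$, $f_n\in L^{1,+}_{\rm loc}(E_n)$, where $E_n\uparrow E$ as $n\to\infty$; (ii) there is an admissible function $f\in L^{1,+}_{\rm loc}(E)$ with $(I^1f)(1/2)>0$ such that for all $x\in E$ $$\lim_{n\to\infty}\int_{-\infty}^x|f_n(h)-f(h)|\,dh=0;$$ (iii) for some fixed $x_0\in\mathbb R$ and some $\delta>0$ $$\sup_{n\in\mathbb N}\int_{-\infty}^{x_0}|h|^{\frac d2+\delta}f_n(h)\,dh<\infty .$$ Let $\eta_n:=\eta_{f_n}$, $n\in\mathbb N$, and $\eta:=\eta_f$ be the Poisson point processes with densities $f_n$ and $f$. Then there exist point processes $\widetilde\eta$ and $(\widetilde\eta_n)_{n\in\mathbb N}$ defined on a common probability space, with $\widetilde\eta\overset{d}{=}\eta$ and $\widetilde\eta_n\overset{d}{=}\eta_n$ for all $n\in\mathbb N$, such that (i) $\mathrm{skel}(\mathcal L(\widetilde\eta_n))$ converges locally with high probability to $\mathrm{skel}(\mathcal L(\widetilde\eta))$ as $n\to\infty$; (ii) $\mathrm{skel}(\mathcal L^*(\widetilde\eta_n))$ converges locally with high probability to $\mathrm{skel}(\mathcal L^*(\widetilde\eta))$ as $n\to\infty$.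
   Context: Let $d\ge2$. Points of $\mathbb R^d\times\mathbb R$ are written $(v,h)$. Put $\mathrm{pow}(w,(v,h))=\|w-v\|^2+h$. For a countable set $A\subset\mathbb R^d\times\mathbb R$ and $(v,h)\in A$ the Laguerre cell is $C((v,h),A)=\{w\in\mathbb R^d:\mathrm{pow}(w,(v,h))\le \mathrm{pow}(w,(v',h'))\ \forall (v',h')\in A\}$, and the Laguerre diagram $\mathcal L(A)$ is the collection of all Laguerre cells with non-empty interior. A tessellation in $\mathbb R^d$ is a locally finite system of convex polytopes (cells) with non-empty, pairwise disjoint interiors covering $\mathbb R^d$, such that the intersection of two distinct cells is empty or a face of both. It is normal if each $k$-dimensional face is contained in precisely $d+1-k$ cells, $0\le k\le d-1$. If $\mathcal L(A)$ is a normal tessellation, its dual $\mathcal L^*(A)$ is the collection of simplices $\mathrm{conv}(v_1,\dots,v_{d+1})$ over distinct $(v_1,h_1),\dots,(v_{d+1},h_{d+1})\in A$ with $\bigcap_{i=1}^{d+1}C((v_i,h_i),A)\ne\varnothing$. The skeleton is $\mathrm{skel}(X)=\bigcup_{c\in X}\mathrm{bd}\,c$. For an interval $E\subset\mathbb R$, $L^{1,+}_{\rm loc}(E)$ is the set of functions $f:\mathrm{int}\,E\to[0,\infty)$ with $\int_K f\,dx<\infty$ for all compact $K\subset E$; such $f$ is regarded as $0$ outside $E$. For $\alpha>0$, $(I^\alpha f)(x)=\frac1{\Gamma(\alpha)}\int_{-\infty}^x f(t)(x-t)^{\alpha-1}\,dt$. For $f\in L^{1,+}_{\rm loc}(E)$,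 $\eta_f$ is the Poisson point process in $\mathbb R^d\times\mathbb R$ with intensity measure $\Lambda_f(\cdot)=\int_{\mathbb R^d}\int_E f(h)\mathbf 1((v,h)\in\cdot)\,dh\,dv$, assumed non-trivial ($\Lambda_f([0,1]^d\times\mathbb R)>0$). A function $f\in L^{1,+}_{\rm loc}(E)$ is admissible if: $E=[a,\infty)$ for some $a\in\mathbb R$, or $E=(-\infty,b)$ for some $b\in\mathbb R$, or $E=\mathbb R$; $(I^{d/2+1}f)(t)<\infty$ for all $t\in E$; and, if $E=(-\infty,b)$, there are $\varepsilon>0$, $n_0\in\mathbb N$ with $(I^{d/2+1}f)(b-1/n)\ge n^\varepsilon$ for all $n>n_0$. For admissible $f$, $\mathcal L(\eta_f)$ is almost surely a normal random tessellation and $\mathcal L^*(\eta_f)$ is almost surely a simplicial random tessellation. Random closed sets $(Z_n)_{n\in\mathbb N}$ converge locally with high probability to a random closed set $Z$ (all on a common probability space) if $\lim_{n\to\infty}\mathbb P(Z_n\cap B_R\ne Z\cap B_R)=0$ for every $R>0$, where $B_R$ is the closed centered ball of radius $R$ in $\mathbb R^d$. *)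

theory Defs
  imports "HOL-Probability.Probability"
begin

section \<open>Laguerre diagrams and their duals\<close>

text \<open>The space \<open>\<real>\<^sup>d\<close> is a type of class \<open>euclidean_space\<close>, with \<open>d = DIM('a)\<close>.\<close>

definition pow :: "'a::euclidean_space \<Rightarrow> 'a \<times> real \<Rightarrow> real" where
  "pow w p = (norm (w - fst p))\<^sup>2 + snd p"

definition laguerre_cell :: "'a::euclidean_space \<times> real \<Rightarrow> ('a \<times> real) set \<Rightarrow> 'a set" where
  "laguerre_cell p A = {w. \<forall>q\<in>A. pow w p \<le> pow w q}"

definition laguerre :: "('a::euclidean_space \<times> real) set \<Rightarrow> 'a set set" where
  "laguerre A = {laguerre_cell p A |p. p \<in> A \<and> interior (laguerre_cell p A) \<noteq> {}}"

text \<open>The dual is only of interest if \<open>laguerre A\<close> is a normal tessellation; the defining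
  formula is used for all \<open>A\<close>. A set \<open>S\<close> of cardinality \<open>d + 1\<close> stands for the distinct points
  \<open>(v\<^sub>1, h\<^sub>1), \<dots>, (v\<^sub>d\<^sub>+\<^sub>1, h\<^sub>d\<^sub>+\<^sub>1)\<close>.\<close>

definition dual_laguerre :: "('a::euclidean_space \<times> real) set \<Rightarrow> 'a set set" where
  "dual_laguerre A =
     {convex hull (fst ` S) |S. S \<subseteq> A \<and> finite S \<and> card S = DIM('a) + 1 \<and>
        (\<Inter>p\<in>S. laguerre_cell p A) \<noteq> {}}"

definition skel :: "'a::euclidean_space set set \<Rightarrow> 'a set" where
  "skel X = (\<Union>c\<in>X. frontier c)"


section \<open>Admissible functions\<close>

text \<open>A function on \<open>int E\<close> is represented by its extension by \<open>0\<close> to the real line.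
  The functions are Borel measurable.\<close>

definition L1_loc_plus :: "real set \<Rightarrow> (real \<Rightarrow> real) set" where
  "L1_loc_plus E = {f. f \<in> borel_measurable borel \<and> (\<forall>x. 0 \<le> f x) \<and>
     (\<forall>x. x \<notin> interior E \<longrightarrow> f x = 0) \<and>
     (\<forall>K. compact K \<and> K \<subseteq> E \<longrightarrow> (\<integral>\<^sup>+x\<in>K. ennreal (f x) \<partial>lborel) < \<infinity>)}"

definition frac_integral :: "real \<Rightarrow> (real \<Rightarrow> real) \<Rightarrow> real \<Rightarrow> ennreal" where
  "frac_integral \<alpha> f x =
     ennreal (1 / Gamma \<alpha>) * (\<integral>\<^sup>+t\<in>{..<x}. ennreal (f t * (x - t) powr (\<alpha> - 1)) \<partial>lborel)"

definition admissible :: "nat \<Rightarrow> real set \<Rightarrow> (real \<Rightarrow> real) \<Rightarrow> bool" where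
  "admissible d E f \<longleftrightarrow>
     f \<in> L1_loc_plus E \<and>
     ((\<exists>a. E = {a..}) \<or> (\<exists>b. E = {..<b}) \<or> E = UNIV) \<and>
     (\<forall>t\<in>E. frac_integral (real d / 2 + 1) f t < \<infinity>) \<and>
     (\<forall>b. E = {..<b} \<longrightarrow>
        (\<exists>\<epsilon>>0. \<exists>n0::nat. \<forall>n>n0.
           frac_integral (real d / 2 + 1) f (b - 1 / real n) \<ge> ennreal (real n powr \<epsilon>)))"


section \<open>Poisson point processes\<close>

text \<open>All processes considered have diffuse intensity measures and are hence almost surely simple,
  so a point process is a random countable set, and the value of the counting measure on \<open>B\<close> is
  \<open>num_points A B\<close>. No local finiteness is required: the points of a process with
  \<open>E = (-\<infinity>, b)\<close> accumulate at height \<open>b\<close>.\<close>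

definition num_points :: "'b set \<Rightarrow> 'b set \<Rightarrow> ennreal" where
  "num_points A B = emeasure (count_space UNIV) (A \<inter> B)"

definition config_space :: "'b::topological_space set measure" where
  "config_space = sigma {A. countable A}
     {{A. countable A \<and> num_points A B \<in> U} |B U. B \<in> sets borel \<and> U \<in> sets borel}"

definition point_process :: "'w measure \<Rightarrow> ('w \<Rightarrow> 'b::topological_space set) \<Rightarrow> bool" where
  "point_process M \<eta> \<longleftrightarrow> prob_space M \<and> \<eta> \<in> measurable M config_space"

definition poisson_process ::
    "'w measure \<Rightarrow> ('w \<Rightarrow> 'b::topological_space set) \<Rightarrow> 'b measure \<Rightarrow> bool" where
  "poisson_process M \<eta> \<Lambda> \<longleftrightarrow>
     point_process M \<eta> \<and>
     (\<forall>B\<in>sets borel. emeasure \<Lambda> B < \<infinity> \<longrightarrow>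
        (\<forall>k::nat. measure M {\<omega>\<in>space M. num_points (\<eta> \<omega>) B = of_nat k} =
           exp (- measure \<Lambda> B) * measure \<Lambda> B ^ k / fact k)) \<and>
     (\<forall>B\<in>sets borel. emeasure \<Lambda> B = \<infinity> \<longrightarrow> (AE \<omega> in M. num_points (\<eta> \<omega>) B = \<infinity>)) \<and>
     (\<forall>(I::nat set) B. finite I \<and> (\<forall>i\<in>I. B i \<in> sets borel) \<and> disjoint_family_on B I \<longrightarrow>
        prob_space.indep_vars M (\<lambda>_. borel) (\<lambda>i \<omega>. num_points (\<eta> \<omega>) (B i)) I)"

definition intensity :: "(real \<Rightarrow> real) \<Rightarrow> ('a::euclidean_space \<times> real) measure" where
  "intensity f = density lborel (\<lambda>(v, h). ennreal (f h))"

definition same_law ::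
    "'w measure \<Rightarrow> ('w \<Rightarrow> 'b::topological_space set) \<Rightarrow> 'u measure \<Rightarrow> ('u \<Rightarrow> 'b set) \<Rightarrow> bool" where
  "same_law M \<eta> N \<xi> \<longleftrightarrow> distr M config_space \<eta> = distr N config_space \<xi>"


section \<open>Random closed sets\<close>

text \<open>Closedness is only required almost surely, because the skeleton of a Laguerre diagram
  of a point process is the skeleton of a tessellation only almost surely.\<close>

definition random_closed_set :: "'w measure \<Rightarrow> ('w \<Rightarrow> 'a::euclidean_space set) \<Rightarrow> bool" where
  "random_closed_set M Z \<longleftrightarrow>
     (AE \<omega> in M. closed (Z \<omega>)) \<and>
     (\<forall>K. compact K \<longrightarrow> {\<omega>\<in>space M. Z \<omega> \<inter> K \<noteq> {}} \<in> sets M)"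

text \<open>Measurability of the events is part of the definition since \<open>measure\<close> is \<open>0\<close> on
  non-measurable sets.\<close>

definition converges_locally_whp ::
    "'w measure \<Rightarrow> (nat \<Rightarrow> 'w \<Rightarrow> 'a::euclidean_space set) \<Rightarrow> ('w \<Rightarrow> 'a set) \<Rightarrow> bool" where
  "converges_locally_whp M Zs Z \<longleftrightarrow>
     prob_space M \<and> (\<forall>n. random_closed_set M (Zs n)) \<and> random_closed_set M Z \<and>
     (\<forall>R>0.
        (\<forall>n. {\<omega>\<in>space M. Zs n \<omega> \<inter> cball 0 R \<noteq> Z \<omega> \<inter> cball 0 R} \<in> sets M) \<and>
        (\<lambda>n. measure M {\<omega>\<in>space M. Zs n \<omega> \<inter> cball 0 R \<noteq> Z \<omega> \<inter> cball 0 R})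
          \<longlonglongrightarrow> 0)"

end

theory Submission
  imports Defs "HOL-Combinatorics.Multiset_Permutations" "HOL-Real_Asymp.Real_Asymp"
begin

text \<open>
  All processes are thinnings of one Poisson process of unit intensity on \<open>(\<real>\<^sup>d \<times> \<real>) \<times> \<real>\<close>: keep the
  points under the graph of \<open>f\<^sub>n\<close>, respectively \<open>f\<close>, and forget the last coordinate. The points
  that can influence the diagram inside a ball lie, once the ball is covered by power balls of
  level \<open>T\<close>, in the set \<open>W = {p. \<exists>w. norm w \<le> R \<and> pow w p \<le> T}\<close>, and the expected number of points of
  \<open>W\<close> at which two thinnings differ is a weighted \<open>L\<^sup>1\<close>-distance of the densities, which tends to
  0 by the moment condition. So both skeletons agree locally with high probability.

  For the dual skeleton one must also bound the common point \<open>z\<close>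
  of the cells of a simplex meeting a ball at \<open>u\<close>: some vertex \<open>p\<close> of the simplex has
  \<open>pow z p \<ge> norm (z - u) ^ 2 + pow u p\<close>, while a point \<open>q\<close> of the process far out in the orthant of
  \<open>z - u\<close> has \<open>pow z q \<le> norm (z - u) ^ 2 + pow u q - 2 * norm (z - u)\<close>. As \<open>pow z p \<le> pow z q\<close>, this
  bounds \<open>norm (z - u)\<close>.
\<close>

subsection \<open>Localization of the skeletons\<close>

text \<open>Hypographs turn distances between densities into volumes: two thinnings disagree at the
  points of the unit process between the two graphs, so one process couples all \<open>n\<close> at
  once. The main obstacle is that no deterministic level covers a ball with certainty. The level
  \<open>T k\<close> that suffices depends on the configuration, and it must stay in
  \<open>E\<close>, since admissibility bounds the number of points in an influence region for
  levels in \<open>E\<close>. If \<open>E\<close> is bounded above by \<open>b\<close>, heights may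
  accumulate at \<open>b\<close>, and a cover at a level below \<open>b\<close> comes from the
  growth condition on \<open>frac_integral\<close>: void probabilities
  \<open>exp (- C * n powr \<epsilon>)\<close> beat the polynomially many points of a net. Two
  features of the statement shape the rest. The probability space consists of real sequences, so
  samples are encoded as such. Hitting and disagreement events must be measurable, so configurations
  are enumerated by countably many random points and are empty outside one event of full
  probability, on which the points are distinct and well spread. The laws are the required ones
  because counts determine the law of a point process.\<close>

definition influence_region :: "real \<Rightarrow> real \<Rightarrow> ('a::euclidean_space \<times> real) set" where
  "influence_region R T = {p. \<exists>w\<in>cball 0 R. pow w p \<le> T}"

lemma influence_region_mono:
  "R \<le> R' \<Longrightarrow> T \<le> T' \<Longrightarrow> influence_region R T \<subseteq> influence_region R' T'"
  unfolding influence_region_def by (force intro: order_trans)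

lemma snd_le_pow: "snd p \<le> pow w p"
  by (simp add: pow_def)

lemma continuous_on_pow [continuous_intros]:
  "continuous_on S f \<Longrightarrow> continuous_on S g \<Longrightarrow> continuous_on S (\<lambda>x. pow (f x) (g x))"
  unfolding pow_def by (intro continuous_intros)

lemma pow_eq_inner: "pow w p = (norm w)\<^sup>2 + ((norm (fst p))\<^sup>2 + snd p) - 2 * (fst p \<bullet> w)"
  unfolding pow_def by (simp add: power2_norm_eq_inner inner_diff inner_commute algebra_simps)

lemma pow_shift:
  "pow z p = (norm (z - u))\<^sup>2 + pow u p + 2 * ((z - u) \<bullet> (u - fst p))"
  unfolding pow_def by (simp add: power2_norm_eq_inner inner_diff inner_commute algebra_simps)

lemma closed_laguerre_cell: "closed (laguerre_cell p A)"
proof -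
  have "laguerre_cell p A = (\<Inter>q\<in>A. {w. pow w p \<le> pow w q})"
    by (auto simp: laguerre_cell_def)
  then show ?thesis
    by (auto intro!: closed_INT closed_Collect_le continuous_intros)
qed

lemma convex_laguerre_cell: "convex (laguerre_cell p A)"
proof -
  have "laguerre_cell p A =
      (\<Inter>q\<in>A. {w. (2 *\<^sub>R (fst q - fst p)) \<bullet> w \<le> (norm (fst q))\<^sup>2 + snd q - ((norm (fst p))\<^sup>2 + snd p)})"
    by (auto simp: laguerre_cell_def pow_eq_inner inner_diff algebra_simps)
  then show ?thesis
    by (simp only:) (intro convex_INT convex_halfspace_le)
qed

text \<open>A point outside the influence region has power above \<open>T\<close> everywhere on the
  ball, while the cover keeps the minimal power at most \<open>T\<close>. So such a point can
  neither own \<open>w\<close> nor compete for it, and only the shared points matter.\<close>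

lemma laguerre_cell_transfer:
  assumes cover: "\<And>w. w \<in> cball 0 R \<Longrightarrow> \<exists>p\<in>A. pow w p \<le> T"
    and eq: "A \<inter> influence_region R T = A' \<inter> influence_region R T"
    and w: "w \<in> cball 0 R" and p: "p \<in> A" "w \<in> laguerre_cell p A"
  shows "p \<in> A' \<and> w \<in> laguerre_cell p A' \<and> p \<in> influence_region R T"
proof -
  obtain p0 where p0: "p0 \<in> A" "pow w p0 \<le> T" using cover[OF w] by auto
  have 1: "pow w p \<le> T" using p p0 by (force simp: laguerre_cell_def)
  then have 2: "p \<in> influence_region R T" using w by (auto simp: influence_region_def)
  have "pow w p \<le> pow w q" if "q \<in> A'" for q
  proof (cases "pow w q \<le> T")
    case True
    then have "q \<in> influence_region R T" using w by (auto simp: influence_region_def)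
    then have "q \<in> A" using eq that by blast
    then show ?thesis using p by (simp add: laguerre_cell_def)
  qed (use 1 in simp)
  then show ?thesis using 2 p eq by (auto simp: laguerre_cell_def)
qed

lemma cover_transfer:
  assumes cover: "\<And>w. w \<in> cball 0 R \<Longrightarrow> \<exists>p\<in>A. pow w p \<le> T"
    and eq: "A \<inter> influence_region R T = A' \<inter> influence_region R T"
    and w: "w \<in> cball 0 R"
  shows "\<exists>p\<in>A'. pow w p \<le> T"
proof -
  obtain p where p: "p \<in> A" "pow w p \<le> T" using cover[OF w] by auto
  then have "p \<in> influence_region R T" using w by (auto simp: influence_region_def)
  then show ?thesis using p eq by blast
qed

text \<open>Whether a cell has interior points is a global property, but a closed convex set with
  interior is the closure of its interior, so the interior is visible near every frontier point.
  Agreement on the open ball of the larger radius \<open>R'\<close> therefore transfers both the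
  frontier point and the non-empty interior.\<close>

lemma skel_laguerre_transfer_subset:
  assumes cover: "\<And>w. w \<in> cball 0 R' \<Longrightarrow> \<exists>p\<in>A. pow w p \<le> T"
    and eq: "A \<inter> influence_region R' T = A' \<inter> influence_region R' T"
    and R: "R < R'"
  shows "skel (laguerre A) \<inter> cball 0 R \<subseteq> skel (laguerre A')"
proof
  fix w assume "w \<in> skel (laguerre A) \<inter> cball 0 R"
  then obtain p where p: "p \<in> A" "interior (laguerre_cell p A) \<noteq> {}" 
      "w \<in> frontier (laguerre_cell p A)" and w: "norm w \<le> R"
    by (auto simp: skel_def laguerre_def)
  note cover' = cover_transfer[OF cover eq]
  let ?C = "laguerre_cell p A" and ?C' = "laguerre_cell p A'"
  have wC: "w \<in> ?C" using p(3) closed_laguerre_cell frontier_subset_closed by blast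
  have wR: "w \<in> cball 0 R'" using w R by simp
  have pA': "p \<in> A'" and wC': "w \<in> ?C'" using laguerre_cell_transfer[OF cover eq wR p(1) wC] by auto
  have same: "y \<in> ?C \<longleftrightarrow> y \<in> ?C'" if "y \<in> ball 0 R'" for y
  proof -
    have y: "y \<in> cball 0 R'" using that by auto
    show ?thesis using laguerre_cell_transfer[OF cover eq y p(1)]
        laguerre_cell_transfer[OF cover' eq[symmetric] y pA'] by blast
  qed
  then have eqU: "?C \<inter> ball 0 R' = ?C' \<inter> ball 0 R'" by auto
  have intU: "interior ?C \<inter> ball 0 R' = interior ?C' \<inter> ball 0 R'"
    using arg_cong[OF eqU, of interior] by (simp add: interior_Int)
  have wU: "w \<in> ball 0 R'" using w R by auto
  have "w \<in> closure (interior ?C)"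
    using convex_closure_interior[OF convex_laguerre_cell p(2)] wC closure_subset by blast
  then have "interior ?C \<inter> ball 0 R' \<noteq> {}"
    using wU open_ball open_Int_closure_eq_empty by blast
  then have ne: "interior ?C' \<noteq> {}" using intU by auto
  have "w \<notin> interior ?C" using p(3) by (simp add: frontier_def)
  then have "w \<notin> interior ?C'" using intU wU by blast
  then have "w \<in> frontier ?C'" using wC' closure_subset by (auto simp: frontier_def)
  then show "w \<in> skel (laguerre A')" using ne pA' unfolding skel_def laguerre_def by blast
qed

lemma skel_laguerre_transfer:
  assumes cover: "\<And>w. w \<in> cball 0 R' \<Longrightarrow> \<exists>p\<in>A. pow w p \<le> T"
    and eq: "A \<inter> influence_region R' T = A' \<inter> influence_region R' T"
    and R: "R < R'"
  shows "skel (laguerre A) \<inter> cball 0 R = skel (laguerre A') \<inter> cball 0 R"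
  using skel_laguerre_transfer_subset[OF cover eq R]
    skel_laguerre_transfer_subset[OF cover_transfer[OF cover eq] eq[symmetric] R]
  by auto

lemma closed_if_closed_Int_cball:
  fixes S :: "'a::euclidean_space set"
  assumes "\<And>R. closed (S \<inter> cball 0 R)"
  shows "closed S"
  unfolding closed_sequential_limits
proof (intro allI impI)
  fix x l assume x: "(\<forall>n. x n \<in> S) \<and> x \<longlonglongrightarrow> l"
  then obtain R where "\<And>n. norm (x n) \<le> R"
    by (metis convergent_imp_Bseq convergentI Bseq_def)
  then have "\<And>n. x n \<in> S \<inter> cball 0 R" using x by auto
  then show "l \<in> S" using assms[of R] x closed_sequentially by blast
qed

text \<open>Inside each ball only the finitely many points of an influence region can have a cell
  that meets the ball, so the skeleton is a locally finite union of closed frontiers.\<close>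

lemma closed_skel_laguerre:
  assumes "\<And>R. \<exists>R'\<ge>R. \<exists>T. (\<forall>w\<in>cball 0 R'. \<exists>p\<in>A. pow w p \<le> T) \<and> finite (A \<inter> influence_region R' T)"
  shows "closed (skel (laguerre A))"
proof (rule closed_if_closed_Int_cball)
  fix R
  obtain R' T where R': "R \<le> R'" and cover: "\<And>w. w\<in>cball 0 R' \<Longrightarrow> \<exists>p\<in>A. pow w p \<le> T"
    and fin: "finite (A \<inter> influence_region R' T)"
    using assms[of R] by blast
  let ?P = "{p \<in> A \<inter> influence_region R' T. interior (laguerre_cell p A) \<noteq> {}}"
  have "skel (laguerre A) \<inter> cball 0 R = (\<Union>p\<in>?P. frontier (laguerre_cell p A)) \<inter> cball 0 R"
    (is "?L = ?R")
  proof
    show "?L \<subseteq> ?R"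
    proof
      fix w assume "w \<in> ?L"
      then obtain p where p: "p \<in> A" "interior (laguerre_cell p A) \<noteq> {}" 
        "w \<in> frontier (laguerre_cell p A)" and w: "norm w \<le> R"
        by (auto simp: skel_def laguerre_def)
      have "w \<in> laguerre_cell p A" using p(3) closed_laguerre_cell frontier_subset_closed by blast
      then have "p \<in> influence_region R' T" 
        using laguerre_cell_transfer[where R = R' and w = w, OF cover refl _ p(1)] w R' by simp
      then show "w \<in> ?R" using p w by (intro IntI UN_I[of p]) (simp_all)
    qed
  qed (auto simp: skel_def laguerre_def)
  moreover have "finite ?P" using fin by (rule finite_subset[rotated]) auto
  ultimately show "closed (skel (laguerre A) \<inter> cball 0 R)" by auto
qed

text \<open>In \<open>pow z p \<le> pow z q\<close> the term quadratic in
  \<open>norm (z - u)\<close> cancels by \<open>pow_shift\<close>, which leaves a linear bound. The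
  factor \<open>norm u + 1\<close> offsets \<open>(z - u) \<bullet> u\<close> and keeps a surplus of
  one \<open>norm (z - u)\<close>.\<close>

lemma simplex_centre_bound:
  fixes A :: "('a::euclidean_space \<times> real) set"
  assumes lower: "\<And>p. p \<in> A \<Longrightarrow> - M \<le> pow u p"
    and surround: "\<And>e. \<exists>q\<in>A. (norm u + 1) * norm e \<le> e \<bullet> fst q \<and> pow u q \<le> C"
    and S: "S \<subseteq> A" "finite S" and z: "\<And>p. p \<in> S \<Longrightarrow> z \<in> laguerre_cell p A"
    and u: "u \<in> convex hull (fst ` S)"
  shows "2 * norm (z - u) \<le> C + M"
proof -
  have "\<exists>p\<in>S. (z - u) \<bullet> fst p \<le> (z - u) \<bullet> u"
  proof (rule ccontr)
    assume "\<not> ?thesis"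
    then have "fst ` S \<subseteq> {x. (z - u) \<bullet> x > (z - u) \<bullet> u}" by force
    then have "convex hull (fst ` S) \<subseteq> {x. (z - u) \<bullet> x > (z - u) \<bullet> u}"
      by (intro hull_minimal convex_halfspace_gt)
    then show False using u by auto
  qed
  then obtain p where p: "p \<in> S" "(z - u) \<bullet> fst p \<le> (z - u) \<bullet> u" by auto
  obtain q where q: "q \<in> A" "(norm u + 1) * norm (z - u) \<le> (z - u) \<bullet> fst q" "pow u q \<le> C"
    using surround[of "z - u"] by auto
  have "(z - u) \<bullet> u \<le> norm (z - u) * norm u" by (rule norm_cauchy_schwarz)
  then have q': "(z - u) \<bullet> (u - fst q) \<le> - norm (z - u)"
    using q(2) by (simp add: inner_diff_right algebra_simps)
  have "(norm (z - u))\<^sup>2 + pow u p + 2 * ((z - u) \<bullet> (u - fst p)) \<le>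
        (norm (z - u))\<^sup>2 + pow u q + 2 * ((z - u) \<bullet> (u - fst q))"
    using z[OF p(1)] q(1) by (simp add: laguerre_cell_def flip: pow_shift)
  moreover have "(z - u) \<bullet> (u - fst p) \<ge> 0" using p(2) by (simp add: inner_diff_right)
  moreover have "- M \<le> pow u p" using lower p(1) S by blast
  ultimately show ?thesis using q' q(3) by linarith
qed

lemma compact_simplex: "finite S \<Longrightarrow> compact (convex hull (fst ` S))"
  for S :: "('a::euclidean_space \<times> real) set"
  by (simp add: compact_convex_hull finite_imp_compact)

text \<open>A deterministic sufficient condition for both skeletons to be determined locally.
  \<open>T\<close> will run cofinally through the admissible heights \<open>E\<close>. The third
  clause asks for points arbitrarily far out in every orthant, \<open>s\<close> being its set of
  positive coordinates, under one common height bound.\<close>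

definition well_spread :: "(nat \<Rightarrow> real) \<Rightarrow> ('a::euclidean_space \<times> real) set \<Rightarrow> bool" where
  "well_spread T A \<longleftrightarrow>
     (\<forall>R. \<exists>k. \<forall>w\<in>cball 0 R. \<exists>p\<in>A. pow w p \<le> T k) \<and>
     (\<forall>k. finite (A \<inter> influence_region (real k) (T k))) \<and>
     (\<exists>k. \<forall>K::nat. \<forall>s. s \<subseteq> Basis \<longrightarrow>
        (\<exists>p\<in>A. snd p \<le> T k \<and> (\<forall>i\<in>Basis. if i \<in> s then real K \<le> fst p \<bullet> i else fst p \<bullet> i \<le> - real K)))"

lemma well_spread_cover:
  assumes "well_spread T A" "incseq T"
  shows "\<exists>k. R \<le> real k \<and> m \<le> k \<and> (\<forall>w\<in>cball 0 R. \<exists>p\<in>A. pow w p \<le> T k)"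
proof -
  obtain k where k: "\<forall>w\<in>cball 0 R. \<exists>p\<in>A. pow w p \<le> T k"
    using assms(1) unfolding well_spread_def by blast
  obtain l where l: "R \<le> real l" using real_arch_simple by blast
  let ?k = "max (max k l) m"
  have "T k \<le> T ?k" using assms(2) by (simp add: incseqD)
  then have "\<forall>w\<in>cball 0 R. \<exists>p\<in>A. pow w p \<le> T ?k" using k by force
  then show ?thesis using l by (intro exI[of _ ?k]) auto
qed

text \<open>The signs of \<open>e\<close> and \<open>v\<close> match coordinatewise, so the inner
  product is at least \<open>K\<close> times the l1 norm of \<open>e\<close>.\<close>

lemma norm_le_inner_orthant:
  fixes e v :: "'a::euclidean_space"
  assumes "0 \<le> K"
    and "\<And>i. i \<in> Basis \<Longrightarrow> if i \<in> {i. e \<bullet> i \<ge> 0} then K \<le> v \<bullet> i else v \<bullet> i \<le> - K"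
  shows "K * norm e \<le> e \<bullet> v"
proof -
  have "K * norm e \<le> K * (\<Sum>i\<in>Basis. \<bar>e \<bullet> i\<bar>)"
    using assms(1) by (intro mult_left_mono norm_le_l1)
  also have "\<dots> = (\<Sum>i\<in>Basis. K * \<bar>e \<bullet> i\<bar>)" by (simp add: sum_distrib_left)
  also have "\<dots> \<le> (\<Sum>i\<in>Basis. (e \<bullet> i) * (v \<bullet> i))"
  proof (rule sum_mono)
    fix i :: 'a assume i: "i \<in> Basis"
    show "K * \<bar>e \<bullet> i\<bar> \<le> (e \<bullet> i) * (v \<bullet> i)"
    proof (cases "e \<bullet> i \<ge> 0")
      case True
      then have "K * (e \<bullet> i) \<le> (v \<bullet> i) * (e \<bullet> i)" using assms(2)[OF i] by (intro mult_right_mono) auto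
      then show ?thesis using True by (simp add: mult.commute)
    next
      case False
      then have "K \<le> - (v \<bullet> i)" using assms(2)[OF i] by simp
      then have "K * (-(e \<bullet> i)) \<le> - (v \<bullet> i) * (- (e \<bullet> i))"
        using False by (intro mult_right_mono) auto
      then show ?thesis using False by (simp add: mult.commute)
    qed
  qed
  also have "\<dots> = e \<bullet> v" by (simp add: euclidean_inner[of e v])
  finally show ?thesis .
qed

text \<open>All data of the bound are read off from finitely many points in one influence region:
  one point per orthant for the upper estimate, the heights in the region for the lower one. Hence
  the same \<open>m\<close> and \<open>Q\<close> serve every \<open>A'\<close> that agrees with
  \<open>A\<close> there, in particular the approximating processes.\<close>

lemma well_spread_centre_bound:
  fixes A :: "('a::euclidean_space \<times> real) set"
  assumes spread: "well_spread T A" and T: "incseq T"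
  obtains m Q where "\<And>A' S u z. A' \<inter> influence_region (real m) (T m) = A \<inter> influence_region (real m) (T m) \<Longrightarrow>
      S \<subseteq> A' \<Longrightarrow> finite S \<Longrightarrow> (\<forall>p\<in>S. z \<in> laguerre_cell p A') \<Longrightarrow>
      u \<in> convex hull (fst ` S) \<Longrightarrow> norm u \<le> R \<Longrightarrow> norm z \<le> Q"
proof -
  obtain K :: nat where K: "R + 1 \<le> real K" using real_arch_simple by blast
  obtain k q where q: "\<And>s. s \<subseteq> Basis \<Longrightarrow> q s \<in> A \<and> snd (q s) \<le> T k \<and>
     (\<forall>i\<in>Basis. if i \<in> s then real K \<le> fst (q s) \<bullet> i else fst (q s) \<bullet> i \<le> - real K)"
    using spread unfolding well_spread_def by metis
  define F where "F = q ` Pow Basis"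
  have F: "finite F" "F \<subseteq> A" unfolding F_def using q by auto
  obtain B where B: "\<And>p. p \<in> F \<Longrightarrow> norm (fst p) \<le> B"
    using finite_imp_bounded[of "fst ` F"] F(1) by (auto simp: bounded_iff)
  \<comment> \<open>\<open>C\<close> bounds the power of the chosen orthant points at every
    \<open>u\<close> of the ball: distance at most \<open>R + B\<close>, height at most
    \<open>T k\<close>.\<close>
  define C where "C = (R + B)\<^sup>2 + T k"
  have C: "pow u p \<le> C" if "p \<in> F" "norm u \<le> R" for u p
  proof -
    have "norm (u - fst p) \<le> R + B" using B[OF that(1)] that(2) norm_triangle_ineq4[of u "fst p"] by linarith
    then have "(norm (u - fst p))\<^sup>2 \<le> (R + B)\<^sup>2" by (intro power_mono) auto
    then show ?thesis using q that(1) by (auto simp: pow_def C_def F_def intro: add_mono)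
  qed
  obtain l where l: "B \<le> real l" using real_arch_simple by blast
  obtain l' where l': "R \<le> real l'" using real_arch_simple by blast
  define m where "m = max k (max l l')"
  have Tm: "T k \<le> T m" using T by (simp add: incseqD m_def)
  have Fm: "F \<subseteq> influence_region (real m) (T m)"
  proof
    fix p assume p: "p \<in> F"
    have "pow (fst p) p \<le> T m" using p q Tm by (force simp: pow_def F_def)
    moreover have "norm (fst p) \<le> real m" using B[OF p] l by (simp add: m_def)
    ultimately show "p \<in> influence_region (real m) (T m)"
      by (auto simp: influence_region_def intro!: bexI[of _ "fst p"])
  qed
  have "finite (A \<inter> influence_region (real m) (T m))" using spread by (simp add: well_spread_def)
  then obtain M0 where M0: "\<And>p. p \<in> A \<inter> influence_region (real m) (T m) \<Longrightarrow> \<bar>snd p\<bar> \<le> M0"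
    using finite_imp_bounded[of "snd ` (A \<inter> influence_region (real m) (T m))"] by (auto simp: bounded_iff)
  \<comment> \<open>Points inside the region have height at least \<open>- M0\<close>; all others
    have power above \<open>T m\<close> at \<open>u\<close>. So \<open>- M\<close> bounds the power
    at \<open>u\<close> from below for every point of \<open>A'\<close>.\<close>
  define M where "M = max M0 (- T m)"
  show thesis
  proof (rule that[of m "R + \<bar>C + M\<bar>"])
    fix A' S u z
    assume eq: "A' \<inter> influence_region (real m) (T m) = A \<inter> influence_region (real m) (T m)"
      and S: "S \<subseteq> A'" "finite S" "\<forall>p\<in>S. z \<in> laguerre_cell p A'"
      and u: "u \<in> convex hull (fst ` S)" "norm u \<le> R"
    have "2 * norm (z - u) \<le> C + M"
    proof (rule simplex_centre_bound[OF _ _ S(1,2) _ u(1)])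
      fix p assume p: "p \<in> A'"
      show "- M \<le> pow u p"
      proof (cases "pow u p \<le> T m")
        case True
        have "norm u \<le> real m" using u(2) l' by (simp add: m_def)
        with True have "p \<in> influence_region (real m) (T m)"
          by (auto simp: influence_region_def)
        then have "\<bar>snd p\<bar> \<le> M0" using M0 p eq by blast
        then show ?thesis using snd_le_pow[of p u] by (simp add: M_def)
      qed (simp add: M_def)
    next
      fix e :: 'a
      let ?s = "{i. e \<bullet> i \<ge> 0} \<inter> Basis"
      let ?p = "q ?s"
      have p: "?p \<in> F" by (auto simp: F_def)
      have "real K * norm e \<le> e \<bullet> fst ?p"
        by (rule norm_le_inner_orthant) (use q[of ?s] in auto)
      moreover have "(norm u + 1) * norm e \<le> real K * norm e"
        using u(2) K by (intro mult_right_mono) auto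
      moreover have "?p \<in> A'" using p F Fm eq by blast
      ultimately show "\<exists>q\<in>A'. (norm u + 1) * norm e \<le> e \<bullet> fst q \<and> pow u q \<le> C"
        using C[OF p u(2)] by (intro bexI[of _ ?p]) auto
    qed (use S in auto)
    then have "norm (z - u) \<le> \<bar>C + M\<bar>" using norm_ge_zero[of "z - u"] by linarith
    then show "norm z \<le> R + \<bar>C + M\<bar>" using u(2) norm_triangle_ineq[of u "z - u"] by simp
  qed
qed

lemma simplex_transfer:
  fixes A :: "('a::euclidean_space \<times> real) set"
  assumes cover: "\<And>w. w \<in> cball 0 Q \<Longrightarrow> \<exists>p\<in>A. pow w p \<le> T"
    and eq: "A \<inter> influence_region Q T = A' \<inter> influence_region Q T"
    and S: "S \<subseteq> A" and z: "norm z \<le> Q" "\<forall>p\<in>S. z \<in> laguerre_cell p A"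
  shows "S \<subseteq> A' \<and> (\<forall>p\<in>S. z \<in> laguerre_cell p A') \<and> S \<subseteq> influence_region Q T"
  using laguerre_cell_transfer[OF cover eq, of z] assms by auto

lemma skel_dual_laguerre:
  "w \<in> skel (dual_laguerre A) \<longleftrightarrow>
     (\<exists>S z. S \<subseteq> A \<and> finite S \<and> card S = DIM('a) + 1 \<and> (\<forall>p\<in>S. z \<in> laguerre_cell p A) \<and>
        w \<in> frontier (convex hull (fst ` S)))"
  for A :: "('a::euclidean_space \<times> real) set"
  unfolding skel_def dual_laguerre_def by blast

lemma frontier_simplex_subset: "finite S \<Longrightarrow> frontier (convex hull (fst ` S)) \<subseteq> convex hull (fst ` S)"
  for S :: "('a::euclidean_space \<times> real) set"
  by (simp add: compact_simplex compact_imp_closed frontier_subset_closed)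

text \<open>A simplex that meets the ball of radius \<open>R\<close> is decided at the common point
  \<open>z\<close> of its cells, which may lie far outside that ball. The cover is therefore taken
  on the ball of radius \<open>Q\<close> containing all such \<open>z\<close>, and the final region
  has to include both the one for this cover and the one from which \<open>Q\<close> was
  found.\<close>

lemma well_spread_skel_dual:
  fixes A :: "('a::euclidean_space \<times> real) set"
  assumes spread: "well_spread T A" and T: "incseq T"
  shows "\<exists>k. (\<forall>A'. A' \<inter> influence_region (real k) (T k) = A \<inter> influence_region (real k) (T k) \<longrightarrow>
      skel (dual_laguerre A') \<inter> cball 0 R = skel (dual_laguerre A) \<inter> cball 0 R)"
    and "closed (skel (dual_laguerre A) \<inter> cball 0 R)"
proof -
  obtain m Q where mQ: "\<And>A' S u z. A' \<inter> influence_region (real m) (T m) = A \<inter> influence_region (real m) (T m) \<Longrightarrow>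
      S \<subseteq> A' \<Longrightarrow> finite S \<Longrightarrow> (\<forall>p\<in>S. z \<in> laguerre_cell p A') \<Longrightarrow>
      u \<in> convex hull (fst ` S) \<Longrightarrow> norm u \<le> R \<Longrightarrow> norm z \<le> Q"
    using well_spread_centre_bound[OF spread T] by metis
  obtain k where k: "Q \<le> real k" "m \<le> k" and cover: "\<forall>w\<in>cball 0 Q. \<exists>p\<in>A. pow w p \<le> T k"
    using well_spread_cover[OF spread T] by blast
  have sub1: "influence_region (real m) (T m) \<subseteq> (influence_region (real k) (T k) :: ('a \<times> real) set)"
    using k T by (intro influence_region_mono) (auto simp: incseqD)
  have sub2: "influence_region Q (T k) \<subseteq> (influence_region (real k) (T k) :: ('a \<times> real) set)"
    using k by (intro influence_region_mono) auto
  show "\<exists>k. (\<forall>A'. A' \<inter> influence_region (real k) (T k) = A \<inter> influence_region (real k) (T k) \<longrightarrow>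
      skel (dual_laguerre A') \<inter> cball 0 R = skel (dual_laguerre A) \<inter> cball 0 R)"
  proof (intro exI[of _ k] allI impI)
    fix A' assume eq: "A' \<inter> influence_region (real k) (T k) = A \<inter> influence_region (real k) (T k)"
    have eqm: "A' \<inter> influence_region (real m) (T m) = A \<inter> influence_region (real m) (T m)"
      using eq sub1 by blast
    have eqQ: "A \<inter> influence_region Q (T k) = A' \<inter> influence_region Q (T k)"
      using eq sub2 by blast
    have cover': "\<exists>p\<in>A'. pow w p \<le> T k" if "w \<in> cball 0 Q" for w
      using cover_transfer[OF _ eqQ that] cover by blast
    have "w \<in> skel (dual_laguerre A') \<longleftrightarrow> w \<in> skel (dual_laguerre A)" if w: "norm w \<le> R" for w
    proof
      assume "w \<in> skel (dual_laguerre A')"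
      then obtain S z where S: "S \<subseteq> A'" "finite S" "card S = DIM('a) + 1"
        "\<forall>p\<in>S. z \<in> laguerre_cell p A'" "w \<in> frontier (convex hull (fst ` S))"
        unfolding skel_dual_laguerre by blast
      have "norm z \<le> Q" using mQ[OF eqm S(1,2,4) _ w] S(2,5) frontier_simplex_subset by blast
      then show "w \<in> skel (dual_laguerre A)"
        using simplex_transfer[OF cover' eqQ[symmetric] S(1) _ S(4)] S(2,3,5)
        unfolding skel_dual_laguerre by blast
    next
      assume "w \<in> skel (dual_laguerre A)"
      then obtain S z where S: "S \<subseteq> A" "finite S" "card S = DIM('a) + 1"
        "\<forall>p\<in>S. z \<in> laguerre_cell p A" "w \<in> frontier (convex hull (fst ` S))"
        unfolding skel_dual_laguerre by blast
      have "norm z \<le> Q" using mQ[OF refl S(1,2,4) _ w] S(2,5) frontier_simplex_subset by blast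
      then show "w \<in> skel (dual_laguerre A')"
        using simplex_transfer[OF _ eqQ S(1) _ S(4)] cover S(2,3,5)
        unfolding skel_dual_laguerre by blast
    qed
    then show "skel (dual_laguerre A') \<inter> cball 0 R = skel (dual_laguerre A) \<inter> cball 0 R"
      by auto
  qed
  let ?P = "{S. S \<subseteq> A \<inter> influence_region (real k) (T k) \<and> card S = DIM('a) + 1 \<and>
      (\<exists>z. \<forall>p\<in>S. z \<in> laguerre_cell p A)}"
  have fin: "finite (A \<inter> influence_region (real k) (T k))" using spread by (simp add: well_spread_def)
  have "skel (dual_laguerre A) \<inter> cball 0 R = (\<Union>S\<in>?P. frontier (convex hull (fst ` S))) \<inter> cball 0 R"
    (is "?L = ?R")
  proof
    show "?L \<subseteq> ?R"
    proof
      fix w assume "w \<in> ?L"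
      then obtain S z where S: "S \<subseteq> A" "finite S" "card S = DIM('a) + 1"
        "\<forall>p\<in>S. z \<in> laguerre_cell p A" "w \<in> frontier (convex hull (fst ` S))" and w: "norm w \<le> R"
        unfolding skel_dual_laguerre Int_iff by auto
      have "norm z \<le> Q" using mQ[OF refl S(1,2,4) _ w] S(2,5) frontier_simplex_subset by blast
      then have "S \<subseteq> influence_region (real k) (T k)"
        using simplex_transfer[OF _ refl S(1) _ S(4)] cover sub2 by blast
      then show "w \<in> ?R" using S w by auto
    qed
    show "?R \<subseteq> ?L"
    proof
      fix w assume "w \<in> ?R"
      then obtain S where "S \<in> ?P" "w \<in> frontier (convex hull (fst ` S))" "w \<in> cball 0 R" by blast
      moreover then have "finite S" using fin finite_subset by blast
      ultimately show "w \<in> ?L" unfolding Int_iff skel_dual_laguerre by blast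
    qed
  qed
  moreover have "finite ?P"
    by (rule finite_subset[OF _ finite_Pow_iff[THEN iffD2, OF fin]]) auto
  ultimately show "closed (skel (dual_laguerre A) \<inter> cball 0 R)" by auto
qed

text \<open>The threshold depends on the configuration. Stating the third claim for all
  \<open>l \<ge> k\<close> makes it usable along any levels that tend to infinity, as the later
  Borel-Cantelli argument requires.\<close>

lemma well_spread_skel:
  fixes A :: "('a::euclidean_space \<times> real) set"
  assumes spread: "well_spread T A" and T: "incseq T"
  shows "closed (skel (laguerre A))" "closed (skel (dual_laguerre A))"
    "\<exists>k. \<forall>l\<ge>k. \<forall>A'. A' \<inter> influence_region (real l) (T l) = A \<inter> influence_region (real l) (T l) \<longrightarrow>
      skel (laguerre A') \<inter> cball 0 R = skel (laguerre A) \<inter> cball 0 R \<and>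
      skel (dual_laguerre A') \<inter> cball 0 R = skel (dual_laguerre A) \<inter> cball 0 R"
proof -
  show "closed (skel (laguerre A))"
  proof (rule closed_skel_laguerre)
    fix R
    obtain k where k: "R \<le> real k" "\<forall>w\<in>cball 0 R. \<exists>p\<in>A. pow w p \<le> T k"
      using well_spread_cover[OF spread T] by blast
    have "finite (A \<inter> influence_region (real k) (T k))" using spread by (simp add: well_spread_def)
    moreover have "A \<inter> influence_region R (T k) \<subseteq> A \<inter> influence_region (real k) (T k)"
      using influence_region_mono[OF k(1)] by blast
    ultimately have "finite (A \<inter> influence_region R (T k))" using finite_subset by blast
    then show "\<exists>R'\<ge>R. \<exists>T. (\<forall>w\<in>cball 0 R'. \<exists>p\<in>A. pow w p \<le> T) \<and> finite (A \<inter> influence_region R' T)"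
      using k(2) by blast
  qed
  show "closed (skel (dual_laguerre A))"
    using closed_if_closed_Int_cball well_spread_skel_dual(2)[OF spread T] by blast
  obtain k1 where k1: "\<And>A'. A' \<inter> influence_region (real k1) (T k1) = A \<inter> influence_region (real k1) (T k1) \<Longrightarrow>
      skel (dual_laguerre A') \<inter> cball 0 R = skel (dual_laguerre A) \<inter> cball 0 R"
    using well_spread_skel_dual(1)[OF spread T] by blast
  \<comment> \<open>The extra 1 in the radius is the margin required by
    \<open>skel_laguerre_transfer\<close>.\<close>
  obtain k2 where k2: "R + 1 \<le> real k2" and cover: "\<forall>w\<in>cball 0 (R + 1). \<exists>p\<in>A. pow w p \<le> T k2"
    using well_spread_cover[OF spread T, of "R + 1"] by blast
  show "\<exists>k. \<forall>l\<ge>k. \<forall>A'. A' \<inter> influence_region (real l) (T l) = A \<inter> influence_region (real l) (T l) \<longrightarrow>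
      skel (laguerre A') \<inter> cball 0 R = skel (laguerre A) \<inter> cball 0 R \<and>
      skel (dual_laguerre A') \<inter> cball 0 R = skel (dual_laguerre A) \<inter> cball 0 R"
  proof (intro exI[of _ "max k1 k2"] allI impI)
    fix l A' assume l: "max k1 k2 \<le> l"
      and eq: "A' \<inter> influence_region (real l) (T l) = A \<inter> influence_region (real l) (T l)"
    have "influence_region (real k1) (T k1) \<subseteq> (influence_region (real l) (T l) :: ('a \<times> real) set)"
      using l T by (intro influence_region_mono) (auto simp: incseqD)
    then have 1: "A' \<inter> influence_region (real k1) (T k1) = A \<inter> influence_region (real k1) (T k1)"
      using eq by blast
    have "influence_region (R + 1) (T k2) \<subseteq> (influence_region (real l) (T l) :: ('a \<times> real) set)"
      using l T k2 by (intro influence_region_mono) (auto simp: incseqD)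
    then have 2: "A \<inter> influence_region (R + 1) (T k2) = A' \<inter> influence_region (R + 1) (T k2)"
      using eq by blast
    have "skel (laguerre A) \<inter> cball 0 R = skel (laguerre A') \<inter> cball 0 R"
      using cover by (intro skel_laguerre_transfer[OF _ 2]) auto
    then show "skel (laguerre A') \<inter> cball 0 R = skel (laguerre A) \<inter> cball 0 R \<and>
      skel (dual_laguerre A') \<inter> cball 0 R = skel (dual_laguerre A) \<inter> cball 0 R"
      using k1[OF 1] by simp
  qed
qed

subsection \<open>Measurability of hitting events\<close>

lemma pred_countable_bex:
  assumes X: "countable X" and P: "\<And>i. i \<in> X \<Longrightarrow> Measurable.pred M (P i)"
  shows "Measurable.pred M (\<lambda>x. \<exists>i\<in>X. P i x)"
proof -
  have "{x\<in>space M. \<exists>i\<in>X. P i x} = (\<Union>i\<in>X. {x\<in>space M. P i x})" by auto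
  moreover have "{x\<in>space M. P i x} \<in> sets M" if "i \<in> X" for i
    using P[OF that] by (simp add: pred_def)
  ultimately show ?thesis unfolding pred_def using X by (auto intro!: sets.countable_UN')
qed

text \<open>The witness ranges over an uncountable set. By compactness it exists if and only if, for
  every \<open>j\<close>, some point of a countable dense subset satisfies the first
  \<open>j + 1\<close> constraints up to \<open>1 / (j + 1)\<close>: a limit point of such
  approximate solutions satisfies all constraints.\<close>

lemma measurable_hit_sublevel:
  fixes g :: "'i::countable \<Rightarrow> 'w \<Rightarrow> 'a::euclidean_space \<Rightarrow> real"
  assumes cont: "\<And>m \<omega>. continuous_on UNIV (g m \<omega>)"
    and meas [measurable]: "\<And>m w. (\<lambda>\<omega>. g m \<omega> w) \<in> borel_measurable M"
    and K: "compact K"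
  shows "{\<omega>\<in>space M. \<exists>w\<in>K. \<forall>m. g m \<omega> w \<le> 0} \<in> sets M"
proof -
  obtain D where D: "countable D" "D \<subseteq> K" "K \<subseteq> closure D"
    using separable[of K] by blast
  have eq: "(\<exists>w\<in>K. \<forall>m. g m \<omega> w \<le> 0) \<longleftrightarrow>
      (\<forall>j::nat. \<exists>w\<in>D. \<forall>n\<in>{..j}. g (from_nat n) \<omega> w < 1 / (Suc j))" for \<omega>
  proof
    assume "\<exists>w\<in>K. \<forall>m. g m \<omega> w \<le> 0"
    then obtain w where w: "w \<in> K" "\<And>m. g m \<omega> w \<le> 0" by blast
    show "\<forall>j::nat. \<exists>w\<in>D. \<forall>n\<in>{..j}. g (from_nat n) \<omega> w < 1 / (Suc j)"
    proof
      fix j :: nat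
      let ?U = "\<Inter>n\<in>{..j}. {w. g (from_nat n) \<omega> w < 1 / (Suc j)}"
      have "open ?U" using cont by (intro open_INT ballI open_Collect_less continuous_intros) auto
      moreover have "w \<in> ?U" using w(2) by (auto intro: le_less_trans[OF w(2)])
      moreover have "w \<in> closure D" using w D by auto
      ultimately have "D \<inter> ?U \<noteq> {}"
        using open_Int_closure_eq_empty[of ?U D] by blast
      then show "\<exists>w\<in>D. \<forall>n\<in>{..j}. g (from_nat n) \<omega> w < 1 / (Suc j)" by blast
    qed
  next
    assume "\<forall>j::nat. \<exists>w\<in>D. \<forall>n\<in>{..j}. g (from_nat n) \<omega> w < 1 / (Suc j)"
    then have "\<forall>j::nat. \<exists>w. w \<in> D \<and> (\<forall>n\<in>{..j}. g (from_nat n) \<omega> w < 1 / (Suc j))" by blast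
    from choice[OF this] obtain x
      where x: "\<And>j. x j \<in> D" "\<And>j n. n \<le> j \<Longrightarrow> g (from_nat n) \<omega> (x j) < 1 / (Suc j)"
      by auto
    have "\<forall>j. x j \<in> K" using x D by auto
    then obtain l r where l: "l \<in> K" "strict_mono (r::nat\<Rightarrow>nat)" "(x \<circ> r) \<longlonglongrightarrow> l"
      using seq_compactE[OF compact_imp_seq_compact[OF K]] by blast
    have "g m \<omega> l \<le> 0" for m
    proof -
      obtain n where n: "m = from_nat n" using surj_from_nat by (metis surjD)
      have "(\<lambda>j. g m \<omega> ((x \<circ> r) j)) \<longlonglongrightarrow> g m \<omega> l"
        using cont l(3) by (auto simp: continuous_on_sequentially o_def)
      moreover have "(\<lambda>j. 1 / real (Suc (r j))) \<longlonglongrightarrow> 0"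
        using LIMSEQ_subseq_LIMSEQ[OF LIMSEQ_inverse_real_of_nat l(2)]
        by (simp add: o_def inverse_eq_divide)
      moreover have "\<forall>\<^sub>F j in sequentially. g m \<omega> ((x \<circ> r) j) \<le> 1 / real (Suc (r j))"
        using eventually_ge_at_top[of n]
      proof eventually_elim
        case (elim j)
        then have "n \<le> r j" using seq_suble[OF l(2), of j] by linarith
        then show ?case using x(2)[of n "r j"] n by simp
      qed
      ultimately show ?thesis by (intro tendsto_le[OF _ _ _ , of sequentially]) auto
    qed
    then show "\<exists>w\<in>K. \<forall>m. g m \<omega> w \<le> 0" using l by blast
  qed
  have "Measurable.pred M (\<lambda>\<omega>. \<forall>j::nat. \<exists>w\<in>D. \<forall>n\<in>{..j}. g (from_nat n) \<omega> w < 1 / (Suc j))"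
    by (intro pred_intros_countable(1) pred_countable_bex[OF D(1)]) measurable
  then show ?thesis unfolding eq by (simp add: pred_def)
qed

lemma obtain_dense_sequence:
  obtains c :: "nat \<Rightarrow> 'a::euclidean_space"
  where "\<And>U. open U \<Longrightarrow> U \<noteq> {} \<Longrightarrow> \<exists>i. c i \<in> U"
proof -
  obtain D :: "'a set" where "countable D \<and> (\<forall>X. open X \<longrightarrow> X \<noteq> {} \<longrightarrow> (\<exists>d\<in>D. d \<in> X))"
    using countable_dense_exists[where 'a = 'a] by (elim exE)
  then have D: "countable D" "\<And>X. open X \<Longrightarrow> X \<noteq> {} \<Longrightarrow> \<exists>d\<in>D. d \<in> X" by simp_all
  have "D \<noteq> {}" using D(2)[of UNIV] by auto
  then have "range (from_nat_into D) = D" using D(1) by (rule range_from_nat_into)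
  then show thesis using D(2) by (intro that[of "from_nat_into D"]) (metis imageE)
qed

lemma dense_sequence_ball:
  fixes c :: "nat \<Rightarrow> 'a::euclidean_space"
  assumes c: "\<And>U. open U \<Longrightarrow> U \<noteq> {} \<Longrightarrow> \<exists>i. c i \<in> U" and U: "open U" "x \<in> U"
  shows "\<exists>i j. x \<in> ball (c i) (1 / real (Suc j)) \<and> cball (c i) (1 / real (Suc j)) \<subseteq> U"
proof -
  obtain e where e: "e > 0" "ball x e \<subseteq> U" using U open_contains_ball by blast
  obtain j where j: "1 / real (Suc j) < e / 2" using e(1) nat_approx_posE[of "e/2"] by auto
  obtain i where i: "c i \<in> ball x (1 / real (Suc j))" using c[of "ball x (1 / real (Suc j))"] by auto
  have "cball (c i) (1 / real (Suc j)) \<subseteq> ball x e"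
  proof
    fix y assume "y \<in> cball (c i) (1 / real (Suc j))"
    then have "dist x y < e" using i j dist_triangle[of x y "c i"] by auto
    then show "y \<in> ball x e" by simp
  qed
  then show ?thesis using i e(2) by (intro exI[of _ i] exI[of _ j]) (auto simp: dist_commute)
qed

section \<open>Random closed sets cut out by countably many continuous inequalities\<close>

context
  fixes h :: "'i::countable \<Rightarrow> 'w \<Rightarrow> 'a::euclidean_space \<Rightarrow> real" and M :: "'w measure"
    and C :: "'w \<Rightarrow> 'a set"
  assumes cont: "\<And>m \<omega>. continuous_on UNIV (h m \<omega>)"
    and meas [measurable]: "\<And>m w. (\<lambda>\<omega>. h m \<omega> w) \<in> borel_measurable M"
    and C: "\<And>\<omega>. C \<omega> = {w. \<forall>m. h m \<omega> w \<le> 0}"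
begin

lemma closed_sublevel: "closed (C \<omega>)"
proof -
  have "C \<omega> = (\<Inter>m. {w. h m \<omega> w \<le> 0})" by (auto simp: C)
  then show ?thesis using cont by (auto intro!: closed_INT closed_Collect_le continuous_intros)
qed

text \<open>The set is closed, so an open ball lies in it as soon as a dense set of points of the
  ball does.\<close>

lemma pred_ball_subset_sublevel: "Measurable.pred M (\<lambda>\<omega>. ball x r \<subseteq> C \<omega>)"
proof -
  obtain c :: "nat \<Rightarrow> 'a" where c: "\<And>U. open U \<Longrightarrow> U \<noteq> {} \<Longrightarrow> \<exists>i. c i \<in> U"
    using obtain_dense_sequence by blast
  have "ball x r \<subseteq> C \<omega> \<longleftrightarrow> (\<forall>i\<in>{i. c i \<in> ball x r}. \<forall>m. h m \<omega> (c i) \<le> 0)" for \<omega>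
  proof
    assume R: "\<forall>i\<in>{i. c i \<in> ball x r}. \<forall>m. h m \<omega> (c i) \<le> 0"
    show "ball x r \<subseteq> C \<omega>"
    proof (rule ccontr)
      assume "\<not> ball x r \<subseteq> C \<omega>"
      then have "ball x r - C \<omega> \<noteq> {}" by auto
      moreover have "open (ball x r - C \<omega>)" using closed_sublevel by auto
      ultimately obtain i where "c i \<in> ball x r - C \<omega>" using c by meson
      then show False using R by (auto simp: C)
    qed
  qed (auto simp: C)
  then show ?thesis by simp
qed

lemma pred_interior_sublevel: "Measurable.pred M (\<lambda>\<omega>. interior (C \<omega>) \<noteq> {})"
proof -
  obtain c :: "nat \<Rightarrow> 'a" where c: "\<And>U. open U \<Longrightarrow> U \<noteq> {} \<Longrightarrow> \<exists>i. c i \<in> U"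
    using obtain_dense_sequence by blast
  have "interior (C \<omega>) \<noteq> {} \<longleftrightarrow> (\<exists>i j. ball (c i) (1 / real (Suc j)) \<subseteq> C \<omega>)" for \<omega>
  proof
    assume "interior (C \<omega>) \<noteq> {}"
    then obtain x where "x \<in> interior (C \<omega>)" by auto
    then show "\<exists>i j. ball (c i) (1 / real (Suc j)) \<subseteq> C \<omega>"
      using dense_sequence_ball[OF c, of "interior (C \<omega>)" x] interior_subset ball_subset_cball
      by (meson open_interior subset_trans)
  next
    assume "\<exists>i j. ball (c i) (1 / real (Suc j)) \<subseteq> C \<omega>"
    then obtain i j where "ball (c i) (1 / real (Suc j)) \<subseteq> interior (C \<omega>)"
      using interior_maximal by blast
    moreover have "c i \<in> ball (c i) (1 / real (Suc j))" by simp
    ultimately show "interior (C \<omega>) \<noteq> {}" by blast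
  qed
  then show ?thesis using pred_ball_subset_sublevel by simp
qed

text \<open>The frontier is a set of the same kind: a point avoids the interior if and only if it
  avoids every basic ball contained in the set. Each such ball contributes the constraint
  \<open>1 / real (Suc j) - dist (c i) w \<le> 0\<close>; for the other balls the value 0 makes the
  constraint vacuous.\<close>

lemma pred_frontier_sublevel:
  assumes K: "compact K"
  shows "Measurable.pred M (\<lambda>\<omega>. frontier (C \<omega>) \<inter> K \<noteq> {})"
proof -
  obtain c :: "nat \<Rightarrow> 'a" where c: "\<And>U. open U \<Longrightarrow> U \<noteq> {} \<Longrightarrow> \<exists>i. c i \<in> U"
    using obtain_dense_sequence by blast
  define g :: "'i + nat \<times> nat \<Rightarrow> 'w \<Rightarrow> 'a \<Rightarrow> real" where
    "g = (\<lambda>t \<omega> w. case t of Inl m \<Rightarrow> h m \<omega> w | Inr (i, j) \<Rightarrow>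
       (if ball (c i) (1 / real (Suc j)) \<subseteq> C \<omega> then 1 / real (Suc j) - dist (c i) w else 0))"
  have eq: "frontier (C \<omega>) \<inter> K \<noteq> {} \<longleftrightarrow> (\<exists>w\<in>K. \<forall>t. g t \<omega> w \<le> 0)" for \<omega>
  proof -
    have "w \<in> frontier (C \<omega>) \<longleftrightarrow> (\<forall>t. g t \<omega> w \<le> 0)" for w
    proof -
      have 1: "w \<in> interior (C \<omega>) \<longleftrightarrow> (\<exists>i j. w \<in> ball (c i) (1 / real (Suc j)) \<and> ball (c i) (1 / real (Suc j)) \<subseteq> C \<omega>)"
      proof
        assume "w \<in> interior (C \<omega>)"
        then show "\<exists>i j. w \<in> ball (c i) (1 / real (Suc j)) \<and> ball (c i) (1 / real (Suc j)) \<subseteq> C \<omega>"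
          using dense_sequence_ball[OF c, of "interior (C \<omega>)" w] interior_subset ball_subset_cball
          by (meson open_interior subset_trans)
      next
        assume "\<exists>i j. w \<in> ball (c i) (1 / real (Suc j)) \<and> ball (c i) (1 / real (Suc j)) \<subseteq> C \<omega>"
        then show "w \<in> interior (C \<omega>)" using interior_maximal[OF _ open_ball] by blast
      qed
      have "w \<in> frontier (C \<omega>) \<longleftrightarrow> w \<in> C \<omega> \<and> w \<notin> interior (C \<omega>)"
        using closed_sublevel by (auto simp: frontier_def)
      also have "\<dots> \<longleftrightarrow> (\<forall>m. g (Inl m) \<omega> w \<le> 0) \<and> (\<forall>i j. g (Inr (i, j)) \<omega> w \<le> 0)"
        unfolding 1 by (auto simp: g_def C not_less)
      also have "\<dots> \<longleftrightarrow> (\<forall>t. g t \<omega> w \<le> 0)"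
        by (metis (full_types) sumE surj_pair)
      finally show ?thesis .
    qed
    then show ?thesis by blast
  qed
  have "{\<omega>\<in>space M. \<exists>w\<in>K. \<forall>t. g t \<omega> w \<le> 0} \<in> sets M"
  proof (rule measurable_hit_sublevel[OF _ _ K])
    show "continuous_on UNIV (g t \<omega>)" for t \<omega>
    proof (cases t)
      case (Inr ij)
      obtain i j where "ij = (i, j)" by (cases ij)
      then show ?thesis unfolding g_def Inr
        by (cases "ball (c i) (1 / real (Suc j)) \<subseteq> C \<omega>") (simp_all add: continuous_intros)
    qed (simp add: g_def cont)
    show "(\<lambda>\<omega>. g t \<omega> w) \<in> borel_measurable M" for t w
    proof (cases t)
      case (Inr ij)
      then show ?thesis
        using pred_ball_subset_sublevel by (cases ij) (auto simp: g_def intro!: measurable_If)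
    qed (simp add: g_def)
  qed
  then show ?thesis unfolding eq by (simp add: pred_def)
qed

lemma pred_nonempty_sublevel: "Measurable.pred M (\<lambda>\<omega>. C \<omega> \<noteq> {})"
proof -
  have "C \<omega> \<noteq> {} \<longleftrightarrow> (\<exists>n::nat. \<exists>w\<in>cball 0 (real n). \<forall>m. h m \<omega> w \<le> 0)" for \<omega>
  proof -
    have "\<exists>n::nat. w \<in> cball 0 (real n)" for w :: 'a using real_arch_simple[of "norm w"] by simp
    then show ?thesis unfolding C by blast
  qed
  moreover have "Measurable.pred M (\<lambda>\<omega>. \<exists>w\<in>cball 0 (real n). \<forall>m. h m \<omega> w \<le> 0)" for n
    unfolding pred_def by (rule measurable_hit_sublevel[OF cont meas compact_cball])
  ultimately show ?thesis by simp
qed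

end

text \<open>A point of one closed set outside the other lies in a small closed ball that misses the
  other. Countably many balls suffice for this, so a difference on \<open>K\<close> is detected by a
  trace of such a ball on \<open>K\<close> that only one of the two sets hits.\<close>

lemma pred_hits_differ:
  fixes Z Z' :: "'w \<Rightarrow> 'a::euclidean_space set"
  assumes cl: "\<And>\<omega>. closed (Z \<omega>)" "\<And>\<omega>. closed (Z' \<omega>)"
    and hit: "\<And>K. compact K \<Longrightarrow> Measurable.pred M (\<lambda>\<omega>. Z \<omega> \<inter> K \<noteq> {})"
      "\<And>K. compact K \<Longrightarrow> Measurable.pred M (\<lambda>\<omega>. Z' \<omega> \<inter> K \<noteq> {})"
    and K: "compact K"
  shows "Measurable.pred M (\<lambda>\<omega>. Z \<omega> \<inter> K \<noteq> Z' \<omega> \<inter> K)"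
proof -
  obtain c :: "nat \<Rightarrow> 'a" where c: "\<And>U. open U \<Longrightarrow> U \<noteq> {} \<Longrightarrow> \<exists>i. c i \<in> U"
    using obtain_dense_sequence by blast
  define B where "B i j = K \<inter> cball (c i) (1 / real (Suc j))" for i j
  have B: "compact (B i j)" "B i j \<subseteq> K" for i j using K by (auto simp: B_def intro: compact_Int)
  have 1: "\<exists>i j. X \<inter> B i j \<noteq> {} \<and> Y \<inter> B i j = {}" if "x \<in> X \<inter> K" "x \<notin> Y" "closed Y" for X Y x
  proof -
    have "open (- Y)" "x \<in> - Y" using that by auto
    then obtain i j where "x \<in> ball (c i) (1 / real (Suc j))" "cball (c i) (1 / real (Suc j)) \<subseteq> - Y"
      using dense_sequence_ball[OF c] by meson
    moreover then have "x \<in> cball (c i) (1 / real (Suc j))" using ball_subset_cball by blast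
    ultimately show ?thesis using that by (intro exI[of _ i] exI[of _ j]) (auto simp: B_def)
  qed
  have "Z \<omega> \<inter> K \<noteq> Z' \<omega> \<inter> K \<longleftrightarrow> (\<exists>i j. (Z \<omega> \<inter> B i j \<noteq> {} \<and> \<not> Z' \<omega> \<inter> B i j \<noteq> {}) \<or>
      (\<not> Z \<omega> \<inter> B i j \<noteq> {} \<and> Z' \<omega> \<inter> B i j \<noteq> {}))" for \<omega>
  proof
    assume "Z \<omega> \<inter> K \<noteq> Z' \<omega> \<inter> K"
    then obtain x where "(x \<in> Z \<omega> \<inter> K \<and> x \<notin> Z' \<omega>) \<or> (x \<in> Z' \<omega> \<inter> K \<and> x \<notin> Z \<omega>)" by blast
    then show "\<exists>i j. (Z \<omega> \<inter> B i j \<noteq> {} \<and> \<not> Z' \<omega> \<inter> B i j \<noteq> {}) \<or>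
      (\<not> Z \<omega> \<inter> B i j \<noteq> {} \<and> Z' \<omega> \<inter> B i j \<noteq> {})"
      using 1[of x "Z \<omega>" "Z' \<omega>"] 1[of x "Z' \<omega>" "Z \<omega>"] cl by meson
  next
    assume "\<exists>i j. (Z \<omega> \<inter> B i j \<noteq> {} \<and> \<not> Z' \<omega> \<inter> B i j \<noteq> {}) \<or>
      (\<not> Z \<omega> \<inter> B i j \<noteq> {} \<and> Z' \<omega> \<inter> B i j \<noteq> {})"
    then show "Z \<omega> \<inter> K \<noteq> Z' \<omega> \<inter> K" using B(2) by blast
  qed
  moreover have [measurable]: "Measurable.pred M (\<lambda>\<omega>. Z \<omega> \<inter> B i j \<noteq> {})"
    "Measurable.pred M (\<lambda>\<omega>. Z' \<omega> \<inter> B i j \<noteq> {})" for i j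
    using hit B(1) by blast+
  have "Measurable.pred M (\<lambda>\<omega>. \<exists>i j. (Z \<omega> \<inter> B i j \<noteq> {} \<and> \<not> Z' \<omega> \<inter> B i j \<noteq> {}) \<or>
      (\<not> Z \<omega> \<inter> B i j \<noteq> {} \<and> Z' \<omega> \<inter> B i j \<noteq> {}))"
    by measurable
  ultimately show ?thesis by simp
qed

section \<open>Configurations given by countably many random points with activity flags\<close>

definition active_points :: "(nat \<Rightarrow> 'w \<Rightarrow> bool) \<Rightarrow> (nat \<Rightarrow> 'w \<Rightarrow> 'b) \<Rightarrow> 'w \<Rightarrow> 'b set" where
  "active_points act X \<omega> = {X k \<omega> |k. act k \<omega>}"

lemma num_points_image:
  fixes J :: "nat set"
  assumes "inj_on X J"
  shows "num_points (X ` J) B = (\<Sum>k. if k \<in> J \<and> X k \<in> B then 1 else 0)"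
proof -
  let ?J = "{k \<in> J. X k \<in> B}"
  have inj: "inj_on X ?J" using assms by (rule inj_on_subset) auto
  have "X ` J \<inter> B = X ` ?J" by auto
  then have "num_points (X ` J) B = emeasure (count_space UNIV) (X ` ?J)" by (simp add: num_points_def)
  also have "\<dots> = emeasure (count_space UNIV) ?J"
    using inj by (cases "finite ?J") (simp_all add: card_image finite_image_iff del: finite_Collect_conjI)
  also have "\<dots> = (\<integral>\<^sup>+k. indicator ?J k \<partial>count_space UNIV)" by simp
  also have "\<dots> = (\<Sum>k. indicator ?J k)" by (rule nn_integral_count_space_nat)
  also have "\<dots> = (\<Sum>k. if k \<in> J \<and> X k \<in> B then 1 else 0)"
    by (intro suminf_cong) (auto simp: indicator_def)
  finally show ?thesis .
qed

lemma num_points_active_points: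
  assumes "inj_on (\<lambda>k. X k \<omega>) {k. act k \<omega>}"
  shows "num_points (active_points act X \<omega>) B = (\<Sum>k. if act k \<omega> \<and> X k \<omega> \<in> B then 1 else 0)"
proof -
  have "active_points act X \<omega> = (\<lambda>k. X k \<omega>) ` {k. act k \<omega>}" by (auto simp: active_points_def)
  then show ?thesis using num_points_image[OF assms] by simp
qed

lemma space_config_space: "space config_space = {A. countable A}"
  unfolding config_space_def by (rule space_measure_of) auto

lemma sets_config_space: "sets config_space = sigma_sets {A. countable A}
     {{A. countable A \<and> num_points A B \<in> U} |B U. B \<in> sets borel \<and> U \<in> sets borel}"
  unfolding config_space_def by (rule sets_measure_of) auto

lemma measurable_config_spaceI:
  fixes \<eta> :: "'w \<Rightarrow> 'b::topological_space set"
  assumes "\<And>\<omega>. \<omega> \<in> space M \<Longrightarrow> countable (\<eta> \<omega>)"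
    and "\<And>B. B \<in> sets borel \<Longrightarrow> (\<lambda>\<omega>. num_points (\<eta> \<omega>) B) \<in> borel_measurable M"
  shows "\<eta> \<in> measurable M config_space"
  unfolding config_space_def
proof (rule measurable_measure_of)
  fix Y :: "'b set set" assume "Y \<in> {{A. countable A \<and> num_points A B \<in> U} |B U. B \<in> sets borel \<and> U \<in> sets borel}"
  then obtain B U where Y: "Y = {A. countable A \<and> num_points A B \<in> U}" "B \<in> sets borel" "U \<in> sets borel" by blast
  have "\<eta> -` Y \<inter> space M = (\<lambda>\<omega>. num_points (\<eta> \<omega>) B) -` U \<inter> space M" using assms(1) Y(1) by auto
  then show "\<eta> -` Y \<inter> space M \<in> sets M" using measurable_sets[OF assms(2)[OF Y(2)] Y(3)] by simp
qed (use assms in auto)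

lemma measurable_num_points:
  fixes \<eta> :: "'w \<Rightarrow> 'b::topological_space set"
  assumes \<eta>: "\<eta> \<in> measurable M config_space" and B: "B \<in> sets borel"
  shows "(\<lambda>\<omega>. num_points (\<eta> \<omega>) B) \<in> borel_measurable M"
proof (rule measurableI)
  fix U :: "ennreal set" assume U: "U \<in> sets borel"
  let ?Y = "{A. countable A \<and> num_points A B \<in> U}"
  have "?Y \<in> sets config_space" unfolding sets_config_space using B U by blast
  then have "\<eta> -` ?Y \<inter> space M \<in> sets M" using \<eta> by (rule measurable_sets[rotated])
  moreover have "\<eta> -` ?Y \<inter> space M = (\<lambda>\<omega>. num_points (\<eta> \<omega>) B) -` U \<inter> space M"
    using measurable_space[OF \<eta>] by (auto simp: space_config_space)
  ultimately show "(\<lambda>\<omega>. num_points (\<eta> \<omega>) B) -` U \<inter> space M \<in> sets M" by simp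
qed auto

lemma measurable_active_points:
  fixes X :: "nat \<Rightarrow> 'w \<Rightarrow> 'b::topological_space"
  assumes [measurable]: "\<And>k. Measurable.pred M (act k)" "\<And>k. X k \<in> borel_measurable M"
    and inj: "\<And>\<omega>. \<omega> \<in> space M \<Longrightarrow> inj_on (\<lambda>k. X k \<omega>) {k. act k \<omega>}"
  shows "active_points act X \<in> measurable M config_space"
proof (rule measurable_config_spaceI)
  show "countable (active_points act X \<omega>)" for \<omega>
    by (simp add: active_points_def setcompr_eq_image)
  fix B :: "'b set" assume [measurable]: "B \<in> sets borel"
  have "(\<lambda>\<omega>. \<Sum>k. if act k \<omega> \<and> X k \<omega> \<in> B then 1 else 0 :: ennreal) \<in> borel_measurable M" by measurable
  then show "(\<lambda>\<omega>. num_points (active_points act X \<omega>) B) \<in> borel_measurable M"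
    by (rule measurable_cong[THEN iffD2, rotated]) (rule num_points_active_points, erule inj)
qed

lemma borel_measurable_pow [measurable (raw)]:
  assumes [measurable]: "X \<in> borel_measurable M"
  shows "(\<lambda>\<omega>. pow w (X \<omega>)) \<in> borel_measurable M"
  unfolding pow_def by (intro borel_measurable_add borel_measurable_power borel_measurable_norm
    borel_measurable_diff borel_measurable_const)
    (use measurable_compose[OF assms borel_measurable_continuous_onI[OF continuous_on_fst[OF continuous_on_id]]]
      measurable_compose[OF assms borel_measurable_continuous_onI[OF continuous_on_snd[OF continuous_on_id]]] in \<open>auto\<close>)

context
  fixes M :: "'w measure" and act :: "nat \<Rightarrow> 'w \<Rightarrow> bool" and X :: "nat \<Rightarrow> 'w \<Rightarrow> 'a::euclidean_space \<times> real"
  assumes act [measurable]: "\<And>k. Measurable.pred M (act k)"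
    and X [measurable]: "\<And>k. X k \<in> borel_measurable M"
begin

lemma laguerre_cell_active_points:
  "laguerre_cell p (active_points act X \<omega>) = {w. \<forall>l. act l \<omega> \<longrightarrow> pow w p \<le> pow w (X l \<omega>)}"
  unfolding laguerre_cell_def active_points_def by blast

lemma pred_skel_laguerre_hits:
  assumes K: "compact K"
  shows "Measurable.pred M (\<lambda>\<omega>. skel (laguerre (active_points act X \<omega>)) \<inter> K \<noteq> {})"
proof -
  \<comment> \<open>Inactive points contribute the vacuous constraint \<open>0 \<le> 0\<close>, so
    the inequalities can be indexed by all of \<open>nat\<close>.\<close>
  define h where "h k l \<omega> w = (if act l \<omega> then pow w (X k \<omega>) - pow w (X l \<omega>) else 0)" for k l \<omega> w
  define C where "C k \<omega> = laguerre_cell (X k \<omega>) (active_points act X \<omega>)" for k \<omega>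
  have 1: "continuous_on UNIV (h k l \<omega>)" for k l \<omega>
    unfolding h_def pow_def by (cases "act l \<omega>") (auto intro!: continuous_intros)
  have 2: "(\<lambda>\<omega>. h k l \<omega> w) \<in> borel_measurable M" for k l w unfolding h_def by measurable
  have 3: "C k \<omega> = {w. \<forall>l. h k l \<omega> w \<le> 0}" for k \<omega>
    by (auto simp: C_def h_def laguerre_cell_active_points)
  have "skel (laguerre (active_points act X \<omega>)) \<inter> K \<noteq> {} \<longleftrightarrow>
    (\<exists>k. act k \<omega> \<and> interior (C k \<omega>) \<noteq> {} \<and> frontier (C k \<omega>) \<inter> K \<noteq> {})" for \<omega>
    unfolding skel_def laguerre_def C_def active_points_def by blast
  then show ?thesis
    using pred_interior_sublevel[OF 1 2 3] pred_frontier_sublevel[OF 1 2 3 K] by simp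
qed

text \<open>A point outside the hull is strictly separated from finitely many points. This is an
  open condition on the direction, so a dense sequence of directions detects it.\<close>

lemma convex_hull_eq_dense_halfspaces:
  fixes c :: "nat \<Rightarrow> 'a" and v :: "nat \<Rightarrow> 'a"
  assumes c: "\<And>U. open U \<Longrightarrow> U \<noteq> {} \<Longrightarrow> \<exists>i. c i \<in> U" and J: "finite J" "J \<noteq> {}"
  shows "convex hull (v ` J) = {w. \<forall>i. c i \<bullet> w - Max ((\<lambda>k. c i \<bullet> v k) ` J) \<le> 0}"
proof -
  have "convex hull (v ` J) \<subseteq> {w. c i \<bullet> w \<le> Max ((\<lambda>k. c i \<bullet> v k) ` J)}" for i
    using J by (intro hull_minimal convex_halfspace_le) auto
  moreover have "w \<in> convex hull (v ` J)" if w: "\<And>i. c i \<bullet> w \<le> Max ((\<lambda>k. c i \<bullet> v k) ` J)" for w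
  proof (rule ccontr)
    assume n: "w \<notin> convex hull (v ` J)"
    have "closed (convex hull (v ` J))"
      using J by (intro compact_imp_closed compact_convex_hull finite_imp_compact) auto
    then obtain a b where ab: "a \<bullet> w < b" "\<And>x. x \<in> convex hull (v ` J) \<Longrightarrow> a \<bullet> x > b"
      using separating_hyperplane_closed_point[OF convex_convex_hull _ n] by blast
    let ?U = "\<Inter>k\<in>J. {e. e \<bullet> v k < e \<bullet> w}"
    have "open ?U" using J by (intro open_INT ballI open_Collect_less continuous_intros) auto
    moreover have "- a \<in> ?U"
    proof
      fix k assume "k \<in> J"
      then have "v k \<in> convex hull (v ` J)" by (simp add: hull_inc)
      then show "- a \<in> {e. e \<bullet> v k < e \<bullet> w}" using ab(2)[of "v k"] ab(1) by simp
    qed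
    ultimately obtain i where "c i \<in> ?U" using c by blast
    then have "\<forall>x\<in>(\<lambda>k. c i \<bullet> v k) ` J. x < c i \<bullet> w" by auto
    then have "Max ((\<lambda>k. c i \<bullet> v k) ` J) < c i \<bullet> w" using J by (subst Max_less_iff) auto
    then show False using w[of i] by simp
  qed
  ultimately show ?thesis by (auto simp: subset_iff)
qed

text \<open>Sets of points are replaced by finite sets of indices, of which there are countably
  many. Injectivity of the enumeration on active indices lets \<open>card J\<close> stand for the
  number of vertices.\<close>

lemma pred_skel_dual_laguerre_hits:
  assumes K: "compact K" and inj: "\<And>\<omega>. \<omega> \<in> space M \<Longrightarrow> inj_on (\<lambda>k. X k \<omega>) {k. act k \<omega>}"
  shows "Measurable.pred M (\<lambda>\<omega>. skel (dual_laguerre (active_points act X \<omega>)) \<inter> K \<noteq> {})"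
proof -
  obtain c :: "nat \<Rightarrow> 'a" where c: "\<And>U. open U \<Longrightarrow> U \<noteq> {} \<Longrightarrow> \<exists>i. c i \<in> U"
    using obtain_dense_sequence by blast
  let ?Js = "{J :: nat set. finite J \<and> card J = DIM('a) + 1}"
  have cJs: "countable ?Js" using countable_Collect_finite by (rule countable_subset[rotated]) auto
  define I where "I J \<omega> = {z. \<forall>k\<in>J. z \<in> laguerre_cell (X k \<omega>) (active_points act X \<omega>)}" for J \<omega>
  define H where "H J \<omega> = convex hull ((\<lambda>k. fst (X k \<omega>)) ` J)" for J \<omega>
  have predI: "Measurable.pred M (\<lambda>\<omega>. I J \<omega> \<noteq> {})" for J
  proof (rule pred_nonempty_sublevel[where h = "\<lambda>(k, l) \<omega> w. if k \<in> J \<and> act l \<omega> then pow w (X k \<omega>) - pow w (X l \<omega>) else 0"])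
    fix m :: "nat \<times> nat" and \<omega> and w :: 'a
    obtain k l where m: "m = (k, l)" by (cases m)
    show "continuous_on UNIV ((\<lambda>(k, l) \<omega> w. if k \<in> J \<and> act l \<omega> then pow w (X k \<omega>) - pow w (X l \<omega>) else 0) m \<omega>)"
      unfolding m pow_def by (cases "k \<in> J \<and> act l \<omega>") (auto intro!: continuous_intros)
    show "(\<lambda>\<omega>. (\<lambda>(k, l) \<omega> w. if k \<in> J \<and> act l \<omega> then pow w (X k \<omega>) - pow w (X l \<omega>) else 0) m \<omega> w) \<in> borel_measurable M"
      unfolding m by simp
    show "I J \<omega> = {w. \<forall>m. (\<lambda>(k, l) \<omega> w. if k \<in> J \<and> act l \<omega> then pow w (X k \<omega>) - pow w (X l \<omega>) else 0) m \<omega> w \<le> 0}"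
      by (auto simp: I_def laguerre_cell_active_points)
  qed
  have predH: "Measurable.pred M (\<lambda>\<omega>. frontier (H J \<omega>) \<inter> K \<noteq> {})" if J: "finite J" "J \<noteq> {}" for J
  proof (rule pred_frontier_sublevel[where h = "\<lambda>i \<omega> w. c i \<bullet> w - Max ((\<lambda>k. c i \<bullet> fst (X k \<omega>)) ` J)", OF _ _ _ K])
    have [measurable]: "(\<lambda>\<omega>. fst (X k \<omega>)) \<in> borel_measurable M" for k
      by (rule measurable_compose[OF X borel_measurable_continuous_onI[OF continuous_on_fst[OF continuous_on_id]]])
    show "(\<lambda>\<omega>. c i \<bullet> w - Max ((\<lambda>k. c i \<bullet> fst (X k \<omega>)) ` J)) \<in> borel_measurable M" for i w
      using J by (intro borel_measurable_diff borel_measurable_const borel_measurable_Max) measurable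
    show "H J \<omega> = {w. \<forall>i. c i \<bullet> w - Max ((\<lambda>k. c i \<bullet> fst (X k \<omega>)) ` J) \<le> 0}" for \<omega>
      unfolding H_def by (rule convex_hull_eq_dense_halfspaces[OF c J])
  qed (auto intro!: continuous_intros)
  have "skel (dual_laguerre (active_points act X \<omega>)) \<inter> K \<noteq> {} \<longleftrightarrow>
    (\<exists>J\<in>?Js. (\<forall>k\<in>J. act k \<omega>) \<and> I J \<omega> \<noteq> {} \<and> frontier (H J \<omega>) \<inter> K \<noteq> {})" (is "?L \<longleftrightarrow> ?R")
    if \<omega>: "\<omega> \<in> space M" for \<omega>
  proof
    assume ?L
    then obtain w S z where w: "w \<in> K" and S: "S \<subseteq> active_points act X \<omega>" "finite S" "card S = DIM('a) + 1"
      "\<And>p. p \<in> S \<Longrightarrow> z \<in> laguerre_cell p (active_points act X \<omega>)" "w \<in> frontier (convex hull (fst ` S))"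
      unfolding skel_def dual_laguerre_def by blast
    have "S \<subseteq> (\<lambda>k. X k \<omega>) ` {k. act k \<omega>}" using S(1) by (auto simp: active_points_def)
    then obtain J where J: "J \<subseteq> {k. act k \<omega>}" "S = (\<lambda>k. X k \<omega>) ` J"
      by (auto simp: subset_image_iff)
    have injJ: "inj_on (\<lambda>k. X k \<omega>) J" using inj[OF \<omega>] J(1) by (rule inj_on_subset)
    have "J \<in> ?Js" using S(2,3) J(2) injJ by (simp add: card_image finite_image_iff)
    moreover have "z \<in> I J \<omega>" using S(4) by (auto simp: I_def J(2))
    moreover have "w \<in> frontier (H J \<omega>)" using S(5) by (simp add: H_def J(2) image_image)
    ultimately show ?R using w J(1) by blast
  next
    assume ?R
    then obtain J z w where J: "finite J" "card J = DIM('a) + 1" "\<forall>k\<in>J. act k \<omega>" "z \<in> I J \<omega>"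
      "w \<in> frontier (H J \<omega>)" "w \<in> K" by blast
    let ?S = "(\<lambda>k. X k \<omega>) ` J"
    have injJ: "inj_on (\<lambda>k. X k \<omega>) J" by (rule inj_on_subset[OF inj[OF \<omega>]]) (use J(3) in auto)
    have "?S \<subseteq> active_points act X \<omega>" using J(3) by (auto simp: active_points_def)
    moreover have "card ?S = DIM('a) + 1" "finite ?S" using J(1,2) injJ by (simp_all add: card_image)
    moreover have "z \<in> (\<Inter>p\<in>?S. laguerre_cell p (active_points act X \<omega>))" using J(4) by (auto simp: I_def)
    moreover have "w \<in> frontier (convex hull (fst ` ?S))" using J(5) by (simp add: H_def image_image)
    ultimately have "convex hull (fst ` ?S) \<in> dual_laguerre (active_points act X \<omega>)"
      unfolding dual_laguerre_def by blast
    with \<open>w \<in> frontier (convex hull (fst ` ?S))\<close> show ?L using J(6) unfolding skel_def by blast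
  qed
  moreover have "Measurable.pred M (\<lambda>\<omega>. \<exists>J\<in>?Js. (\<forall>k\<in>J. act k \<omega>) \<and> I J \<omega> \<noteq> {} \<and> frontier (H J \<omega>) \<inter> K \<noteq> {})"
  proof (rule pred_countable_bex[OF cJs])
    fix J assume J: "J \<in> ?Js"
    have [measurable]: "Measurable.pred M (\<lambda>\<omega>. frontier (H J \<omega>) \<inter> K \<noteq> {})"
      using J by (intro predH) auto
    note predI [measurable]
    have [simp]: "finite J" using J by auto
    show "Measurable.pred M (\<lambda>\<omega>. (\<forall>k\<in>J. act k \<omega>) \<and> I J \<omega> \<noteq> {} \<and> frontier (H J \<omega>) \<inter> K \<noteq> {})"
      by (intro pred_intros_logic pred_intros_finite predI predH) (use J in auto)
  qed
  ultimately show ?thesis by (simp cong: measurable_cong)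
qed

end

subsection \<open>Poisson counts\<close>

text \<open>Rate 0 is included: as \<open>0 ^ 0 = 1\<close>, it gives the point mass at 0, the law
  of the count of a null set.\<close>

definition poisson_density :: "real \<Rightarrow> nat \<Rightarrow> real" where
  "poisson_density m k = exp (- m) * m ^ k / fact k"

lemma poisson_density_sums: "poisson_density m sums 1"
proof -
  have "(\<lambda>k. exp (- m) * (m ^ k /\<^sub>R fact k)) sums (exp (- m) * exp m)"
    by (intro sums_mult exp_converges)
  then show ?thesis by (simp add: poisson_density_def[abs_def] exp_minus field_simps)
qed

text \<open>This is the binomial theorem, in the form that makes the sum of two independent Poisson
  variables Poisson.\<close>

lemma poisson_density_convolution:
  "(\<Sum>j\<le>k. poisson_density a j * poisson_density b (k - j)) = poisson_density (a + b) k"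
proof -
  have "(\<Sum>j\<le>k. poisson_density a j * poisson_density b (k - j)) =
      (\<Sum>j\<le>k. exp (- (a + b)) / fact k * (of_nat (k choose j) * a ^ j * b ^ (k - j)))"
    by (intro sum.cong refl) (simp add: poisson_density_def binomial_fact exp_diff exp_minus field_simps exp_add)
  also have "\<dots> = poisson_density (a + b) k"
    by (simp add: poisson_density_def binomial_ring sum_distrib_left sum_divide_distrib mult.assoc)
  finally show ?thesis .
qed

lemma count_mset_eq_card: "count (mset xs) i = card {j. j < length xs \<and> xs ! j = i}"
proof -
  have "count_list xs i = length (filter (\<lambda>x. x = i) xs)" by (induction xs) auto
  then show ?thesis unfolding count_mset length_filter_conv_card .
qed

text \<open>The multinomial formula. The event is the disjoint union, over all words
  \<open>xs\<close> with \<open>k i\<close> letters \<open>i\<close>, of the events that point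
  \<open>j\<close> falls into cell \<open>xs ! j\<close>. These are equally likely, and their number
  is \<open>fact n\<close> divided by the product of the \<open>fact (k i)\<close>.\<close>

lemma (in prob_space) prob_iid_counts:
  fixes B :: "'i \<Rightarrow> 'a set"
  assumes I: "finite I" and B: "\<And>i. i \<in> I \<Longrightarrow> B i \<in> events"
    and disj: "disjoint_family_on B I" and cover: "(\<Union>i\<in>I. B i) = space M"
    and n: "n = sum k I"
  shows "measure (PiM UNIV (\<lambda>_::nat. M))
      {x\<in>space (PiM UNIV (\<lambda>_::nat. M)). \<forall>i\<in>I. card {j. j < n \<and> x j \<in> B i} = k i} =
    fact n * (\<Prod>i\<in>I. prob (B i) ^ k i / fact (k i))"
proof -
  interpret P: product_prob_space "\<lambda>_::nat. M" UNIV ..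
  let ?P = "PiM UNIV (\<lambda>_::nat. M)"
  define A where "A = (\<Sum>i\<in>I. replicate_mset (k i) i)"
  have count_A: "count A i = (if i \<in> I then k i else 0)" for i
  proof -
    have "count A i = (\<Sum>j\<in>I. if j = i then k i else 0)"
      unfolding A_def by (subst count_sum) (intro sum.cong refl, auto)
    then show ?thesis using I by simp
  qed
  have size_A: "size A = n" unfolding A_def n by (simp add: size_multiset_sum)
  have set_A: "set_mset A \<subseteq> I" using count_A by (auto simp flip: count_greater_zero_iff split: if_splits)
  define E where "E xs = {x\<in>space ?P. \<forall>j\<in>{..<n}. x j \<in> B (xs ! j)}" for xs
  have len: "length xs = n" "set xs \<subseteq> I" if "xs \<in> permutations_of_multiset A" for xs
    using that size_A set_A by (auto simp: permutations_of_multiset_def)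
  have uniq: "i = i'" if "y \<in> B i" "y \<in> B i'" "i \<in> I" "i' \<in> I" for y i i'
    using disj that by (auto simp: disjoint_family_on_def)
  have eq: "{x\<in>space ?P. \<forall>i\<in>I. card {j. j < n \<and> x j \<in> B i} = k i} = (\<Union>xs\<in>permutations_of_multiset A. E xs)"
  proof (intro set_eqI iffI)
    fix x assume x: "x \<in> {x\<in>space ?P. \<forall>i\<in>I. card {j. j < n \<and> x j \<in> B i} = k i}"
    have "\<forall>j. \<exists>i\<in>I. x j \<in> B i" using x cover by (auto simp: space_PiM PiE_def Pi_def)
    then obtain lab where lab: "\<And>j. lab j \<in> I" "\<And>j. x j \<in> B (lab j)" by metis
    have lab_iff: "lab j = i \<longleftrightarrow> x j \<in> B i" if "i \<in> I" for i j using uniq lab that by blast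
    let ?xs = "map lab [0..<n]"
    have "mset ?xs = A"
    proof (rule multiset_eqI)
      fix i
      have "{j. j < length ?xs \<and> ?xs ! j = i} = (if i \<in> I then {j. j < n \<and> x j \<in> B i} else {})"
        using lab lab_iff by auto
      then show "count (mset ?xs) i = count A i"
        unfolding count_mset_eq_card count_A using x by simp
    qed
    moreover have "x \<in> E ?xs" using x lab by (simp add: E_def)
    ultimately show "x \<in> (\<Union>xs\<in>permutations_of_multiset A. E xs)"
      by (intro UN_I[of ?xs]) (simp_all add: permutations_of_multiset_def)
  next
    fix x assume "x \<in> (\<Union>xs\<in>permutations_of_multiset A. E xs)"
    then obtain xs where xs: "xs \<in> permutations_of_multiset A" "x \<in> E xs" by auto
    have "card {j. j < n \<and> x j \<in> B i} = k i" if i: "i \<in> I" for i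
    proof -
      have "{j. j < n \<and> x j \<in> B i} = {j. j < length xs \<and> xs ! j = i}"
      proof -
        have "x j \<in> B i \<longleftrightarrow> xs ! j = i" if j: "j < n" for j
        proof -
          have "xs ! j \<in> I" using len[OF xs(1)] j nth_mem by blast
          moreover have "x j \<in> B (xs ! j)" using xs(2) j by (simp add: E_def)
          ultimately show ?thesis using uniq i by blast
        qed
        then show ?thesis using len(1)[OF xs(1)] by auto
      qed
      then show ?thesis using xs(1) i
        by (simp add: count_A permutations_of_multiset_def flip: count_mset_eq_card)
    qed
    then show "x \<in> {x\<in>space ?P. \<forall>i\<in>I. card {j. j < n \<and> x j \<in> B i} = k i}"
      using xs(2) by (auto simp: E_def)
  qed
  have disjE: "disjoint_family_on E (permutations_of_multiset A)"
    unfolding disjoint_family_on_def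
  proof (intro ballI impI)
    fix xs ys assume xy: "xs \<in> permutations_of_multiset A" "ys \<in> permutations_of_multiset A" "xs \<noteq> ys"
    then obtain j where j: "j < n" "xs ! j \<noteq> ys ! j" using len by (metis nth_equalityI)
    then have "xs ! j \<in> I" "ys ! j \<in> I" using xy len by (metis nth_mem subsetD)+
    then show "E xs \<inter> E ys = {}" using uniq[of _ "xs ! j" "ys ! j"] j by (auto simp: E_def)
  qed
  have E_sets: "E xs \<in> sets ?P" if "xs \<in> permutations_of_multiset A" for xs
  proof -
    have "Measurable.pred ?P (\<lambda>x. \<forall>j\<in>{..<n}. x j \<in> B (xs ! j))"
    proof (intro pred_intros_finite(3))
      fix j assume "j \<in> {..<n}"
      then have [measurable]: "B (xs ! j) \<in> events"
        using len[OF \<open>xs \<in> permutations_of_multiset A\<close>] B nth_mem by blast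
      show "Measurable.pred ?P (\<lambda>x. x j \<in> B (xs ! j))" by measurable
    qed auto
    then show ?thesis by (simp add: E_def pred_def)
  qed
  have "measure ?P (E xs) = (\<Prod>i\<in>I. prob (B i) ^ k i)" if xs: "xs \<in> permutations_of_multiset A" for xs
  proof -
    have Bev: "B (xs ! j) \<in> events" if "j < n" for j
      using that len[OF xs] B by (metis nth_mem subsetD)
    have "emeasure ?P (E xs) = (\<Prod>j\<in>{..<n}. emeasure M (B (xs ! j)))"
      unfolding E_def using Bev by (intro P.emeasure_PiM_Collect) auto
    also have "\<dots> = ennreal (\<Prod>j\<in>{..<n}. prob (B (xs ! j)))"
      by (simp add: emeasure_eq_measure prod_ennreal)
    finally have "measure ?P (E xs) = (\<Prod>j\<in>{..<n}. prob (B (xs ! j)))"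
      by (simp add: measure_def prod_nonneg)
    also have "\<dots> = prod_list (map (\<lambda>i. prob (B i)) xs)"
      using len[OF xs] by (simp add: prod.list_conv_set_nth atLeast0LessThan)
    also have "\<dots> = prod_mset (image_mset (\<lambda>i. prob (B i)) A)"
      using xs by (auto simp: permutations_of_multiset_def prod_mset_prod_list[symmetric])
    also have "\<dots> = (\<Prod>i\<in>set_mset A. prob (B i) ^ count A i)"
      by (rule image_prod_mset_multiplicity)
    also have "\<dots> = (\<Prod>i\<in>I. prob (B i) ^ count A i)"
      using I set_A by (intro prod.mono_neutral_left) (auto simp: not_in_iff)
    finally show ?thesis by (simp add: count_A)
  qed
  then have "measure ?P {x\<in>space ?P. \<forall>i\<in>I. card {j. j < n \<and> x j \<in> B i} = k i} =
      card (permutations_of_multiset A) * (\<Prod>i\<in>I. prob (B i) ^ k i)"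
    unfolding eq using E_sets disjE by (subst P.finite_measure_finite_Union) auto
  moreover have "card (permutations_of_multiset A) * (\<Prod>i\<in>I. fact (k i)) = (fact n :: nat)"
  proof -
    have "(\<Prod>i\<in>set_mset A. fact (count A i)) = (\<Prod>i\<in>I. fact (count A i) :: nat)"
      using I set_A by (intro prod.mono_neutral_left) (auto simp: not_in_iff)
    then show ?thesis using card_permutations_of_multiset_aux[of A] size_A by (simp add: count_A)
  qed
  then have "real (card (permutations_of_multiset A)) * (\<Prod>i\<in>I. fact (k i)) = fact n"
    using arg_cong[of _ _ real] by fastforce
  then have "real (card (permutations_of_multiset A)) = fact n / (\<Prod>i\<in>I. fact (k i))"
    using I by (simp add: field_simps)
  ultimately show ?thesis by (simp add: prod_dividef)
qed

definition count_below :: "nat \<times> (nat \<Rightarrow> 'b) \<Rightarrow> 'b set \<Rightarrow> nat" where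
  "count_below q B = card {j. j < fst q \<and> snd q j \<in> B}"

text \<open>A Poisson process of finite intensity \<open>r\<close> times \<open>M\<close>, presented
  as a Poisson number and an infinite iid sequence, of which \<open>count_below\<close> uses the
  initial segment of that length. The sample space is thus a plain product.\<close>

definition poisson_sample :: "real \<Rightarrow> 'b measure \<Rightarrow> (nat \<times> (nat \<Rightarrow> 'b)) measure" where
  "poisson_sample r M = measure_pmf (poisson_pmf r) \<Otimes>\<^sub>M PiM UNIV (\<lambda>_. M)"

lemma measurable_count_below [measurable]:
  assumes [measurable]: "B \<in> sets M"
  shows "(\<lambda>q. count_below q B) \<in> measurable (poisson_sample r M) (count_space UNIV)"
proof -
  have [measurable]: "fst \<in> measurable (poisson_sample r M) (count_space UNIV)"
    unfolding poisson_sample_def by measurable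
  have [measurable]: "(\<lambda>q. snd q j) \<in> measurable (poisson_sample r M) M" for j
    unfolding poisson_sample_def by measurable
  show ?thesis unfolding count_below_def by measurable
qed

lemma prob_space_poisson_sample: "prob_space M \<Longrightarrow> prob_space (poisson_sample r M)"
  unfolding poisson_sample_def
  by (intro prob_space_pair prob_space_measure_pmf prob_space_PiM)

text \<open>Since the cells cover the space, their counts fix the total number, and the event is a
  rectangle. The Poisson weight times the multinomial weight factorizes because the probabilities of
  the cells sum to 1.\<close>

lemma (in prob_space) poisson_sample_counts_partition:
  fixes B :: "'i \<Rightarrow> 'a set"
  assumes r: "r > 0" and I: "finite I" and B: "\<And>i. i \<in> I \<Longrightarrow> B i \<in> events"
    and disj: "disjoint_family_on B I" and cover: "(\<Union>i\<in>I. B i) = space M"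
  shows "measure (poisson_sample r M) {q\<in>space (poisson_sample r M). \<forall>i\<in>I. count_below q (B i) = k i} =
    (\<Prod>i\<in>I. poisson_density (r * prob (B i)) (k i))"
proof -
  interpret P: product_prob_space "\<lambda>_::nat. M" UNIV ..
  let ?P = "PiM UNIV (\<lambda>_::nat. M)"
  interpret Q: pair_prob_space "measure_pmf (poisson_pmf r)" ?P ..
  let ?n = "sum k I"
  let ?E = "{x\<in>space ?P. \<forall>i\<in>I. card {j. j < ?n \<and> x j \<in> B i} = k i}"
  have "{q\<in>space (poisson_sample r M). \<forall>i\<in>I. count_below q (B i) = k i} = {?n} \<times> ?E"
  proof (intro set_eqI iffI)
    fix q assume q: "q \<in> {q\<in>space (poisson_sample r M). \<forall>i\<in>I. count_below q (B i) = k i}"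
    then have "\<forall>j. snd q j \<in> (\<Union>i\<in>I. B i)"
      by (auto simp: cover poisson_sample_def space_pair_measure space_PiM PiE_def Pi_def)
    then have "{..<fst q} = (\<Union>i\<in>I. {j. j < fst q \<and> snd q j \<in> B i})" by auto
    then have "fst q = card (\<Union>i\<in>I. {j. j < fst q \<and> snd q j \<in> B i})" by (metis card_lessThan)
    also have "\<dots> = (\<Sum>i\<in>I. card {j. j < fst q \<and> snd q j \<in> B i})"
      using I disj by (intro card_UN_disjoint) (auto simp: disjoint_family_on_def)
    also have "\<dots> = ?n" using q by (simp add: count_below_def)
    finally have "fst q = ?n" .
    then show "q \<in> {?n} \<times> ?E" using q
      by (cases q) (auto simp: count_below_def poisson_sample_def space_pair_measure)
  qed (auto simp: count_below_def poisson_sample_def space_pair_measure)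
  moreover have "?E \<in> sets ?P"
  proof -
    have "Measurable.pred ?P (\<lambda>x. \<forall>i\<in>I. card {j. j < ?n \<and> x j \<in> B i} = k i)"
    proof (intro pred_intros_finite(3)[OF I] pred_count_space_const1)
      fix i assume "i \<in> I"
      from B[OF this, measurable] show "(\<lambda>x. card {j. j < ?n \<and> x j \<in> B i}) \<in> measurable ?P (count_space UNIV)"
        by measurable
    qed
    then show ?thesis by (simp add: pred_def)
  qed
  ultimately have "measure (poisson_sample r M) {q\<in>space (poisson_sample r M). \<forall>i\<in>I. count_below q (B i) = k i} =
     measure (measure_pmf (poisson_pmf r)) {?n} * measure ?P ?E"
    unfolding poisson_sample_def
    by (simp add: measure_def P.emeasure_pair_measure_Times enn2real_mult)
  also have "\<dots> = r ^ ?n * exp (- r) / fact ?n * (fact ?n * (\<Prod>i\<in>I. prob (B i) ^ k i / fact (k i)))"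
    using r by (simp add: measure_pmf_single prob_iid_counts[OF I B disj cover refl])
  also have "\<dots> = (\<Prod>i\<in>I. r ^ k i) * exp (- r * (\<Sum>i\<in>I. prob (B i))) * (\<Prod>i\<in>I. prob (B i) ^ k i / fact (k i))"
  proof -
    have "(\<Sum>i\<in>I. prob (B i)) = 1"
      using I B disj cover prob_space finite_measure_finite_Union[of I B] by (simp add: image_subset_iff)
    then show ?thesis by (simp add: power_sum)
  qed
  also have "\<dots> = (\<Prod>i\<in>I. poisson_density (r * prob (B i)) (k i))"
    using I by (simp add: poisson_density_def prod.distrib prod_dividef exp_sum sum_distrib_left
        power_mult_distrib sum_negf flip: sum_negf)
  finally show ?thesis .
qed

text \<open>The complement of all cells is adjoined as a cell \<open>None\<close> to obtain a
  partition, and its count \<open>k0\<close> is then summed out.\<close>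

lemma (in prob_space) poisson_sample_counts:
  fixes B :: "'i \<Rightarrow> 'a set"
  assumes r: "r > 0" and I: "finite I" and B: "\<And>i. i \<in> I \<Longrightarrow> B i \<in> events"
    and disj: "disjoint_family_on B I"
  shows "measure (poisson_sample r M) {q\<in>space (poisson_sample r M). \<forall>i\<in>I. count_below q (B i) = k i} =
    (\<Prod>i\<in>I. poisson_density (r * prob (B i)) (k i))"
proof -
  interpret Q: prob_space "poisson_sample r M" by (rule prob_space_poisson_sample) unfold_locales
  define B0 where "B0 = space M - (\<Union>i\<in>I. B i)"
  have B0: "B0 \<in> events" unfolding B0_def using I B by auto
  define B' where "B' = case_option B0 B"
  let ?I = "insert None (Some ` I)"
  let ?E = "\<lambda>k0. {q\<in>space (poisson_sample r M). \<forall>i\<in>?I. count_below q (B' i) = case_option k0 k i}"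
  have m: "measure (poisson_sample r M) (?E k0) =
      poisson_density (r * prob B0) k0 * (\<Prod>i\<in>I. poisson_density (r * prob (B i)) (k i))" for k0
  proof -
    have "measure (poisson_sample r M) (?E k0) =
        (\<Prod>i\<in>?I. poisson_density (r * prob (B' i)) (case_option k0 k i))"
    proof (rule poisson_sample_counts_partition[OF r])
      show "B' i \<in> events" if "i \<in> ?I" for i using that B0 B by (auto simp: B'_def)
      show "disjoint_family_on B' ?I" using disj
        by (auto simp: disjoint_family_on_def B'_def B0_def split: option.splits)
      show "(\<Union>i\<in>?I. B' i) = space M" using B sets.sets_into_space
        by (auto simp: B'_def B0_def)
    qed (use I in auto)
    also have "\<dots> = poisson_density (r * prob B0) k0 * (\<Prod>i\<in>I. poisson_density (r * prob (B i)) (k i))"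
      using I by (subst prod.insert) (auto simp: B'_def prod.reindex)
    finally show ?thesis .
  qed
  have eq: "{q\<in>space (poisson_sample r M). \<forall>i\<in>I. count_below q (B i) = k i} = (\<Union>k0. ?E k0)"
    by (auto simp: B'_def)
  have "?E k0 \<in> sets (poisson_sample r M)" for k0
  proof -
    have [measurable]: "B' i \<in> sets M" if "i \<in> ?I" for i using that B0 B by (auto simp: B'_def)
    have "Measurable.pred (poisson_sample r M) (\<lambda>q. \<forall>i\<in>?I. count_below q (B' i) = case_option k0 k i)"
      using I by (intro pred_intros_finite(3) pred_count_space_const1 measurable_count_below) (auto simp del: insert_iff)
    then show ?thesis by (simp add: pred_def)
  qed
  moreover have "disjoint_family ?E" by (auto simp: disjoint_family_on_def)
  ultimately have "(\<lambda>k0. measure (poisson_sample r M) (?E k0)) sums measure (poisson_sample r M) (\<Union>k0. ?E k0)"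
    by (intro Q.finite_measure_UNION) auto
  moreover have "(\<lambda>k0. measure (poisson_sample r M) (?E k0)) sums (1 * (\<Prod>i\<in>I. poisson_density (r * prob (B i)) (k i)))"
    unfolding m by (intro sums_mult2 poisson_density_sums)
  ultimately show ?thesis unfolding eq using sums_unique2 by fastforce
qed

lemma (in prob_space) indep_vars_nat_valuedI:
  fixes Y :: "'i \<Rightarrow> 'a \<Rightarrow> nat"
  assumes Y: "\<And>i. i \<in> I \<Longrightarrow> Y i \<in> measurable M (count_space UNIV)"
    and prod: "\<And>J k. J \<subseteq> I \<Longrightarrow> finite J \<Longrightarrow> J \<noteq> {} \<Longrightarrow>
      prob {\<omega>\<in>space M. \<forall>j\<in>J. Y j \<omega> = k j} = (\<Prod>j\<in>J. prob {\<omega>\<in>space M. Y j \<omega> = k j})"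
  shows "indep_vars (\<lambda>_. count_space UNIV) Y I"
proof -
  \<comment> \<open>The empty set is added because two different level sets are disjoint; the family
    is then stable under intersection.\<close>
  define F where "F i = insert {} {{\<omega>\<in>space M. Y i \<omega> = k} |k. True}" for i
  have F_events: "F i \<subseteq> events" if "i \<in> I" for i
  proof -
    have [measurable]: "Y i \<in> measurable M (count_space UNIV)" using Y[OF that] .
    show ?thesis unfolding F_def by auto
  qed
  have "indep_sets F I"
  proof (rule indep_setsI)
    fix A J assume J: "J \<noteq> {}" "J \<subseteq> I" "finite J" and A: "\<forall>j\<in>J. A j \<in> F j"
    show "prob (\<Inter>j\<in>J. A j) = (\<Prod>j\<in>J. prob (A j))"
    proof (cases "\<exists>j\<in>J. A j = {}")
      case True
      then have "(\<Inter>j\<in>J. A j) = {}" by auto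
      moreover have "(\<Prod>j\<in>J. prob (A j)) = 0" 
      proof -
        obtain j where "j \<in> J" "A j = {}" using True by blast
        then show ?thesis using J(3) by (intro prod_zero bexI[of _ j]) simp_all
      qed
      ultimately show ?thesis by simp
    next
      case False
      then have "\<forall>j\<in>J. \<exists>k. A j = {\<omega>\<in>space M. Y j \<omega> = k}" using A by (auto simp: F_def)
      then obtain k where k: "\<And>j. j \<in> J \<Longrightarrow> A j = {\<omega>\<in>space M. Y j \<omega> = k j}" by metis
      have "(\<Inter>j\<in>J. A j) = {\<omega>\<in>space M. \<forall>j\<in>J. Y j \<omega> = k j}" using k J by auto
      then show ?thesis using prod[OF J(2,3,1), of k] k by (simp cong: prod.cong)
    qed
  qed (use F_events in auto)
  moreover have "Int_stable (F i)" for i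
    by (auto simp: Int_stable_def F_def)
  ultimately have ind: "indep_sets (\<lambda>i. sigma_sets (space M) (F i)) I"
    by (intro indep_sets_sigma) auto
  have sub: "{Y i -` A \<inter> space M |A. A \<in> sets (count_space UNIV)} \<subseteq> sigma_sets (space M) (F i)" for i
  proof safe
    fix A :: "nat set"
    have "Y i -` A \<inter> space M = (\<Union>k. if k \<in> A then {\<omega>\<in>space M. Y i \<omega> = k} else {})"
      by (auto split: if_splits)
    also have "\<dots> \<in> sigma_sets (space M) (F i)"
      by (intro sigma_sets.Union) (auto simp: F_def intro: sigma_sets.Basic sigma_sets.Empty)
    finally show "Y i -` A \<inter> space M \<in> sigma_sets (space M) (F i)" .
  qed
  have "F i \<subseteq> Pow (space M)" for i by (auto simp: F_def)
  then have "sigma_sets (space M) {Y i -` A \<inter> space M |A. A \<in> sets (count_space UNIV)} \<subseteq> sigma_sets (space M) (F i)" for i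
    using sub by (intro sigma_sets_mono) auto
  then have "indep_sets (\<lambda>i. sigma_sets (space M) {Y i -` A \<inter> space M |A. A \<in> sets (count_space UNIV)}) I"
    by (intro indep_sets_mono_sets[OF ind])
  then show ?thesis unfolding indep_vars_def using Y by auto
qed

lemma (in prob_space) poisson_partial_sums:
  fixes U :: "nat \<Rightarrow> 'a \<Rightarrow> nat"
  assumes ind: "indep_vars (\<lambda>_. count_space UNIV) U UNIV"
    and U: "\<And>i k. prob {\<omega>\<in>space M. U i \<omega> = k} = poisson_density (m i) k"
  shows "prob {\<omega>\<in>space M. (\<Sum>i<n. U i \<omega>) = k} = poisson_density (\<Sum>i<n. m i) k"
proof (induction n arbitrary: k)
  case 0
  show ?case by (cases k) (simp_all add: prob_space poisson_density_def)
next
  case (Suc n)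
  have [measurable]: "U i \<in> measurable M (count_space UNIV)" for i
    using ind by (auto simp: indep_vars_def)
  have ind': "indep_vars (\<lambda>_. borel) (\<lambda>i \<omega>. real (U i \<omega>)) UNIV"
    using ind by (rule indep_vars_compose2) simp
  then have "indep_vars (\<lambda>_. borel) (\<lambda>i \<omega>. real (U i \<omega>)) (insert n {..<n})"
    by (rule indep_vars_subset) simp
  then have iv: "indep_var borel (\<lambda>\<omega>. real (U n \<omega>)) borel (\<lambda>\<omega>. \<Sum>i<n. real (U i \<omega>))"
    by (intro indep_vars_sum) auto
  have joint: "prob {\<omega>\<in>space M. (\<Sum>i<n. U i \<omega>) = j \<and> U n \<omega> = l} =
      poisson_density (\<Sum>i<n. m i) j * poisson_density (m n) l" for j l
  proof -
    have "prob ((\<lambda>x. (real (U n x), \<Sum>i<n. real (U i x))) -` ({real l} \<times> {real j}) \<inter> space M) =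
        prob ((\<lambda>\<omega>. real (U n \<omega>)) -` {real l} \<inter> space M) * prob ((\<lambda>\<omega>. \<Sum>i<n. real (U i \<omega>)) -` {real j} \<inter> space M)"
      by (rule indep_varD[OF iv]) auto
    moreover have "(\<lambda>x. (real (U n x), \<Sum>i<n. real (U i x))) -` ({real l} \<times> {real j}) \<inter> space M =
        {\<omega>\<in>space M. (\<Sum>i<n. U i \<omega>) = j \<and> U n \<omega> = l}"
      by (auto simp flip: of_nat_sum)
    moreover have "(\<lambda>\<omega>. real (U n \<omega>)) -` {real l} \<inter> space M = {\<omega>\<in>space M. U n \<omega> = l}" by auto
    moreover have "(\<lambda>\<omega>. \<Sum>i<n. real (U i \<omega>)) -` {real j} \<inter> space M = {\<omega>\<in>space M. (\<Sum>i<n. U i \<omega>) = j}"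
      by (auto simp flip: of_nat_sum)
    ultimately show ?thesis by (simp add: Suc U mult.commute)
  qed
  have "{\<omega>\<in>space M. (\<Sum>i<Suc n. U i \<omega>) = k} =
      (\<Union>j\<in>{..k}. {\<omega>\<in>space M. (\<Sum>i<n. U i \<omega>) = j \<and> U n \<omega> = k - j})" by auto
  also have "prob \<dots> = (\<Sum>j\<le>k. prob {\<omega>\<in>space M. (\<Sum>i<n. U i \<omega>) = j \<and> U n \<omega> = k - j})"
    by (intro finite_measure_finite_Union) (auto simp: disjoint_family_on_def)
  also have "\<dots> = poisson_density (\<Sum>i<Suc n. m i) k"
    by (simp add: joint poisson_density_convolution)
  finally show ?case .
qed

lemma tendsto_poisson_density_at_top:
  assumes "filterlim m at_top sequentially"
  shows "(\<lambda>n. poisson_density (m n) k) \<longlonglongrightarrow> 0"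
proof -
  have "((\<lambda>x. x ^ k / exp x) \<longlongrightarrow> (0::real)) at_top" by (rule tendsto_power_div_exp_0)
  then have "((\<lambda>x. x ^ k / exp x / fact k) \<longlongrightarrow> (0 / fact k :: real)) at_top"
    by (intro tendsto_divide) auto
  then have "((\<lambda>x. poisson_density x k) \<longlongrightarrow> 0) at_top"
    by (simp add: poisson_density_def[abs_def] exp_minus field_simps)
  then show ?thesis using assms by (rule filterlim_compose)
qed

lemma tendsto_poisson_density [tendsto_intros]:
  "(m \<longlongrightarrow> l) F \<Longrightarrow> ((\<lambda>n. poisson_density (m n) k) \<longlongrightarrow> poisson_density l k) F"
  unfolding poisson_density_def by (intro tendsto_intros) auto

context prob_space
begin

context
  fixes U :: "nat \<Rightarrow> 'a \<Rightarrow> nat" and m :: "nat \<Rightarrow> real"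
  assumes ind: "indep_vars (\<lambda>_. count_space UNIV) U UNIV"
    and U: "\<And>i k. prob {\<omega>\<in>space M. U i \<omega> = k} = poisson_density (m i) k"
    and m: "\<And>i. 0 \<le> m i"
begin

lemma measurable_poisson_series:
  "(\<lambda>\<omega>. \<Sum>i. of_nat (U i \<omega>) :: ennreal) \<in> borel_measurable M"
proof -
  have [measurable]: "U i \<in> measurable M (count_space UNIV)" for i
    using ind by (auto simp: indep_vars_def)
  show ?thesis by measurable
qed

text \<open>The events that the partial sums are at most \<open>k\<close> decrease, so continuity of
  the measure gives the limit whether or not the means are summable. The finite and the infinite
  case are both read off from it.\<close>

lemma poisson_series_le:
  "(\<lambda>n. \<Sum>j\<le>k. poisson_density (\<Sum>i<n. m i) j) \<longlonglongrightarrow>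
     prob {\<omega>\<in>space M. (\<Sum>i. of_nat (U i \<omega>) :: ennreal) \<le> of_nat k}"
proof -
  have [measurable]: "U i \<in> measurable M (count_space UNIV)" for i
    using ind by (auto simp: indep_vars_def)
  define A where "A n = {\<omega>\<in>space M. (\<Sum>i<n. U i \<omega>) \<le> k}" for n
  have "prob (A n) = (\<Sum>j\<le>k. poisson_density (\<Sum>i<n. m i) j)" for n
  proof -
    have "A n = (\<Union>j\<in>{..k}. {\<omega>\<in>space M. (\<Sum>i<n. U i \<omega>) = j})" by (auto simp: A_def)
    also have "prob \<dots> = (\<Sum>j\<le>k. prob {\<omega>\<in>space M. (\<Sum>i<n. U i \<omega>) = j})"
      by (intro finite_measure_finite_Union) (auto simp: disjoint_family_on_def)
    finally show ?thesis by (simp add: poisson_partial_sums[OF ind U])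
  qed
  moreover have "(\<lambda>n. prob (A n)) \<longlonglongrightarrow> prob (\<Inter>n. A n)"
  proof (rule finite_Lim_measure_decseq)
    show "range A \<subseteq> events" by (auto simp: A_def)
    show "decseq A" unfolding decseq_def A_def
      by (auto intro: order_trans[rotated] sum_mono2)
  qed
  moreover have "(\<Inter>n. A n) = {\<omega>\<in>space M. (\<Sum>i. of_nat (U i \<omega>) :: ennreal) \<le> of_nat k}"
    by (auto simp: A_def suminf_eq_SUP SUP_le_iff simp flip: of_nat_sum)
  ultimately show ?thesis by simp
qed

lemma poisson_series_finite:
  assumes "(\<Sum>i. ennreal (m i)) = ennreal c" "c \<ge> 0"
  shows "prob {\<omega>\<in>space M. (\<Sum>i. of_nat (U i \<omega>) :: ennreal) = of_nat k} = poisson_density c k"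
proof -
  let ?S = "\<lambda>\<omega>. \<Sum>i. of_nat (U i \<omega>) :: ennreal"
  note measurable_poisson_series [measurable]
  have "(\<lambda>i. ennreal (m i)) sums ennreal c" using assms(1) by (metis summableI summable_sums)
  then have "m sums c" using m assms(2) by simp
  then have mc: "(\<lambda>n. \<Sum>i<n. m i) \<longlonglongrightarrow> c" by (simp add: sums_def)
  have le: "prob {\<omega>\<in>space M. ?S \<omega> \<le> of_nat k} = (\<Sum>j\<le>k. poisson_density c j)" for k
    by (rule LIMSEQ_unique[OF poisson_series_le]) (intro tendsto_intros mc)
  show ?thesis
  proof (cases k)
    case 0
    then show ?thesis using le[of 0] by simp
  next
    case (Suc l)
    \<comment> \<open>Partial sums are integers, so one that exceeds \<open>l\<close> is at least
      \<open>l + 1\<close>; the series takes no value strictly in between.\<close>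
    have "?S \<omega> = of_nat (Suc l)" if le: "?S \<omega> \<le> of_nat (Suc l)" and nle: "\<not> ?S \<omega> \<le> of_nat l" for \<omega>
    proof -
      obtain n where "\<not> (\<Sum>i<n. of_nat (U i \<omega>)) \<le> (of_nat l :: ennreal)"
        using nle by (auto simp: suminf_eq_SUP SUP_le_iff)
      then have "of_nat (Suc l) \<le> (\<Sum>i<n. of_nat (U i \<omega>) :: ennreal)"
        by (simp del: of_nat_Suc flip: of_nat_sum)
      also have "\<dots> \<le> ?S \<omega>" by (intro sum_le_suminf) auto
      finally show ?thesis using le by simp
    qed
    moreover have "\<not> (of_nat (Suc l) :: ennreal) \<le> of_nat l" by (simp del: of_nat_Suc)
    ultimately have "{\<omega>\<in>space M. ?S \<omega> = of_nat k} =
        {\<omega>\<in>space M. ?S \<omega> \<le> of_nat (Suc l)} - {\<omega>\<in>space M. ?S \<omega> \<le> of_nat l}"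
      unfolding Suc by (auto simp del: of_nat_Suc)
    moreover have "{\<omega>\<in>space M. ?S \<omega> \<le> of_nat l} \<subseteq> {\<omega>\<in>space M. ?S \<omega> \<le> of_nat (Suc l)}"
    proof -
      have "(of_nat l :: ennreal) \<le> of_nat (Suc l)" by simp
      then show ?thesis by (auto simp del: of_nat_Suc intro: order_trans)
    qed
    ultimately have "prob {\<omega>\<in>space M. ?S \<omega> = of_nat k} =
        prob {\<omega>\<in>space M. ?S \<omega> \<le> of_nat (Suc l)} - prob {\<omega>\<in>space M. ?S \<omega> \<le> of_nat l}"
      by (simp add: finite_measure_Diff del: of_nat_Suc)
    then show ?thesis by (simp add: le Suc del: of_nat_Suc)
  qed
qed

text \<open>Along diverging means the Poisson probability of each fixed value tends to 0, so no
  bound \<open>k\<close> on the series has positive probability.\<close>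

lemma poisson_series_infinite:
  assumes "(\<Sum>i. ennreal (m i)) = \<infinity>"
  shows "AE \<omega> in M. (\<Sum>i. of_nat (U i \<omega>) :: ennreal) = \<infinity>"
proof -
  let ?S = "\<lambda>\<omega>. \<Sum>i. of_nat (U i \<omega>) :: ennreal"
  note measurable_poisson_series [measurable]
  have ns: "\<not> summable m"
    using assms m suminf_ennreal2[of m] by auto
  have "filterlim (\<lambda>n. \<Sum>i<n. m i) at_top sequentially"
    unfolding filterlim_at_top
  proof
    fix Z
    have "\<exists>n. Z \<le> (\<Sum>i<n. m i)"
    proof (rule ccontr)
      assume "\<not> ?thesis"
      then have "summable m" using m by (intro summableI_nonneg_bounded[where x = Z]) (auto simp: not_le less_imp_le)
      then show False using ns by simp
    qed
    then obtain n where "Z \<le> (\<Sum>i<n. m i)" by blast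
    then show "\<forall>\<^sub>F n in sequentially. Z \<le> (\<Sum>i<n. m i)"
    proof (intro eventually_sequentiallyI[of n])
      fix n' assume "n \<le> n'"
      then have "(\<Sum>i<n. m i) \<le> (\<Sum>i<n'. m i)" using m by (intro sum_mono2) auto
      then show "Z \<le> (\<Sum>i<n'. m i)" using \<open>Z \<le> (\<Sum>i<n. m i)\<close> by simp
    qed
  qed
  then have "(\<lambda>n. \<Sum>j\<le>k. poisson_density (\<Sum>i<n. m i) j) \<longlonglongrightarrow> (\<Sum>j\<le>k. 0)" for k
    by (intro tendsto_sum tendsto_poisson_density_at_top)
  then have "prob {\<omega>\<in>space M. ?S \<omega> \<le> of_nat k} = 0" for k
    using LIMSEQ_unique[OF poisson_series_le] by simp
  then have "AE \<omega> in M. \<omega> \<notin> {\<omega>\<in>space M. ?S \<omega> \<le> of_nat k}" for k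
    by (subst prob_eq_0[symmetric]) auto
  then have "AE \<omega> in M. \<not> ?S \<omega> \<le> of_nat k" for k
    using AE_space[of M] by (rule AE_mp[OF AE_conjI, OF _ _ AE_I2]) auto
  then have "AE \<omega> in M. \<forall>k. \<not> ?S \<omega> \<le> of_nat k" by (simp add: AE_all_countable)
  then show ?thesis
  proof (rule AE_mp, intro AE_I2 impI)
    fix \<omega> assume "\<forall>k. \<not> ?S \<omega> \<le> of_nat k"
    then have "\<not> ?S \<omega> < top" using ennreal_Ex_less_of_nat[of "?S \<omega>"] less_imp_le by blast
    then show "?S \<omega> = \<infinity>" using less_top[of "?S \<omega>"] by simp
  qed
qed

end

end

text \<open>The distributional part of \<open>poisson_process\<close>, for an arbitrary family
  \<open>N\<close> of counts. Superposition, change of the probability space and thinning are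
  carried out for counts with multiplicity, before the points are known to be distinct.\<close>

definition poisson_counts :: "'w measure \<Rightarrow> ('b::topological_space set \<Rightarrow> 'w \<Rightarrow> ennreal) \<Rightarrow> 'b measure \<Rightarrow> bool" where
  "poisson_counts M N \<Lambda> \<longleftrightarrow> prob_space M \<and> (\<forall>B\<in>sets borel. N B \<in> borel_measurable M) \<and>
     (\<forall>B\<in>sets borel. emeasure \<Lambda> B < \<infinity> \<longrightarrow>
        (\<forall>k::nat. measure M {\<omega>\<in>space M. N B \<omega> = of_nat k} = poisson_density (measure \<Lambda> B) k)) \<and>
     (\<forall>B\<in>sets borel. emeasure \<Lambda> B = \<infinity> \<longrightarrow> (AE \<omega> in M. N B \<omega> = \<infinity>)) \<and>
     (\<forall>(I::nat set) B. finite I \<and> (\<forall>i\<in>I. B i \<in> sets borel) \<and> disjoint_family_on B I \<longrightarrow>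
        prob_space.indep_vars M (\<lambda>_. borel) (\<lambda>i \<omega>. N (B i) \<omega>) I)"

section \<open>Superposition of countably many independent Poisson samples\<close>

locale poisson_superposition =
  fixes \<mu> :: "nat \<Rightarrow> 'b::topological_space measure" and r :: "nat \<Rightarrow> real"
  assumes prob_\<mu>: "\<And>i. prob_space (\<mu> i)" and sets_\<mu>: "\<And>i. sets (\<mu> i) = sets borel"
    and r: "\<And>i. r i > 0"
begin

definition samples :: "(nat \<Rightarrow> nat \<times> (nat \<Rightarrow> 'b)) measure" where
  "samples = PiM UNIV (\<lambda>i. poisson_sample (r i) (\<mu> i))"

definition total_count :: "'b set \<Rightarrow> (nat \<Rightarrow> nat \<times> (nat \<Rightarrow> 'b)) \<Rightarrow> ennreal" where
  "total_count B \<omega> = (\<Sum>i. of_nat (count_below (\<omega> i) B))"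

sublocale S: product_prob_space "\<lambda>i. poisson_sample (r i) (\<mu> i)" UNIV
  by (intro product_prob_spaceI prob_space_poisson_sample prob_\<mu>)

lemma prob_space_samples: "prob_space samples"
  unfolding samples_def by (intro prob_space_PiM prob_space_poisson_sample prob_\<mu>)

lemma measurable_cell_count:
  assumes "B \<in> sets borel"
  shows "(\<lambda>\<omega>. count_below (\<omega> i) B) \<in> measurable samples (count_space UNIV)"
proof -
  have "(\<lambda>\<omega>. \<omega> i) \<in> measurable samples (poisson_sample (r i) (\<mu> i))"
    unfolding samples_def by (rule measurable_component_singleton) simp
  then show ?thesis
    by (rule measurable_compose[OF _ measurable_count_below]) (simp add: sets_\<mu> assms)
qed

text \<open>Index pairs are grouped by sample: different samples are independent by construction,
  and the cells within one sample are handled by \<open>poisson_sample_counts\<close>.\<close>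

lemma prob_cell_counts:
  fixes B :: "'l \<Rightarrow> 'b set" and J :: "(nat \<times> 'l) set"
  assumes J: "finite J" "J \<subseteq> UNIV \<times> L" and B: "\<And>l. l \<in> L \<Longrightarrow> B l \<in> sets borel"
    and disj: "disjoint_family_on B L"
  shows "measure samples {\<omega>\<in>space samples. \<forall>j\<in>J. count_below (\<omega> (fst j)) (B (snd j)) = k j} =
    (\<Prod>j\<in>J. poisson_density (r (fst j) * measure (\<mu> (fst j)) (B (snd j))) (k j))"
proof -
  define Jl where "Jl i = {l. (i, l) \<in> J}" for i
  have Jl: "finite (Jl i)" "Jl i \<subseteq> L" for i
  proof -
    have "Jl i \<subseteq> snd ` J" by (force simp: Jl_def)
    then show "finite (Jl i)" using J(1) finite_subset by blast
    show "Jl i \<subseteq> L" using J(2) by (auto simp: Jl_def)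
  qed
  have JS: "J = Sigma (fst ` J) Jl" by (force simp: Jl_def)
  let ?X = "\<lambda>i. {q\<in>space (poisson_sample (r i) (\<mu> i)). \<forall>l\<in>Jl i. count_below q (B l) = k (i, l)}"
  have X: "?X i \<in> sets (poisson_sample (r i) (\<mu> i))" for i
  proof -
    have "Measurable.pred (poisson_sample (r i) (\<mu> i)) (\<lambda>q. \<forall>l\<in>Jl i. count_below q (B l) = k (i, l))"
      using Jl B by (intro pred_intros_finite(3) pred_count_space_const1 measurable_count_below)
        (auto simp: sets_\<mu>)
    then show ?thesis by (simp add: pred_def)
  qed
  have "{\<omega>\<in>space samples. \<forall>j\<in>J. count_below (\<omega> (fst j)) (B (snd j)) = k j} =
      {\<omega>\<in>space samples. \<forall>i\<in>fst ` J. \<omega> i \<in> ?X i}"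
    by (force simp: Jl_def samples_def space_PiM PiE_def Pi_def)
  then have "emeasure samples {\<omega>\<in>space samples. \<forall>j\<in>J. count_below (\<omega> (fst j)) (B (snd j)) = k j} =
      (\<Prod>i\<in>fst ` J. emeasure (poisson_sample (r i) (\<mu> i)) (?X i))"
    unfolding samples_def using J(1) X by (simp only:) (intro S.emeasure_PiM_Collect, auto)
  also have "\<dots> = ennreal (\<Prod>i\<in>fst ` J. measure (poisson_sample (r i) (\<mu> i)) (?X i))"
    by (simp add: prod_ennreal finite_measure.emeasure_eq_measure
        prob_space.finite_measure prob_space_poisson_sample prob_\<mu>)
  finally have "measure samples {\<omega>\<in>space samples. \<forall>j\<in>J. count_below (\<omega> (fst j)) (B (snd j)) = k j} =
      (\<Prod>i\<in>fst ` J. measure (poisson_sample (r i) (\<mu> i)) (?X i))"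
    by (simp add: measure_def prod_nonneg)
  also have "\<dots> = (\<Prod>i\<in>fst ` J. \<Prod>l\<in>Jl i. poisson_density (r i * measure (\<mu> i) (B l)) (k (i, l)))"
  proof (rule prod.cong[OF refl])
    fix i
    interpret \<mu>: prob_space "\<mu> i" by (rule prob_\<mu>)
    show "measure (poisson_sample (r i) (\<mu> i)) (?X i) =
      (\<Prod>l\<in>Jl i. poisson_density (r i * measure (\<mu> i) (B l)) (k (i, l)))"
      using Jl B disj by (intro \<mu>.poisson_sample_counts r) (auto simp: sets_\<mu> intro: disjoint_family_on_mono)
  qed
  also have "\<dots> = (\<Prod>j\<in>J. poisson_density (r (fst j) * measure (\<mu> (fst j)) (B (snd j))) (k j))"
    using J(1) Jl by (subst (2) JS, subst prod.Sigma) (auto simp: case_prod_beta)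
  finally show ?thesis .
qed

lemma prob_cell_count:
  assumes "B \<in> sets borel"
  shows "measure samples {\<omega>\<in>space samples. count_below (\<omega> i) B = k} =
    poisson_density (r i * measure (\<mu> i) B) k"
  using prob_cell_counts[of "{(i, ())}" UNIV "\<lambda>_. B" "\<lambda>_. k"] assms by (simp add: disjoint_family_on_def)

lemma indep_cell_counts:
  fixes B :: "'l \<Rightarrow> 'b set"
  assumes B: "\<And>l. l \<in> L \<Longrightarrow> B l \<in> sets borel" and disj: "disjoint_family_on B L"
  shows "prob_space.indep_vars samples (\<lambda>_. count_space UNIV)
    (\<lambda>j \<omega>. count_below (\<omega> (fst j)) (B (snd j))) ((UNIV :: nat set) \<times> L)"
proof -
  interpret P: prob_space samples by (rule prob_space_samples)
  show ?thesis
  proof (rule P.indep_vars_nat_valuedI)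
    show "(\<lambda>\<omega>. count_below (\<omega> (fst j)) (B (snd j))) \<in> measurable samples (count_space UNIV)"
      if "j \<in> UNIV \<times> L" for j :: "nat \<times> 'l" using that B by (intro measurable_cell_count) auto
    fix J :: "(nat \<times> 'l) set" and k assume J: "J \<subseteq> UNIV \<times> L" "finite J" "J \<noteq> {}"
    have "P.prob {\<omega>\<in>space samples. count_below (\<omega> (fst j)) (B (snd j)) = k j} =
        poisson_density (r (fst j) * measure (\<mu> (fst j)) (B (snd j))) (k j)" if "j \<in> J" for j
      using that J B by (intro prob_cell_count) auto
    then show "P.prob {\<omega>\<in>space samples. \<forall>j\<in>J. count_below (\<omega> (fst j)) (B (snd j)) = k j} =
      (\<Prod>j\<in>J. P.prob {\<omega>\<in>space samples. count_below (\<omega> (fst j)) (B (snd j)) = k j})"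
      using prob_cell_counts[OF J(2,1) B disj] by (simp cong: prod.cong)
  qed
qed

text \<open>The count of a set is a sum of independent Poisson variables with total mean
  \<open>emeasure \<Lambda> B\<close>, so the two series lemmas apply. Counts of disjoint sets are
  functions of disjoint columns of the independent double array of cell counts.\<close>

lemma poisson_counts_samples:
  assumes \<Lambda>: "\<And>B. B \<in> sets borel \<Longrightarrow> emeasure \<Lambda> B = (\<Sum>i. ennreal (r i) * emeasure (\<mu> i) B)"
  shows "poisson_counts samples total_count \<Lambda>"
proof -
  interpret P: prob_space samples by (rule prob_space_samples)
  let ?m = "\<lambda>B i. r i * measure (\<mu> i) B"
  have m0: "0 \<le> ?m B i" for B i using r[of i] by simp
  have \<Lambda>': "(\<Sum>i. ennreal (?m B i)) = emeasure \<Lambda> B" if "B \<in> sets borel" for B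
  proof -
    have "ennreal (?m B i) = ennreal (r i) * emeasure (\<mu> i) B" for i
    proof -
      interpret \<mu>: prob_space "\<mu> i" by (rule prob_\<mu>)
      show ?thesis using r[of i] by (simp add: \<mu>.emeasure_eq_measure ennreal_mult)
    qed
    then show ?thesis using \<Lambda>[OF that] by simp
  qed
  have ind1: "P.indep_vars (\<lambda>_. count_space UNIV) (\<lambda>i \<omega>. count_below (\<omega> i) B) UNIV" if "B \<in> sets borel" for B
  proof -
    have J: "P.indep_vars (\<lambda>_. count_space UNIV) (\<lambda>j \<omega>. count_below (\<omega> (fst j)) B) (UNIV \<times> {()})"
      using indep_cell_counts[of "{()}" "\<lambda>_. B"] that by (simp add: disjoint_family_on_def)
    show ?thesis
    proof (rule P.indep_vars_nat_valuedI)
      show "(\<lambda>\<omega>. count_below (\<omega> i) B) \<in> measurable samples (count_space UNIV)" for i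
        using that by (rule measurable_cell_count)
      fix J :: "nat set" and k assume J: "finite J"
      have "P.prob {\<omega>\<in>space samples. \<forall>j\<in>(\<lambda>i. (i, ())) ` J. count_below (\<omega> (fst j)) B = k (fst j)} =
         (\<Prod>j\<in>(\<lambda>i. (i, ())) ` J. poisson_density (r (fst j) * measure (\<mu> (fst j)) B) (k (fst j)))"
        using J that by (intro prob_cell_counts[where L = "{()}" and B = "\<lambda>_. B"]) (auto simp: disjoint_family_on_def)
      then show "P.prob {\<omega>\<in>space samples. \<forall>j\<in>J. count_below (\<omega> j) B = k j} =
         (\<Prod>j\<in>J. P.prob {\<omega>\<in>space samples. count_below (\<omega> j) B = k j})"
        using that by (simp add: prob_cell_count prod.reindex inj_on_def)
    qed
  qed
  note series = ind1 prob_cell_count m0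
  show ?thesis unfolding poisson_counts_def
  proof (intro conjI ballI impI allI)
    show "prob_space samples" by (rule prob_space_samples)
    show "total_count B \<in> borel_measurable samples" if "B \<in> sets borel" for B
      using P.measurable_poisson_series[OF series, OF that that] by (simp add: total_count_def[abs_def])
  next
    fix B :: "'b set" and k :: nat assume B: "B \<in> sets borel" and fin: "emeasure \<Lambda> B < \<infinity>"
    then have "(\<Sum>i. ennreal (?m B i)) = ennreal (measure \<Lambda> B)"
      using \<Lambda>'[OF B] by (simp add: emeasure_eq_ennreal_measure)
    then show "P.prob {\<omega>\<in>space samples. total_count B \<omega> = of_nat k} = poisson_density (measure \<Lambda> B) k"
      unfolding total_count_def by (intro P.poisson_series_finite[OF series, OF B B]) auto
  next
    fix B :: "'b set" assume B: "B \<in> sets borel" and inf: "emeasure \<Lambda> B = \<infinity>"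
    show "AE \<omega> in samples. total_count B \<omega> = \<infinity>"
      unfolding total_count_def
      by (rule P.poisson_series_infinite[OF series, OF B B]) (use \<Lambda>'[OF B] inf in simp)
  next
    fix I :: "nat set" and B :: "nat \<Rightarrow> 'b set"
    assume "finite I \<and> (\<forall>i\<in>I. B i \<in> sets borel) \<and> disjoint_family_on B I"
    then have B: "\<And>i. i \<in> I \<Longrightarrow> B i \<in> sets borel" and disj: "disjoint_family_on B I" by auto
    let ?K = "\<lambda>l. UNIV \<times> {l} :: (nat \<times> nat) set"
    have "P.indep_vars (\<lambda>l. PiM (?K l) (\<lambda>_. count_space UNIV))
        (\<lambda>l \<omega>. restrict (\<lambda>j. count_below (\<omega> (fst j)) (B (snd j))) (?K l)) I"
      by (rule P.indep_vars_restrict[OF indep_cell_counts[OF B disj]])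
        (auto simp: disjoint_family_on_def)
    then have "P.indep_vars (\<lambda>_. borel) (\<lambda>l \<omega>. (\<lambda>f. \<Sum>i. of_nat (f (i, l)) :: ennreal)
       (restrict (\<lambda>j. count_below (\<omega> (fst j)) (B (snd j))) (?K l))) I"
    proof (rule P.indep_vars_compose2)
      fix l
      have [measurable]: "(\<lambda>f. f (i, l)) \<in> measurable (PiM (?K l) (\<lambda>_. count_space (UNIV::nat set))) (count_space UNIV)" for i
        by (rule measurable_component_singleton) auto
      show "(\<lambda>f. \<Sum>i. of_nat (f (i, l)) :: ennreal) \<in> borel_measurable (PiM (?K l) (\<lambda>_. count_space UNIV))"
        by measurable
    qed
    then show "P.indep_vars (\<lambda>_. borel) (\<lambda>i \<omega>. total_count (B i) \<omega>) I"
      by (simp add: total_count_def)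
  qed
qed

end

section \<open>Transfer of Poisson counts between probability spaces and between sets\<close>

lemma indep_vars_empty: "prob_space M \<Longrightarrow> prob_space.indep_vars M M' X {}"
  by (simp add: prob_space.indep_vars_def prob_space.indep_sets_def)

text \<open>Independence says that the joint law is the product of the marginals, so every family
  with the same joint law inherits it.\<close>

lemma indep_vars_joint_law:
  fixes X :: "'i \<Rightarrow> 'w \<Rightarrow> 'b::topological_space"
  assumes M: "prob_space M" and M': "prob_space M'"
    and X: "\<And>i. i \<in> I \<Longrightarrow> X i \<in> borel_measurable M" and X': "\<And>i. i \<in> I \<Longrightarrow> X' i \<in> borel_measurable M'"
    and law: "distr M (PiM I (\<lambda>_. borel)) (\<lambda>x. \<lambda>i\<in>I. X i x) = distr M' (PiM I (\<lambda>_. borel)) (\<lambda>x. \<lambda>i\<in>I. X' i x)"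
    and ind: "prob_space.indep_vars M (\<lambda>_. borel) X I"
  shows "prob_space.indep_vars M' (\<lambda>_. borel) X' I"
proof (cases "I = {}")
  case True
  then show ?thesis using M' by (simp add: indep_vars_empty)
next
  case False
  have "distr M borel (X i) = distr M' borel (X' i)" if i: "i \<in> I" for i
  proof -
    have "distr M borel (X i) = distr (distr M (PiM I (\<lambda>_. borel)) (\<lambda>x. \<lambda>i\<in>I. X i x)) borel (\<lambda>f. f i)"
      using X i by (subst distr_distr) (auto simp: o_def intro!: measurable_restrict)
    also have "\<dots> = distr M' borel (X' i)"
      unfolding law using X' i by (subst distr_distr) (auto simp: o_def intro!: measurable_restrict)
    finally show ?thesis .
  qed
  then have "PiM I (\<lambda>i. distr M borel (X i)) = PiM I (\<lambda>i. distr M' borel (X' i))"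
    by (intro PiM_cong) auto
  then show ?thesis
    using ind law prob_space.indep_vars_iff_distr_eq_PiM'[where M' = "\<lambda>_. borel", OF M False X]
      prob_space.indep_vars_iff_distr_eq_PiM'[where M' = "\<lambda>_. borel", OF M' False X'] by simp
qed

lemma poisson_countsD:
  assumes "poisson_counts M N \<Lambda>"
  shows "prob_space M" "\<And>B. B \<in> sets borel \<Longrightarrow> N B \<in> borel_measurable M"
    "\<And>B k. B \<in> sets borel \<Longrightarrow> emeasure \<Lambda> B < \<infinity> \<Longrightarrow>
      measure M {\<omega>\<in>space M. N B \<omega> = of_nat k} = poisson_density (measure \<Lambda> B) k"
    "\<And>B. B \<in> sets borel \<Longrightarrow> emeasure \<Lambda> B = \<infinity> \<Longrightarrow> AE \<omega> in M. N B \<omega> = \<infinity>"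
    "\<And>I B. finite (I::nat set) \<Longrightarrow> (\<And>i. i \<in> I \<Longrightarrow> B i \<in> sets borel) \<Longrightarrow> disjoint_family_on B I \<Longrightarrow>
        prob_space.indep_vars M (\<lambda>_. borel) (\<lambda>i \<omega>. N (B i) \<omega>) I"
  using assms unfolding poisson_counts_def by auto

text \<open>Each clause of \<open>poisson_counts\<close> speaks only about joint laws of finitely
  many counts; the law of one count is the projection from the index set \<open>{0}\<close>.\<close>

lemma poisson_counts_same_law:
  fixes N :: "'b::topological_space set \<Rightarrow> 'w \<Rightarrow> ennreal"
  assumes N: "poisson_counts M N \<Lambda>" and M': "prob_space M'"
    and N': "\<And>B. B \<in> sets borel \<Longrightarrow> N' B \<in> borel_measurable M'"
    and law: "\<And>(I::nat set) B. finite I \<Longrightarrow> (\<And>i. i \<in> I \<Longrightarrow> B i \<in> sets borel) \<Longrightarrow>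
      distr M (PiM I (\<lambda>_. borel)) (\<lambda>x. \<lambda>i\<in>I. N (B i) x) = distr M' (PiM I (\<lambda>_. borel)) (\<lambda>x. \<lambda>i\<in>I. N' (B i) x)"
  shows "poisson_counts M' N' \<Lambda>"
proof -
  note D = poisson_countsD[OF N]
  have marg: "distr M borel (N B) = distr M' borel (N' B)" if B: "B \<in> sets borel" for B
  proof -
    have "distr M borel (N B) = distr (distr M (PiM {0::nat} (\<lambda>_. borel)) (\<lambda>x. \<lambda>i\<in>{0}. N B x)) borel (\<lambda>f. f 0)"
      using D(2)[OF B] by (subst distr_distr) (auto simp: o_def intro!: measurable_restrict)
    also have "\<dots> = distr (distr M' (PiM {0::nat} (\<lambda>_. borel)) (\<lambda>x. \<lambda>i\<in>{0}. N' B x)) borel (\<lambda>f. f 0)"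
      using law[of "{0}" "\<lambda>_. B"] B by simp
    also have "\<dots> = distr M' borel (N' B)"
      using N'[OF B] by (subst distr_distr) (auto simp: o_def intro!: measurable_restrict)
    finally show ?thesis .
  qed
  have eq: "measure M {\<omega>\<in>space M. N B \<omega> \<in> U} = measure M' {\<omega>\<in>space M'. N' B \<omega> \<in> U}"
    if "B \<in> sets borel" "U \<in> sets borel" for B U
  proof -
    have "measure (distr M borel (N B)) U = measure (distr M' borel (N' B)) U" using marg[OF that(1)] by simp
    then show ?thesis using that D(2) N'
      by (simp add: measure_distr vimage_def Int_def conj_commute)
  qed
  show ?thesis unfolding poisson_counts_def
  proof (intro conjI ballI impI allI)
    fix B :: "'b set" and k :: nat assume B: "B \<in> sets borel" "emeasure \<Lambda> B < \<infinity>"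
    show "measure M' {\<omega>\<in>space M'. N' B \<omega> = of_nat k} = poisson_density (measure \<Lambda> B) k"
      using eq[OF B(1), of "{of_nat k}"] D(3)[OF B] by simp
  next
    fix B :: "'b set" assume B: "B \<in> sets borel" "emeasure \<Lambda> B = \<infinity>"
    interpret M': prob_space M' by fact
    interpret M: prob_space M by (rule D(1))
    have [measurable]: "N B \<in> borel_measurable M" "N' B \<in> borel_measurable M'" using D(2) N' B by auto
    have "M.prob {\<omega>\<in>space M. N B \<omega> \<in> {\<infinity>}} = 1"
      using D(4)[OF B] by (subst M.prob_Collect_eq_1) auto
    then have "M'.prob {\<omega>\<in>space M'. N' B \<omega> \<in> {\<infinity>}} = 1" using eq[OF B(1), of "{\<infinity>}"] by simp
    then show "AE \<omega> in M'. N' B \<omega> = \<infinity>" by (subst (asm) M'.prob_Collect_eq_1) auto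
  next
    fix I :: "nat set" and B :: "nat \<Rightarrow> 'b set"
    assume "finite I \<and> (\<forall>i\<in>I. B i \<in> sets borel) \<and> disjoint_family_on B I"
    then show "prob_space.indep_vars M' (\<lambda>_. borel) (\<lambda>i \<omega>. N' (B i) \<omega>) I"
      using D N' M' law by (intro indep_vars_joint_law[OF D(1) M' _ _ law]) auto
  qed (use M' N' in auto)
qed

lemma poisson_counts_pullback:
  fixes N :: "'b::topological_space set \<Rightarrow> 'w \<Rightarrow> ennreal"
  assumes N: "poisson_counts M N \<Lambda>" and T: "T \<in> measurable M' M" "distr M' M T = M" and M': "prob_space M'"
  shows "poisson_counts M' (\<lambda>B \<omega>. N B (T \<omega>)) \<Lambda>"
proof (rule poisson_counts_same_law[OF N M'])
  note D = poisson_countsD[OF N]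
  show "(\<lambda>\<omega>. N B (T \<omega>)) \<in> borel_measurable M'" if "B \<in> sets borel" for B
    using measurable_compose[OF T(1) D(2)[OF that]] .
  fix I :: "nat set" and B :: "nat \<Rightarrow> 'b set" assume "finite I" and B: "\<And>i. i \<in> I \<Longrightarrow> B i \<in> sets borel"
  have "distr M (PiM I (\<lambda>_. borel)) (\<lambda>x. \<lambda>i\<in>I. N (B i) x) =
      distr (distr M' M T) (PiM I (\<lambda>_. borel)) (\<lambda>x. \<lambda>i\<in>I. N (B i) x)" using T(2) by simp
  also have "\<dots> = distr M' (PiM I (\<lambda>_. borel)) (\<lambda>x. \<lambda>i\<in>I. N (B i) (T x))"
    using T(1) D(2)[OF B] by (subst distr_distr) (auto simp: o_def intro!: measurable_restrict)
  finally show "distr M (PiM I (\<lambda>_. borel)) (\<lambda>x. \<lambda>i\<in>I. N (B i) x) =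
      distr M' (PiM I (\<lambda>_. borel)) (\<lambda>x. \<lambda>i\<in>I. N (B i) (T x))" .
qed

lemma poisson_counts_cong_AE:
  fixes N :: "'b::topological_space set \<Rightarrow> 'w \<Rightarrow> ennreal"
  assumes N: "poisson_counts M N \<Lambda>"
    and N': "\<And>B. B \<in> sets borel \<Longrightarrow> N' B \<in> borel_measurable M"
    and AE: "\<And>B. B \<in> sets borel \<Longrightarrow> AE \<omega> in M. N B \<omega> = N' B \<omega>"
  shows "poisson_counts M N' \<Lambda>"
proof (rule poisson_counts_same_law[OF N _ N'])
  note D = poisson_countsD[OF N]
  show "prob_space M" by (rule D(1))
  fix I :: "nat set" and B :: "nat \<Rightarrow> 'b set" assume I: "finite I" and B: "\<And>i. i \<in> I \<Longrightarrow> B i \<in> sets borel"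
  have "AE \<omega> in M. \<forall>i\<in>I. N (B i) \<omega> = N' (B i) \<omega>"
    by (rule AE_finite_allI[OF I]) (use AE B in auto)
  then have "AE \<omega> in M. (\<lambda>i\<in>I. N (B i) \<omega>) = (\<lambda>i\<in>I. N' (B i) \<omega>)"
    by eventually_elim (auto simp: restrict_def fun_eq_iff)
  then show "distr M (PiM I (\<lambda>_. borel)) (\<lambda>x. \<lambda>i\<in>I. N (B i) x) =
      distr M (PiM I (\<lambda>_. borel)) (\<lambda>x. \<lambda>i\<in>I. N' (B i) x)"
    by (intro distr_cong_AE) (auto intro!: measurable_restrict D(2) N' B)
qed auto

text \<open>With \<open>T B\<close> the part of a hypograph that lies over \<open>B\<close>, this
  performs thinning and projection in one step.\<close>

lemma poisson_counts_map:
  fixes N :: "'b::topological_space set \<Rightarrow> 'w \<Rightarrow> ennreal" and T :: "'c::topological_space set \<Rightarrow> 'b set"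
  assumes N: "poisson_counts M N \<Lambda>"
    and T: "\<And>B. B \<in> sets borel \<Longrightarrow> T B \<in> sets borel" "\<And>A B. A \<inter> B = {} \<Longrightarrow> T A \<inter> T B = {}"
    and \<Lambda>': "\<And>B. B \<in> sets borel \<Longrightarrow> emeasure \<Lambda> (T B) = emeasure \<Lambda>' B"
  shows "poisson_counts M (\<lambda>B. N (T B)) \<Lambda>'"
proof -
  note D = poisson_countsD[OF N]
  have "measure \<Lambda> (T B) = measure \<Lambda>' B" if "B \<in> sets borel" for B
    using \<Lambda>'[OF that] by (simp add: measure_def)
  moreover have "prob_space.indep_vars M (\<lambda>_. borel) (\<lambda>i \<omega>. N (T (B i)) \<omega>) I"
    if "finite I" "\<forall>i\<in>I. B i \<in> sets borel" "disjoint_family_on B I" for I :: "nat set" and B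
    using that T by (intro D(5)) (auto simp: disjoint_family_on_def)
  ultimately show ?thesis
    unfolding poisson_counts_def using D(1-4) T \<Lambda>' by simp
qed

section \<open>Almost sure distinctness of the sample points\<close>

context poisson_superposition
begin

lemma emeasure_poisson_sample_points:
  assumes J: "finite J" and A: "\<And>j. j \<in> J \<Longrightarrow> A j \<in> sets borel"
  shows "emeasure (poisson_sample (r i) (\<mu> i)) {q. \<forall>j\<in>J. snd q j \<in> A j} = (\<Prod>j\<in>J. emeasure (\<mu> i) (A j))"
proof -
  interpret \<mu>: prob_space "\<mu> i" by (rule prob_\<mu>)
  interpret P: product_prob_space "\<lambda>_::nat. \<mu> i" UNIV ..
  have sp: "space (\<mu> i) = UNIV" using sets_eq_imp_space_eq[OF sets_\<mu>] by simp
  let ?E = "{x\<in>space (PiM UNIV (\<lambda>_. \<mu> i)). \<forall>j\<in>J. x j \<in> A j}"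
  have E: "?E \<in> sets (PiM UNIV (\<lambda>_. \<mu> i))"
  proof -
    have "Measurable.pred (PiM UNIV (\<lambda>_. \<mu> i)) (\<lambda>x. \<forall>j\<in>J. x j \<in> A j)"
    proof (intro pred_intros_finite(3)[OF J])
      fix j assume "j \<in> J"
      then have [measurable]: "A j \<in> sets (\<mu> i)" using A sets_\<mu> by blast
      show "Measurable.pred (PiM UNIV (\<lambda>_. \<mu> i)) (\<lambda>x. x j \<in> A j)" by measurable
    qed
    then show ?thesis by (simp add: pred_def)
  qed
  have eq: "{q. \<forall>j\<in>J. snd q j \<in> A j} = (UNIV :: nat set) \<times> ?E" by (auto simp: space_PiM sp)
  have "emeasure (poisson_sample (r i) (\<mu> i)) {q. \<forall>j\<in>J. snd q j \<in> A j} =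
      emeasure (measure_pmf (poisson_pmf (r i))) UNIV * emeasure (PiM UNIV (\<lambda>_. \<mu> i)) ?E"
    unfolding poisson_sample_def eq by (intro P.emeasure_pair_measure_Times E) simp
  also have "emeasure (PiM UNIV (\<lambda>_. \<mu> i)) ?E = (\<Prod>j\<in>J. emeasure (\<mu> i) (A j))"
    using J A by (intro P.emeasure_PiM_Collect) (auto simp: sets_\<mu>)
  finally show ?thesis by (simp add: measure_pmf.emeasure_space_1[simplified])
qed

lemma measurable_sample_point: "(\<lambda>\<omega>. snd (\<omega> i) j) \<in> borel_measurable samples"
proof -
  have 1: "(\<lambda>\<omega>. \<omega> i) \<in> measurable samples (poisson_sample (r i) (\<mu> i))"
    unfolding samples_def by (rule measurable_component_singleton) simp
  have "(\<lambda>q. snd q j) \<in> measurable (poisson_sample (r i) (\<mu> i)) (\<mu> i)"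
    unfolding poisson_sample_def by measurable
  from measurable_compose[OF 1 this] show ?thesis
    by (simp add: measurable_cong_sets[OF refl sets_\<mu>])
qed

lemma measurable_sample_count: "(\<lambda>\<omega>. fst (\<omega> i)) \<in> measurable samples (count_space UNIV)"
proof -
  have 1: "(\<lambda>\<omega>. \<omega> i) \<in> measurable samples (poisson_sample (r i) (\<mu> i))"
    unfolding samples_def by (rule measurable_component_singleton) simp
  have "fst \<in> measurable (poisson_sample (r i) (\<mu> i)) (count_space UNIV)"
    unfolding poisson_sample_def by measurable
  from measurable_compose[OF 1 this] show ?thesis .
qed

lemma emeasure_two_sample_points:
  assumes ne: "(i, j) \<noteq> (i', j')" and A: "A \<in> sets borel" "B \<in> sets borel"
  shows "emeasure samples {\<omega>\<in>space samples. snd (\<omega> i) j \<in> A \<and> snd (\<omega> i') j' \<in> B} =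
    emeasure (\<mu> i) A * emeasure (\<mu> i') B"
proof -
  have sp: "space (\<mu> i) = UNIV" for i using sets_eq_imp_space_eq[OF sets_\<mu>] by simp
  have meas: "{q. \<forall>j\<in>J. snd q j \<in> A j} \<in> sets (poisson_sample (r i) (\<mu> i))"
    if "finite J" "\<And>j. j \<in> J \<Longrightarrow> A j \<in> sets borel" for i and J and A :: "nat \<Rightarrow> 'b set"
  proof -
    have "Measurable.pred (poisson_sample (r i) (\<mu> i)) (\<lambda>q. \<forall>j\<in>J. snd q j \<in> A j)"
    proof (intro pred_intros_finite(3)[OF that(1)])
      fix j assume "j \<in> J"
      then have [measurable]: "A j \<in> sets (\<mu> i)" using that sets_\<mu> by blast
      show "Measurable.pred (poisson_sample (r i) (\<mu> i)) (\<lambda>q. snd q j \<in> A j)"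
        unfolding poisson_sample_def by measurable
    qed
    moreover have "space (poisson_sample (r i) (\<mu> i)) = UNIV"
      by (auto simp: poisson_sample_def space_pair_measure space_PiM sp)
    ultimately show ?thesis by (simp add: pred_def)
  qed
  show ?thesis
  proof (cases "i = i'")
    case True
    then have jj: "j \<noteq> j'" using ne by simp
    let ?C = "{q. \<forall>l\<in>{j, j'}. snd q l \<in> (if l = j then A else B)}"
    have "{\<omega>\<in>space samples. snd (\<omega> i) j \<in> A \<and> snd (\<omega> i') j' \<in> B} =
      {\<omega>\<in>space samples. \<forall>l\<in>{i}. \<omega> l \<in> ?C}" using True jj by auto
    also have "emeasure samples \<dots> = (\<Prod>l\<in>{i}. emeasure (poisson_sample (r l) (\<mu> l)) ?C)"
      unfolding samples_def using A by (intro S.emeasure_PiM_Collect meas) auto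
    also have "\<dots> = emeasure (\<mu> i) A * emeasure (\<mu> i) B"
      using A jj by (simp only: prod.insert finite.emptyI empty_iff prod.empty not_False_eq_True mult_1_right,
        subst emeasure_poisson_sample_points) auto
    finally show ?thesis using True by simp
  next
    case False
    let ?C = "\<lambda>l. if l = i then {q. \<forall>m\<in>{j}. snd q m \<in> A} else {q. \<forall>m\<in>{j'}. snd q m \<in> B}"
    have "{\<omega>\<in>space samples. snd (\<omega> i) j \<in> A \<and> snd (\<omega> i') j' \<in> B} =
      {\<omega>\<in>space samples. \<forall>l\<in>{i, i'}. \<omega> l \<in> ?C l}" using False by auto
    also have "emeasure samples \<dots> = (\<Prod>l\<in>{i, i'}. emeasure (poisson_sample (r l) (\<mu> l)) (?C l))"
      unfolding samples_def
    proof (rule S.emeasure_PiM_Collect)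
      fix l
      show "?C l \<in> sets (poisson_sample (r l) (\<mu> l))"
        using meas[of "{j}" "\<lambda>_. A"] meas[of "{j'}" "\<lambda>_. B"] A by simp
    qed auto
    also have "\<dots> = emeasure (\<mu> i) A * emeasure (\<mu> i') B"
      using False emeasure_poisson_sample_points[of "{j}" "\<lambda>_. A" i]
        emeasure_poisson_sample_points[of "{j'}" "\<lambda>_. B" i'] A by simp
    finally show ?thesis .
  qed
qed

text \<open>By Fubini: two different points have a product law, and every section of the set of
  pairs with equal image is a fibre of \<open>\<pi>\<close>, which is null. The map
  \<open>\<pi>\<close> is there because the points must stay distinct after a coordinate has been
  forgotten.\<close>

lemma AE_sample_points_distinct:
  fixes \<pi> :: "'b \<Rightarrow> 'c::euclidean_space"
  assumes \<pi> [measurable]: "\<pi> \<in> borel_measurable borel" and diffuse: "\<And>i c. emeasure (\<mu> i) {x. \<pi> x = c} = 0"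
    and ne: "(i, j) \<noteq> (i', j')"
  shows "AE \<omega> in samples. \<pi> (snd (\<omega> i) j) \<noteq> \<pi> (snd (\<omega> i') j')"
proof -
  interpret \<mu>i: prob_space "\<mu> i" by (rule prob_\<mu>)
  interpret \<mu>i': prob_space "\<mu> i'" by (rule prob_\<mu>)
  note measurable_sample_point [measurable]
  let ?f = "\<lambda>\<omega>. (snd (\<omega> i) j, snd (\<omega> i') j')"
  have setspair: "sets (\<mu> i \<Otimes>\<^sub>M \<mu> i') = sets (borel \<Otimes>\<^sub>M borel)"
    by (intro sets_pair_measure_cong sets_\<mu>)
  have f: "?f \<in> measurable samples (\<mu> i \<Otimes>\<^sub>M \<mu> i')"
    by (subst measurable_cong_sets[OF refl setspair]) measurable
  have law: "\<mu> i \<Otimes>\<^sub>M \<mu> i' = distr samples (\<mu> i \<Otimes>\<^sub>M \<mu> i') ?f"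
  proof (rule pair_measure_eqI)
    show "sigma_finite_measure (\<mu> i)" "sigma_finite_measure (\<mu> i')" by unfold_locales
    fix A B assume AB: "A \<in> sets (\<mu> i)" "B \<in> sets (\<mu> i')"
    then have "emeasure (distr samples (\<mu> i \<Otimes>\<^sub>M \<mu> i') ?f) (A \<times> B) = emeasure samples (?f -` (A \<times> B) \<inter> space samples)"
      using f by (intro emeasure_distr) auto
    also have "?f -` (A \<times> B) \<inter> space samples = {\<omega>\<in>space samples. snd (\<omega> i) j \<in> A \<and> snd (\<omega> i') j' \<in> B}" by auto
    also have "emeasure samples \<dots> = emeasure (\<mu> i) A * emeasure (\<mu> i') B"
      using AB by (intro emeasure_two_sample_points ne) (auto simp: sets_\<mu>)
    finally show "emeasure (\<mu> i) A * emeasure (\<mu> i') B = emeasure (distr samples (\<mu> i \<Otimes>\<^sub>M \<mu> i') ?f) (A \<times> B)" by simp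
  qed simp
  let ?D = "{p. \<pi> (fst p) = \<pi> (snd p)}"
  have "{p\<in>space (borel \<Otimes>\<^sub>M borel). dist (\<pi> (fst p)) (\<pi> (snd p)) = 0} \<in> sets (borel \<Otimes>\<^sub>M borel)"
    by measurable
  then have D: "?D \<in> sets (\<mu> i \<Otimes>\<^sub>M \<mu> i')" by (simp add: setspair space_pair_measure)
  have "emeasure (\<mu> i \<Otimes>\<^sub>M \<mu> i') ?D = (\<integral>\<^sup>+x. emeasure (\<mu> i') (Pair x -` ?D) \<partial>\<mu> i)"
    by (rule \<mu>i'.emeasure_pair_measure_alt[OF D])
  also have "\<dots> = 0"
  proof -
    have "Pair x -` ?D = {y. \<pi> y = \<pi> x}" for x by auto
    then show ?thesis by (simp add: diffuse)
  qed
  finally have "emeasure samples (?f -` ?D \<inter> space samples) = 0"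
    using emeasure_distr[OF f D] law by simp
  moreover have "?f -` ?D \<inter> space samples \<in> sets samples" using f D by (rule measurable_sets)
  ultimately have "?f -` ?D \<inter> space samples \<in> null_sets samples" by auto
  then show ?thesis by (rule AE_I') auto
qed

lemma AE_sample_points_inj:
  fixes \<pi> :: "'b \<Rightarrow> 'c::euclidean_space"
  assumes \<pi>: "\<pi> \<in> borel_measurable borel" and diffuse: "\<And>i c. emeasure (\<mu> i) {x. \<pi> x = c} = 0"
  shows "AE \<omega> in samples. inj (\<lambda>(i, j). \<pi> (snd (\<omega> i) j))"
proof -
  have "AE \<omega> in samples. \<forall>p p'. p \<noteq> p' \<longrightarrow> \<pi> (snd (\<omega> (fst p)) (snd p)) \<noteq> \<pi> (snd (\<omega> (fst p')) (snd p'))"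
    unfolding AE_all_countable
  proof (intro allI)
    fix p p' :: "nat \<times> nat"
    show "AE \<omega> in samples. p \<noteq> p' \<longrightarrow> \<pi> (snd (\<omega> (fst p)) (snd p)) \<noteq> \<pi> (snd (\<omega> (fst p')) (snd p'))"
      using AE_sample_points_distinct[OF assms, of "fst p" "snd p" "fst p'" "snd p'"]
      by (cases "p = p'") auto
  qed
  then show ?thesis by eventually_elim (auto simp: inj_on_def)
qed

text \<open>Flattening the double index brings the count with multiplicity into the form of
  \<open>num_points_active_points\<close>: a sum over one enumeration with activity flags.\<close>

lemma total_count_eq:
  "total_count B \<omega> = (\<Sum>k. if snd (prod_decode k) < fst (\<omega> (fst (prod_decode k))) \<and>
      snd (\<omega> (fst (prod_decode k))) (snd (prod_decode k)) \<in> B then 1 else 0)"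
proof -
  have "of_nat (count_below (\<omega> i) B) = (\<Sum>j. if j < fst (\<omega> i) \<and> snd (\<omega> i) j \<in> B then 1 else 0 :: ennreal)" for i
  proof -
    let ?J = "{j. j < fst (\<omega> i) \<and> snd (\<omega> i) j \<in> B}"
    have fin: "finite ?J" by simp
    have "(\<Sum>j. if j < fst (\<omega> i) \<and> snd (\<omega> i) j \<in> B then 1 else 0 :: ennreal) =
        (\<Sum>j\<in>?J. if j < fst (\<omega> i) \<and> snd (\<omega> i) j \<in> B then 1 else 0)"
      by (rule suminf_finite[OF fin]) auto
    also have "\<dots> = of_nat (card ?J)" by simp
    finally show ?thesis by (simp add: count_below_def)
  qed
  then have "(\<Sum>k. (\<lambda>p. if snd p < fst (\<omega> (fst p)) \<and> snd (\<omega> (fst p)) (snd p) \<in> B then 1 else 0 :: ennreal) (prod_decode k)) =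
      (\<Sum>i. of_nat (count_below (\<omega> i) B))"
    by (intro suminf_ennreal_2dimen) simp
  then show ?thesis by (simp add: total_count_def)
qed

end

subsection \<open>A Poisson process on the space of real sequences\<close>

text \<open>The shells cut the space into pieces of finite positive volume, on which uniform
  distributions exist.\<close>

lemma shell_measure_pos:
  "measure lborel (ball (0::'b::euclidean_space) (real (Suc i)) - ball 0 (real i)) > 0"
proof -
  have fin: "emeasure lborel (ball (0::'b) (real (Suc i))) \<noteq> \<infinity>"
    using emeasure_lborel_ball_finite[of "0::'b" "real (Suc i)"] by (metis less_irrefl)
  have "measure lborel (ball (0::'b) (real (Suc i)) - ball 0 (real i)) =
      measure lborel (ball (0::'b) (real (Suc i))) - measure lborel (ball (0::'b) (real i))"
    by (intro measure_Diff fin subset_ball) simp_all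
  also have "\<dots> = unit_ball_vol (real DIM('b)) * (real (Suc i) ^ DIM('b) - real i ^ DIM('b))"
    using content_ball[of "real (Suc i)" "0::'b"] content_ball[of "real i" "0::'b"]
    by (simp add: right_diff_distrib)
  also have "\<dots> > 0"
  proof -
    have "real i ^ DIM('b) < real (Suc i) ^ DIM('b)" by (intro power_strict_mono) simp_all
    then show ?thesis by (intro mult_pos_pos) simp_all
  qed
  finally show ?thesis .
qed

text \<open>The index \<open>n\<close> stands for sample \<open>i\<close>, slot \<open>j\<close> and
  coordinate \<open>l\<close>. Slot 0 holds the number of points, so point \<open>j\<close> occupies
  slot \<open>j + 1\<close>. Redundant entries are harmless because \<open>decode_samples\<close>
  only has to be a left inverse.\<close>

definition encode_samples :: "(nat \<Rightarrow> nat \<times> (nat \<Rightarrow> 'b::euclidean_space)) \<Rightarrow> nat \<Rightarrow> real" where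
  "encode_samples \<omega> n = (case prod_decode n of (i, n') \<Rightarrow> case prod_decode n' of (j, l) \<Rightarrow>
     if j = 0 then real (fst (\<omega> i)) else snd (\<omega> i) (j - 1) \<bullet> from_nat_into Basis l)"

definition decode_samples :: "(nat \<Rightarrow> real) \<Rightarrow> nat \<Rightarrow> nat \<times> (nat \<Rightarrow> 'b::euclidean_space)" where
  "decode_samples z i = (nat \<lfloor>z (prod_encode (i, prod_encode (0, 0)))\<rfloor>,
     \<lambda>j. \<Sum>b\<in>Basis. z (prod_encode (i, prod_encode (Suc j, to_nat_on Basis b))) *\<^sub>R b)"

lemma decode_encode_samples: "decode_samples (encode_samples \<omega>) = \<omega>"
proof
  fix i
  have "(\<Sum>b\<in>Basis. (snd (\<omega> i) j \<bullet> from_nat_into Basis (to_nat_on Basis b)) *\<^sub>R b) = snd (\<omega> i) j" for j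
    using euclidean_representation[of "snd (\<omega> i) j"] by (simp add: countable_finite cong: sum.cong)
  then show "decode_samples (encode_samples \<omega>) i = \<omega> i"
    by (simp add: decode_samples_def encode_samples_def prod_eq_iff)
qed

lemma (in poisson_superposition) measurable_encode_samples:
  assumes "\<And>i j. (\<lambda>\<omega>. X i \<omega> j :: 'c::euclidean_space) \<in> borel_measurable samples"
    and "\<And>i. (\<lambda>\<omega>. N i \<omega>) \<in> measurable samples (count_space UNIV)"
  shows "(\<lambda>\<omega>. encode_samples (\<lambda>i. (N i \<omega>, X i \<omega>))) \<in> measurable samples (PiM UNIV (\<lambda>_. borel))"
proof (rule measurable_PiM_single')
  fix n
  obtain i j l where n: "prod_decode n = (i, prod_encode (j, l))" by (metis prod.exhaust prod_decode_inverse)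
  note assms [measurable]
  show "(\<lambda>\<omega>. encode_samples (\<lambda>i. (N i \<omega>, X i \<omega>)) n) \<in> borel_measurable samples"
    unfolding encode_samples_def n by (cases "j = 0") simp_all
qed auto

text \<open>Uniform samples on the shells, with the volume of the shell as Poisson parameter, add up
  to intensity \<open>lborel\<close>. The law of the samples is pushed to real sequences by
  \<open>encode_samples\<close>; decoding is a left inverse, so pulling back along it recovers the
  samples with their law.\<close>

lemma poisson_enumeration_lborel:
  fixes \<pi> :: "'b::euclidean_space \<Rightarrow> 'c::euclidean_space"
  assumes \<pi>: "\<pi> \<in> borel_measurable borel" and diffuse: "\<And>c. emeasure lborel {x. \<pi> x = c} = 0"
  obtains P :: "(nat \<Rightarrow> real) measure" and act and x :: "nat \<Rightarrow> (nat \<Rightarrow> real) \<Rightarrow> 'b" where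
    "prob_space P" "\<And>k. Measurable.pred P (act k)" "\<And>k. x k \<in> borel_measurable P"
    "poisson_counts P (\<lambda>B \<omega>. \<Sum>k. if act k \<omega> \<and> x k \<omega> \<in> B then 1 else 0) lborel"
    "AE \<omega> in P. inj (\<lambda>k. \<pi> (x k \<omega>))"
proof -
  define A :: "nat \<Rightarrow> 'b set" where "A i = ball 0 (real (Suc i)) - ball 0 (real i)" for i
  define r where "r i = measure lborel (A i)" for i
  define \<mu> where "\<mu> i = uniform_measure lborel (A i)" for i
  have A_sets [measurable]: "A i \<in> sets borel" for i by (simp add: A_def)
  have A_fin: "emeasure lborel (A i) < \<infinity>" for i
    using emeasure_mono[of "A i" "ball 0 (real (Suc i))" lborel] emeasure_lborel_ball_finite
    by (auto simp: A_def intro: le_less_trans)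
  have r: "r i > 0" for i unfolding r_def A_def by (rule shell_measure_pos)
  have emA: "emeasure lborel (A i) = ennreal (r i)" for i
    using A_fin[of i] by (simp add: r_def emeasure_eq_ennreal_measure)
  have A_disj: "disjoint_family A"
    unfolding disjoint_family_on_def
  proof (intro ballI impI)
    have *: "A i \<inter> A j = {}" if "i < j" for i j
    proof -
      have "ball (0::'b) (real (Suc i)) \<subseteq> ball 0 (real j)" using that by (intro subset_ball) simp
      then show ?thesis by (auto simp: A_def)
    qed
    fix i j :: nat assume "i \<noteq> j"
    then show "A i \<inter> A j = {}" using *[of i j] *[of j i] by (cases "i < j") auto
  qed
  have A_cover: "(\<Union>i. A i) = UNIV"
  proof -
    have "x \<in> A (nat \<lfloor>norm x\<rfloor>)" for x :: 'b
      unfolding A_def by (auto simp: not_less) linarith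
    then show ?thesis by blast
  qed
  interpret poisson_superposition \<mu> r
  proof (rule poisson_superposition.intro)
    show "prob_space (\<mu> i)" for i
      unfolding \<mu>_def using emA r A_fin by (intro prob_space_uniform_measure) (auto simp: ennreal_eq_0_iff not_le)
  qed (auto simp: \<mu>_def r)
  have mean: "emeasure lborel B = (\<Sum>i. ennreal (r i) * emeasure (\<mu> i) B)" if B: "B \<in> sets borel" for B
  proof -
    have "ennreal (r i) * emeasure (\<mu> i) B = emeasure lborel (A i \<inter> B)" for i
    proof -
      have "emeasure (\<mu> i) B = emeasure lborel (A i \<inter> B) / ennreal (r i)"
        using B by (simp add: \<mu>_def emA)
      then have "ennreal (r i) * emeasure (\<mu> i) B = emeasure lborel (A i \<inter> B) * ennreal (r i) / ennreal (r i)"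
        by (simp only: ennreal_times_divide mult.commute[of "ennreal (r i)"])
      also have "\<dots> = emeasure lborel (A i \<inter> B)"
        using r[of i] by (intro mult_divide_eq_ennreal) auto
      finally show ?thesis .
    qed
    moreover have "(\<Sum>i. emeasure lborel (A i \<inter> B)) = emeasure lborel (\<Union>i. A i \<inter> B)"
      using A_disj B by (intro suminf_emeasure) (auto simp: disjoint_family_on_def)
    moreover have "(\<Union>i. A i \<inter> B) = B" using A_cover by auto
    ultimately show ?thesis by simp
  qed
  have PC: "poisson_counts samples total_count lborel" by (rule poisson_counts_samples[OF mean])
  have diffuse': "emeasure (\<mu> i) {x. \<pi> x = c} = 0" for i c
  proof -
    have "{x \<in> space borel. \<pi> x = c} \<in> sets borel" using \<pi> by measurable
    then have S: "{x. \<pi> x = c} \<in> sets borel" by simp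
    have "emeasure lborel (A i \<inter> {x. \<pi> x = c}) \<le> emeasure lborel {x. \<pi> x = c}"
      using S by (intro emeasure_mono) auto
    then show ?thesis using S diffuse by (simp add: \<mu>_def)
  qed
  have INJ: "AE \<omega> in samples. inj (\<lambda>(i, j). \<pi> (snd (\<omega> i) j))"
    by (rule AE_sample_points_inj[OF \<pi> diffuse'])
  interpret Sa: prob_space samples by (rule prob_space_samples)
  define Z where "Z = (PiM UNIV (\<lambda>_. borel) :: (nat \<Rightarrow> real) measure)"
  have enc: "encode_samples \<in> measurable samples Z"
    using measurable_encode_samples[of "\<lambda>i \<omega>. snd (\<omega> i)" "\<lambda>i \<omega>. fst (\<omega> i)"]
      measurable_sample_point measurable_sample_count by (simp add: Z_def)
  have dec: "decode_samples \<in> measurable Z samples"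
    unfolding samples_def
  proof (rule measurable_PiM_single')
    fix i
    have 1: "(\<lambda>z. nat \<lfloor>z (prod_encode (i, prod_encode (0, 0)))\<rfloor>) \<in> measurable Z (measure_pmf (poisson_pmf (r i)))"
      unfolding Z_def by measurable
    have 2: "(\<lambda>z j. \<Sum>b\<in>Basis. z (prod_encode (i, prod_encode (Suc j, to_nat_on Basis b))) *\<^sub>R b) \<in> measurable Z (PiM UNIV (\<lambda>_. \<mu> i))"
    proof (rule measurable_PiM_single')
      fix j
      have "(\<lambda>z. \<Sum>b\<in>Basis. z (prod_encode (i, prod_encode (Suc j, to_nat_on Basis b))) *\<^sub>R b :: 'b) \<in> borel_measurable Z"
        unfolding Z_def by measurable
      then show "(\<lambda>z. \<Sum>b\<in>Basis. z (prod_encode (i, prod_encode (Suc j, to_nat_on Basis b))) *\<^sub>R b) \<in> measurable Z (\<mu> i)"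
        by (simp add: measurable_cong_sets[OF refl sets_\<mu>])
    qed (auto simp: \<mu>_def)
    show "(\<lambda>z. decode_samples z i) \<in> measurable Z (poisson_sample (r i) (\<mu> i))"
      unfolding decode_samples_def poisson_sample_def by (rule measurable_Pair[OF 1 2])
  qed (auto simp: poisson_sample_def space_pair_measure space_PiM \<mu>_def)
  define P where "P = distr samples Z encode_samples"
  have dec': "decode_samples \<in> measurable P samples" using dec by (simp add: P_def)
  have law: "distr P samples decode_samples = samples"
    unfolding P_def using enc dec by (simp add: distr_distr o_def decode_encode_samples)
  have prob: "prob_space P" unfolding P_def by (rule Sa.prob_space_distr[OF enc])
  define act where "act k z = (snd (prod_decode k) < fst (decode_samples z (fst (prod_decode k)) :: nat \<times> (nat \<Rightarrow> 'b)))" for k z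
  define x where "x k z = (snd (decode_samples z (fst (prod_decode k))) (snd (prod_decode k)) :: 'b)" for k z
  show thesis
  proof (rule that[of P act x])
    show "Measurable.pred P (act k)" for k
    proof -
      have [measurable]: "(\<lambda>z. fst (decode_samples z (fst (prod_decode k)) :: nat \<times> (nat \<Rightarrow> 'b))) \<in> measurable P (count_space UNIV)"
        using measurable_compose[OF dec' measurable_sample_count] .
      show ?thesis unfolding act_def by measurable
    qed
    show "x k \<in> borel_measurable P" for k
      unfolding x_def using measurable_compose[OF dec' measurable_sample_point] .
    show "poisson_counts P (\<lambda>B \<omega>. \<Sum>k. if act k \<omega> \<and> x k \<omega> \<in> B then 1 else 0) lborel"
      using poisson_counts_pullback[OF PC dec' law prob] by (simp add: total_count_eq act_def x_def)
    have "AE \<omega> in distr P samples decode_samples. inj (\<lambda>(i, j). \<pi> (snd (\<omega> i) j))"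
      unfolding law by (rule INJ)
    then have "AE z in P. inj (\<lambda>(i, j). \<pi> (snd (decode_samples z i) j))"
      by (rule AE_distrD[OF dec'])
    then show "AE z in P. inj (\<lambda>k. \<pi> (x k z))"
    proof eventually_elim
      case (elim z)
      have "inj ((\<lambda>(i, j). \<pi> (snd (decode_samples z i) j)) \<circ> prod_decode)"
        using elim inj_prod_decode by (rule inj_compose)
      then show ?case by (simp add: x_def o_def case_prod_beta)
    qed
  qed (rule prob)
qed

section \<open>Hypographs and thinning\<close>

definition hypograph :: "(real \<Rightarrow> real) \<Rightarrow> (('a \<times> real) \<times> real) set" where
  "hypograph f = {q. 0 \<le> snd q \<and> snd q < f (snd (fst q))}"

lemma measurable_height [measurable]:
  fixes f :: "real \<Rightarrow> real"
  assumes [measurable]: "f \<in> borel_measurable borel"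
  shows "(\<lambda>p::'a::euclidean_space \<times> real. f (snd p)) \<in> borel_measurable borel"
proof -
  have "(snd :: 'a \<times> real \<Rightarrow> real) \<in> borel_measurable borel"
    by (intro borel_measurable_continuous_onI continuous_intros)
  from measurable_compose[OF this assms] show ?thesis .
qed

lemma measurable_fst_borel: "(fst :: 'b::topological_space \<times> 'c::topological_space \<Rightarrow> 'b) \<in> borel_measurable borel"
  by (intro borel_measurable_continuous_onI continuous_intros)

lemma measurable_snd_borel: "(snd :: 'b::topological_space \<times> 'c::topological_space \<Rightarrow> 'c) \<in> borel_measurable borel"
  by (intro borel_measurable_continuous_onI continuous_intros)

lemma sets_hypograph [measurable]:
  assumes f: "f \<in> borel_measurable borel"
  shows "(hypograph f :: (('a::euclidean_space \<times> real) \<times> real) set) \<in> sets borel"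
proof -
  have [measurable]: "(\<lambda>q::('a \<times> real) \<times> real. f (snd (fst q))) \<in> borel_measurable borel"
    using measurable_compose[OF measurable_fst_borel measurable_height[OF f]] .
  have [measurable]: "(\<lambda>q::('a \<times> real) \<times> real. snd q) \<in> borel_measurable borel"
    by (rule measurable_snd_borel)
  have "{q\<in>space borel. 0 \<le> snd q \<and> snd q < f (snd (fst q))} \<in> sets (borel :: (('a \<times> real) \<times> real) measure)"
    by measurable
  then show ?thesis by (simp add: hypograph_def)
qed

lemma emeasure_lborel_sections:
  assumes D: "D \<in> sets (borel :: ('b::euclidean_space \<times> 'c::euclidean_space) measure)"
  shows "emeasure lborel D = (\<integral>\<^sup>+p. emeasure lborel {t. (p, t) \<in> D} \<partial>lborel)"
proof -
  have "emeasure (lborel \<Otimes>\<^sub>M lborel) D = (\<integral>\<^sup>+p. emeasure lborel (Pair p -` D) \<partial>lborel)"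
    using D by (intro lborel.emeasure_pair_measure_alt) (simp only: lborel_prod sets_lborel)
  then show ?thesis by (simp add: lborel_prod vimage_def)
qed

lemma emeasure_intensity:
  fixes B :: "('a::euclidean_space \<times> real) set"
  assumes [measurable]: "f \<in> borel_measurable borel" "B \<in> sets borel"
  shows "emeasure (intensity f) B = (\<integral>\<^sup>+p. ennreal (f (snd p)) * indicator B p \<partial>lborel)"
proof -
  have "(\<lambda>(v, h). ennreal (f h)) = (\<lambda>p::'a \<times> real. ennreal (f (snd p)))" by auto
  then show ?thesis unfolding intensity_def
    using measurable_height[OF assms(1), where 'a = 'a] by (simp add: emeasure_density)
qed

text \<open>The fibre over a point \<open>p\<close> of \<open>B\<close> is an interval of length
  \<open>f (snd p)\<close>, so by Fubini the volume below the graph is the wanted intensity.\<close>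

lemma emeasure_hypograph:
  fixes B :: "('a::euclidean_space \<times> real) set"
  assumes f: "f \<in> borel_measurable borel" and B: "B \<in> sets borel"
  shows "emeasure lborel (hypograph f \<inter> fst -` B) = emeasure (intensity f) B"
proof -
  have "(fst -` B :: (('a \<times> real) \<times> real) set) \<in> sets borel"
    using measurable_sets[OF measurable_fst_borel B] by simp
  then have "hypograph f \<inter> fst -` B \<in> sets borel" using sets_hypograph[OF f] by blast
  then have "emeasure lborel (hypograph f \<inter> fst -` B) =
      (\<integral>\<^sup>+p. emeasure lborel {t. (p, t) \<in> hypograph f \<inter> fst -` B} \<partial>lborel)"
    by (rule emeasure_lborel_sections)
  also have "\<dots> = (\<integral>\<^sup>+p. ennreal (f (snd p)) * indicator B p \<partial>lborel)"
  proof (rule nn_integral_cong)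
    fix p
    have "{t. (p, t) \<in> hypograph f \<inter> fst -` B} = (if p \<in> B then {0..<f (snd p)} else {})"
      by (auto simp: hypograph_def)
    then show "emeasure lborel {t. (p, t) \<in> hypograph f \<inter> fst -` B} = ennreal (f (snd p)) * indicator B p"
      by (cases "0 \<le> f (snd p)") (auto simp: ennreal_neg)
  qed
  finally show ?thesis using emeasure_intensity[OF f B] by simp
qed

text \<open>This is the diffuseness that keeps the points of the unit process distinct after
  projection by \<open>fst\<close>.\<close>

lemma emeasure_lborel_fst_fibre: "emeasure lborel {q::'b::euclidean_space \<times> real. fst q = c} = 0"
proof -
  have "{q::'b \<times> real. fst q = c} = {c} \<times> UNIV" by auto
  then have "emeasure lborel {q::'b \<times> real. fst q = c} = emeasure (lborel \<Otimes>\<^sub>M lborel) ({c} \<times> (UNIV :: real set))"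
    by (simp add: lborel_prod)
  also have "\<dots> = 0" by (subst lborel.emeasure_pair_measure_Times) auto
  finally show ?thesis .
qed

lemma poisson_process_iff_counts:
  "poisson_process M \<eta> \<Lambda> \<longleftrightarrow> point_process M \<eta> \<and> poisson_counts M (\<lambda>B \<omega>. num_points (\<eta> \<omega>) B) \<Lambda>"
proof (cases "point_process M \<eta>")
  case True
  then have "(\<forall>B\<in>sets borel. (\<lambda>\<omega>. num_points (\<eta> \<omega>) B) \<in> borel_measurable M) = True"
    and "prob_space M = True" and "point_process M \<eta> = True"
    using measurable_num_points unfolding point_process_def by blast+
  note eqs = this
  show ?thesis
    unfolding poisson_process_def poisson_counts_def poisson_density_def eqs simp_thms by (rule TrueI)
qed (simp add: poisson_process_def)

text \<open>Outside \<open>G\<close> the configuration is made empty. The flagged enumeration is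
  then injective for every \<open>\<omega>\<close>, which yields measurability into
  \<open>config_space\<close>, while the counts change only on a null set.\<close>

lemma thinned_poisson_process:
  fixes x :: "nat \<Rightarrow> 'w \<Rightarrow> ('a::euclidean_space \<times> real) \<times> real"
  assumes P: "prob_space P" and act: "\<And>k. Measurable.pred P (act k)" and x: "\<And>k. x k \<in> borel_measurable P"
    and counts: "poisson_counts P (\<lambda>B \<omega>. \<Sum>k. if act k \<omega> \<and> x k \<omega> \<in> B then 1 else 0) lborel"
    and G: "G \<in> sets P" "AE \<omega> in P. \<omega> \<in> G" "\<And>\<omega>. \<omega> \<in> G \<Longrightarrow> inj (\<lambda>k. fst (x k \<omega>))"
    and f: "f \<in> borel_measurable borel"
  shows "poisson_process P (active_points (\<lambda>k \<omega>. act k \<omega> \<and> x k \<omega> \<in> hypograph f \<and> \<omega> \<in> G) (\<lambda>k \<omega>. fst (x k \<omega>)))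
    (intensity f)"
proof -
  let ?act = "\<lambda>k \<omega>. act k \<omega> \<and> x k \<omega> \<in> hypograph f \<and> \<omega> \<in> G" and ?X = "\<lambda>k \<omega>. fst (x k \<omega>)"
  note act [measurable] x [measurable] G(1) [measurable] sets_hypograph[OF f, measurable]
  have X: "?X k \<in> borel_measurable P" for k
    using measurable_compose[OF x measurable_fst_borel] .
  have inj: "inj_on (\<lambda>k. ?X k \<omega>) {k. ?act k \<omega>}" for \<omega>
    using G(3)[of \<omega>] by (cases "\<omega> \<in> G") (auto intro: inj_on_subset)
  have meas: "active_points ?act ?X \<in> measurable P config_space"
    by (rule measurable_active_points[OF _ X inj]) measurable
  have "poisson_counts P (\<lambda>B \<omega>. \<Sum>k. if act k \<omega> \<and> x k \<omega> \<in> hypograph f \<inter> fst -` B then 1 else 0) (intensity f)"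
  proof (rule poisson_counts_map[OF counts])
    fix B :: "('a \<times> real) set" assume B: "B \<in> sets borel"
    then have "(fst -` B :: (('a \<times> real) \<times> real) set) \<in> sets borel"
      using measurable_sets[OF measurable_fst_borel B] by simp
    then show "hypograph f \<inter> fst -` B \<in> sets borel" using sets_hypograph[OF f] by blast
    show "emeasure lborel (hypograph f \<inter> fst -` B) = emeasure (intensity f) B"
      by (rule emeasure_hypograph[OF f B])
  qed auto
  then have "poisson_counts P (\<lambda>B \<omega>. num_points (active_points ?act ?X \<omega>) B) (intensity f)"
  proof (rule poisson_counts_cong_AE)
    fix B :: "('a \<times> real) set" assume B: "B \<in> sets borel"
    show "(\<lambda>\<omega>. num_points (active_points ?act ?X \<omega>) B) \<in> borel_measurable P"
      by (rule measurable_num_points[OF meas B])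
    show "AE \<omega> in P. (\<Sum>k. if act k \<omega> \<and> x k \<omega> \<in> hypograph f \<inter> fst -` B then 1 else 0) =
        num_points (active_points ?act ?X \<omega>) B"
      using G(2)
    proof eventually_elim
      case (elim \<omega>)
      have "(\<lambda>k. if act k \<omega> \<and> x k \<omega> \<in> hypograph f \<inter> fst -` B then 1 else 0 :: ennreal) =
         (\<lambda>k. if ?act k \<omega> \<and> ?X k \<omega> \<in> B then 1 else 0)"
        using elim by (auto simp: fun_eq_iff)
      then show ?case using num_points_active_points[where act = ?act and X = ?X, OF inj, of \<omega> B] by simp
    qed
  qed
  then show ?thesis using P meas by (simp add: poisson_process_iff_counts point_process_def)
qed

subsection \<open>Uniqueness in law\<close>

text \<open>The masses at the natural numbers already sum to 1, so neither
  \<open>\<infinity>\<close> nor any other value carries mass, and both laws are discrete with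
  weights \<open>p\<close>.\<close>

lemma distr_eq_if_prob_of_nat_eq:
  fixes X :: "'w \<Rightarrow> ennreal" and Y :: "'u \<Rightarrow> ennreal"
  assumes M: "prob_space M" and M': "prob_space M'"
    and X: "X \<in> borel_measurable M" and Y: "Y \<in> borel_measurable M'"
    and pX: "\<And>k. measure M {\<omega>\<in>space M. X \<omega> = of_nat k} = p k"
    and pY: "\<And>k. measure M' {\<omega>\<in>space M'. Y \<omega> = of_nat k} = p k"
    and p: "p sums 1"
  shows "distr M borel X = distr M' borel Y"
proof -
  have eq: "measure M {\<omega>\<in>space M. X \<omega> \<in> U} = (\<Sum>k. if of_nat k \<in> U then p k else 0)"
    if M: "prob_space M" and X [measurable]: "X \<in> borel_measurable M"
      and pX: "\<And>k. measure M {\<omega>\<in>space M. X \<omega> = of_nat k} = p k"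
      and U [measurable]: "U \<in> sets borel"
    for M :: "'v measure" and X :: "'v \<Rightarrow> ennreal" and U
  proof -
    interpret prob_space M by fact
    have S: "(\<lambda>k. prob (if of_nat k \<in> U then {\<omega>\<in>space M. X \<omega> = of_nat k} else {})) sums
        prob (\<Union>k. if of_nat k \<in> U then {\<omega>\<in>space M. X \<omega> = of_nat k} else {})"
      if [measurable]: "U \<in> sets borel" for U
      by (rule finite_measure_UNION) (auto simp: disjoint_family_on_def)
    have "(\<lambda>k. prob {\<omega>\<in>space M. X \<omega> = of_nat k}) sums prob (\<Union>k. {\<omega>\<in>space M. X \<omega> = of_nat k})"
      using S[of UNIV] by simp
    then have "prob (\<Union>k. {\<omega>\<in>space M. X \<omega> = of_nat k}) = 1" using p pX sums_unique2 by fastforce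
    then have "AE \<omega> in M. \<omega> \<in> (\<Union>k. {\<omega>\<in>space M. X \<omega> = of_nat k})" by (subst (asm) prob_eq_1) auto
    then have "AE \<omega> in M. \<omega> \<in> {\<omega>\<in>space M. X \<omega> \<in> U} \<longleftrightarrow>
        \<omega> \<in> (\<Union>k. if of_nat k \<in> U then {\<omega>\<in>space M. X \<omega> = of_nat k} else {})"
      by eventually_elim (auto split: if_splits)
    then have "prob {\<omega>\<in>space M. X \<omega> \<in> U} = prob (\<Union>k. if of_nat k \<in> U then {\<omega>\<in>space M. X \<omega> = of_nat k} else {})"
      by (rule measure_eq_AE) (auto intro!: sets.countable_UN)
    also have "\<dots> = (\<Sum>k. if of_nat k \<in> U then p k else 0)"
      using sums_unique[OF S[OF U]] pX by (simp add: if_distrib[where f = prob] cong: if_cong)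
    finally show ?thesis .
  qed
  interpret D: prob_space "distr M borel X" by (rule prob_space.prob_space_distr[OF M X])
  interpret D': prob_space "distr M' borel Y" by (rule prob_space.prob_space_distr[OF M' Y])
  show ?thesis
  proof (rule measure_eqI)
    fix U assume "U \<in> sets (distr M borel X)"
    then have U: "U \<in> sets borel" by simp
    have "measure (distr M borel X) U = measure M {\<omega>\<in>space M. X \<omega> \<in> U}"
      using X U by (simp add: measure_distr vimage_def Int_def conj_commute)
    also have "\<dots> = measure M' {\<omega>\<in>space M'. Y \<omega> \<in> U}"
      using eq[OF M X pX U] eq[OF M' Y pY U] by simp
    also have "\<dots> = measure (distr M' borel Y) U"
      using Y U by (simp add: measure_distr vimage_def Int_def conj_commute)
    finally show "emeasure (distr M borel X) U = emeasure (distr M' borel Y) U"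
      by (simp add: D.emeasure_eq_measure D'.emeasure_eq_measure)
  qed simp
qed

lemma poisson_counts_marginal_unique:
  assumes N: "poisson_counts M N \<Lambda>" and N': "poisson_counts M' N' \<Lambda>" and B: "B \<in> sets borel"
  shows "distr M borel (N B) = distr M' borel (N' B)"
proof (cases "emeasure \<Lambda> B = \<infinity>")
  case True
  have "distr M borel (N B) = return borel \<infinity>" if N: "poisson_counts M N \<Lambda>" for M :: "'v measure" and N
  proof -
    note D = poisson_countsD[OF N]
    have "distr M borel (N B) = distr M borel (\<lambda>_. \<infinity>)"
      using D(2,4) B True by (intro distr_cong_AE) auto
    also have "\<dots> = return borel \<infinity>" by (rule prob_space.distr_const[OF D(1)]) simp
    finally show ?thesis .
  qed
  from this[OF N] this[OF N'] show ?thesis by simp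
next
  case False
  then have "emeasure \<Lambda> B < \<infinity>" by (simp add: less_top)
  then show ?thesis
    using poisson_countsD[OF N] poisson_countsD[OF N'] B
    by (intro distr_eq_if_prob_of_nat_eq[where p = "poisson_density (measure \<Lambda> B)"] poisson_density_sums) auto
qed

lemma poisson_counts_joint_unique:
  assumes N: "poisson_counts M N \<Lambda>" and N': "poisson_counts M' N' \<Lambda>"
    and I: "finite (I :: nat set)" "I \<noteq> {}" and B: "\<And>i. i \<in> I \<Longrightarrow> B i \<in> sets borel" and disj: "disjoint_family_on B I"
  shows "distr M (PiM I (\<lambda>_. borel)) (\<lambda>x. \<lambda>i\<in>I. N (B i) x) = distr M' (PiM I (\<lambda>_. borel)) (\<lambda>x. \<lambda>i\<in>I. N' (B i) x)"
proof -
  have "distr M (PiM I (\<lambda>_. borel)) (\<lambda>x. \<lambda>i\<in>I. N (B i) x) = PiM I (\<lambda>i. distr M borel (N (B i)))"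
    if N: "poisson_counts M N \<Lambda>" for M :: "'v measure" and N
  proof -
    note D = poisson_countsD[OF N]
    have "prob_space.indep_vars M (\<lambda>_. borel) (\<lambda>i \<omega>. N (B i) \<omega>) I" using D(5)[OF I(1) B disj] .
    then show ?thesis
      using prob_space.indep_vars_iff_distr_eq_PiM'[where M' = "\<lambda>_. borel" and X = "\<lambda>i. N (B i)", OF D(1) I(2) D(2)[OF B]]
      by simp
  qed
  from this[OF N] this[OF N'] show ?thesis
    using poisson_counts_marginal_unique[OF N N' B] by (simp cong: PiM_cong)
qed

lemma num_points_UN:
  assumes "finite S" "disjoint_family_on C S"
  shows "num_points A (\<Union>s\<in>S. C s) = (\<Sum>s\<in>S. num_points A (C s))"
proof -
  have "(\<Sum>s\<in>S. emeasure (count_space UNIV) (A \<inter> C s)) = emeasure (count_space UNIV) (\<Union>s\<in>S. A \<inter> C s)"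
    using assms by (intro sum_emeasure) (auto simp: disjoint_family_on_def)
  moreover have "(\<Union>s\<in>S. A \<inter> C s) = A \<inter> (\<Union>s\<in>S. C s)" by auto
  ultimately show ?thesis by (simp add: num_points_def)
qed

text \<open>Counts of finitely many arbitrary Borel sets are sums of the independent counts of the
  atoms that these sets generate.\<close>

lemma poisson_process_event_unique:
  fixes \<eta> :: "'w \<Rightarrow> 'b::topological_space set" and \<eta>' :: "'u \<Rightarrow> 'b set"
  assumes N: "poisson_counts M (\<lambda>B \<omega>. num_points (\<eta> \<omega>) B) \<Lambda>" and N': "poisson_counts M' (\<lambda>B \<omega>. num_points (\<eta>' \<omega>) B) \<Lambda>"
    and B: "\<And>i. i < (m::nat) \<Longrightarrow> B i \<in> sets borel" and U: "\<And>i. i < m \<Longrightarrow> U i \<in> sets borel"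
  shows "measure M {\<omega>\<in>space M. \<forall>i<m. num_points (\<eta> \<omega>) (B i) \<in> U i} =
    measure M' {\<omega>\<in>space M'. \<forall>i<m. num_points (\<eta>' \<omega>) (B i) \<in> U i}"
proof -
  \<comment> \<open>Subsets of \<open>{..<m}\<close> are coded as natural numbers because
    \<open>poisson_counts\<close> states independence for index sets of naturals.\<close>
  define I where "I = set_encode ` Pow {..<m}"
  have I: "finite I" "I \<noteq> {}" by (auto simp: I_def)
  define C where "C s = {x. \<forall>i<m. x \<in> B i \<longleftrightarrow> i \<in> set_decode s}" for s
  have C: "C s \<in> sets borel" for s
  proof -
    have "C s = (\<Inter>i\<in>{..<m}. if i \<in> set_decode s then B i else - B i) \<inter> UNIV"
      by (auto simp: C_def split: if_splits)
    moreover have "(\<Inter>i\<in>{..<m}. if i \<in> set_decode s then B i else - B i) \<inter> UNIV \<in> sets borel"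
    proof (cases "m = 0")
      case False
      then show ?thesis using B by (intro sets.Int sets.finite_INT) (auto simp: borel_comp)
    qed simp
    ultimately show ?thesis by simp
  qed
  have disj: "disjoint_family_on C I"
    unfolding disjoint_family_on_def
  proof (intro ballI impI)
    fix s t assume st: "s \<in> I" "t \<in> I" "s \<noteq> t"
    then have "set_decode s \<noteq> set_decode t" by (metis set_decode_inverse)
    moreover have "set_decode s \<subseteq> {..<m}" "set_decode t \<subseteq> {..<m}"
      using st finite_subset[OF _ finite_lessThan] by (auto simp: I_def)
    ultimately obtain i where "i < m" "i \<in> set_decode s \<longleftrightarrow> i \<notin> set_decode t" by blast
    then show "C s \<inter> C t = {}" by (auto simp: C_def)
  qed
  have BC: "B i = (\<Union>s\<in>{s\<in>I. i \<in> set_decode s}. C s)" if i: "i < m" for i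
  proof
    show "B i \<subseteq> (\<Union>s\<in>{s\<in>I. i \<in> set_decode s}. C s)"
    proof
      fix x assume x: "x \<in> B i"
      let ?S = "{j\<in>{..<m}. x \<in> B j}"
      have "set_decode (set_encode ?S) = ?S" by (rule set_encode_inverse) simp
      then show "x \<in> (\<Union>s\<in>{s\<in>I. i \<in> set_decode s}. C s)"
        using x i by (intro UN_I[of "set_encode ?S"]) (auto simp: I_def C_def)
    qed
  qed (use i in \<open>auto simp: C_def\<close>)
  have NB: "num_points A (B i) = (\<Sum>s\<in>{s\<in>I. i \<in> set_decode s}. num_points A (C s))" if "i < m" for A i
    using disj I by (subst BC[OF that], intro num_points_UN) (auto intro: disjoint_family_on_mono)
  let ?E = "{f\<in>space (PiM I (\<lambda>_. borel)). \<forall>i\<in>{..<m}. (\<Sum>s\<in>{s\<in>I. i \<in> set_decode s}. f s) \<in> U i} :: (nat \<Rightarrow> ennreal) set"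
  have E: "?E \<in> sets (PiM I (\<lambda>_. borel))"
  proof -
    have "Measurable.pred (PiM I (\<lambda>_. borel)) (\<lambda>f. \<forall>i\<in>{..<m}. (\<Sum>s\<in>{s\<in>I. i \<in> set_decode s}. f s :: ennreal) \<in> U i)"
    proof (intro pred_intros_finite(3))
      fix i assume "i \<in> {..<m}"
      then have [measurable]: "U i \<in> sets borel" using U by auto
      have [measurable]: "(\<lambda>f. \<Sum>s\<in>{s\<in>I. i \<in> set_decode s}. f s :: ennreal) \<in> borel_measurable (PiM I (\<lambda>_. borel))"
        by (intro borel_measurable_sum measurable_component_singleton) auto
      show "Measurable.pred (PiM I (\<lambda>_. borel)) (\<lambda>f. (\<Sum>s\<in>{s\<in>I. i \<in> set_decode s}. f s :: ennreal) \<in> U i)"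
        by measurable
    qed simp
    then show ?thesis by (simp add: pred_def)
  qed
  have "measure M {\<omega>\<in>space M. \<forall>i<m. num_points (\<eta> \<omega>) (B i) \<in> U i} =
      measure (distr M (PiM I (\<lambda>_. borel)) (\<lambda>x. \<lambda>s\<in>I. num_points (\<eta> x) (C s))) ?E"
    if N: "poisson_counts M (\<lambda>B \<omega>. num_points (\<eta> \<omega>) B) \<Lambda>" for M :: "'v measure" and \<eta>
  proof -
    note D = poisson_countsD[OF N]
    have m: "(\<lambda>x. \<lambda>s\<in>I. num_points (\<eta> x) (C s)) \<in> measurable M (PiM I (\<lambda>_. borel))"
      using D(2)[OF C] by (intro measurable_restrict) auto
    have "(\<lambda>x. \<lambda>s\<in>I. num_points (\<eta> x) (C s)) -` ?E \<inter> space M =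
        {\<omega>\<in>space M. \<forall>i<m. num_points (\<eta> \<omega>) (B i) \<in> U i}"
      using measurable_space[OF m] by (auto simp: NB)
    then show ?thesis using measure_distr[OF m E] by simp
  qed
  from this[OF N] this[OF N'] show ?thesis
    using poisson_counts_joint_unique[OF N N' I C disj] by simp
qed

text \<open>Finite conjunctions of count events form an intersection-stable generator of
  \<open>config_space\<close>, and their probabilities are determined by
  \<open>\<Lambda>\<close>.\<close>

lemma poisson_process_same_law:
  fixes \<eta> :: "'w \<Rightarrow> 'b::topological_space set" and \<eta>' :: "'u \<Rightarrow> 'b set"
  assumes \<eta>: "\<eta> \<in> measurable M config_space" "poisson_counts M (\<lambda>B \<omega>. num_points (\<eta> \<omega>) B) \<Lambda>"
    and \<eta>': "\<eta>' \<in> measurable M' config_space" "poisson_counts M' (\<lambda>B \<omega>. num_points (\<eta>' \<omega>) B) \<Lambda>"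
  shows "same_law M \<eta> M' \<eta>'"
proof -
  let ?\<Omega> = "{A :: 'b set. countable A}"
  define G where "G = {{A \<in> ?\<Omega>. \<forall>i<m. num_points A (B i) \<in> U i} |(m::nat) B U.
      (\<forall>i<m. B i \<in> sets borel) \<and> (\<forall>i<m. U i \<in> sets borel)}"
  interpret M: prob_space M using \<eta>(2) by (rule poisson_countsD)
  interpret M': prob_space M' using \<eta>'(2) by (rule poisson_countsD)
  interpret D: prob_space "distr M config_space \<eta>" by (rule M.prob_space_distr[OF \<eta>(1)])
  interpret D': prob_space "distr M' config_space \<eta>'" by (rule M'.prob_space_distr[OF \<eta>'(1)])
  have G_sets: "G \<subseteq> sets config_space"
  proof
    fix X assume "X \<in> G"
    then obtain m :: nat and B U where X: "X = {A \<in> ?\<Omega>. \<forall>i<m. num_points A (B i) \<in> U i}"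
      and B: "\<forall>i<m. B i \<in> sets borel" and U: "\<forall>i<m. U i \<in> sets borel" unfolding G_def by blast
    have "Measurable.pred config_space (\<lambda>A. \<forall>i\<in>{..<m}. num_points A (B i) \<in> U i)"
    proof (intro pred_intros_finite(3))
      fix i assume "i \<in> {..<m}"
      then have [measurable]: "U i \<in> sets borel" "(\<lambda>A. num_points A (B i)) \<in> borel_measurable config_space"
        using B U by (auto intro: measurable_num_points[OF measurable_ident_sets[OF refl]])
      show "Measurable.pred config_space (\<lambda>A. num_points A (B i) \<in> U i)" by measurable
    qed simp
    then show "X \<in> sets config_space" by (simp add: X pred_def space_config_space Ball_def)
  qed
  have sets_G: "sets config_space = sigma_sets ?\<Omega> G"
  proof
    show "sets config_space \<subseteq> sigma_sets ?\<Omega> G"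
      unfolding sets_config_space
    proof (rule sigma_sets_mono', safe)
      fix B :: "'b set" and U :: "ennreal set" assume "B \<in> sets borel" "U \<in> sets borel"
      then show "{A. countable A \<and> num_points A B \<in> U} \<in> G"
        unfolding G_def by (intro CollectI exI[of _ "1::nat"] exI[of _ "\<lambda>_. B"] exI[of _ "\<lambda>_. U"]) auto
    qed
    show "sigma_sets ?\<Omega> G \<subseteq> sets config_space"
      using sets.sigma_sets_subset[OF G_sets] by (simp add: space_config_space)
  qed
  have "distr M config_space \<eta> = distr M' config_space \<eta>'"
  proof (rule measure_eqI_generator_eq[where E = G and \<Omega> = ?\<Omega> and A = "\<lambda>_. ?\<Omega>"])
    show "Int_stable G"
      unfolding Int_stable_def
    proof (intro ballI)
      fix X Y assume "X \<in> G" "Y \<in> G"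
      then obtain m :: nat and B U and n :: nat and C V
        where X: "X = {A \<in> ?\<Omega>. \<forall>i<m. num_points A (B i) \<in> U i}"
          "\<forall>i<m. B i \<in> sets borel" "\<forall>i<m. U i \<in> sets borel"
        and Y: "Y = {A \<in> ?\<Omega>. \<forall>i<n. num_points A (C i) \<in> V i}"
          "\<forall>i<n. C i \<in> sets borel" "\<forall>i<n. V i \<in> sets borel" unfolding G_def by blast
      let ?B = "\<lambda>i. if i < m then B i else C (i - m)" and ?U = "\<lambda>i. if i < m then U i else V (i - m)"
      have "X \<inter> Y = {A \<in> ?\<Omega>. \<forall>i<m + n. num_points A (?B i) \<in> ?U i}"
      proof (intro set_eqI iffI)
        fix A assume "A \<in> X \<inter> Y"
        then show "A \<in> {A \<in> ?\<Omega>. \<forall>i<m + n. num_points A (?B i) \<in> ?U i}" by (auto simp: X Y)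
      next
        fix A assume A: "A \<in> {A \<in> ?\<Omega>. \<forall>i<m + n. num_points A (?B i) \<in> ?U i}"
        have "num_points A (B i) \<in> U i" if "i < m" for i
        proof -
          have "i < m + n" using that by simp
          then show ?thesis using A that by fastforce
        qed
        moreover have "num_points A (C i) \<in> V i" if "i < n" for i
        proof -
          have "i + m < m + n" using that by simp
          then show ?thesis using A that by fastforce
        qed
        ultimately show "A \<in> X \<inter> Y" using A by (simp add: X Y)
      qed
      moreover have "\<forall>i<m + n. ?B i \<in> sets borel" "\<forall>i<m + n. ?U i \<in> sets borel" using X Y by auto
      ultimately show "X \<inter> Y \<in> G"
        unfolding G_def by (intro CollectI exI[of _ "m + n"] exI[of _ ?B] exI[of _ ?U] conjI)
    qed
    show "G \<subseteq> Pow ?\<Omega>" by (auto simp: G_def)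
    show "emeasure (distr M config_space \<eta>) X = emeasure (distr M' config_space \<eta>') X" if XG: "X \<in> G" for X
    proof -
      obtain m :: nat and B U where X: "X = {A \<in> ?\<Omega>. \<forall>i<m. num_points A (B i) \<in> U i}"
        and B: "\<And>i. i < m \<Longrightarrow> B i \<in> sets borel" and U: "\<And>i. i < m \<Longrightarrow> U i \<in> sets borel"
        using XG unfolding G_def by blast
      have Xs: "X \<in> sets config_space" using XG G_sets by blast
      have 1: "\<eta> -` X \<inter> space M = {\<omega>\<in>space M. \<forall>i<m. num_points (\<eta> \<omega>) (B i) \<in> U i}"
        using measurable_space[OF \<eta>(1)] by (auto simp: X space_config_space)
      have 2: "\<eta>' -` X \<inter> space M' = {\<omega>\<in>space M'. \<forall>i<m. num_points (\<eta>' \<omega>) (B i) \<in> U i}"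
        using measurable_space[OF \<eta>'(1)] by (auto simp: X space_config_space)
      show ?thesis
        using poisson_process_event_unique[OF \<eta>(2) \<eta>'(2) B U] Xs \<eta>(1) \<eta>'(1)
        by (simp add: emeasure_distr M.emeasure_eq_measure M'.emeasure_eq_measure 1 2)
    qed
    show "range (\<lambda>_::nat. ?\<Omega>) \<subseteq> G"
      unfolding G_def by (auto intro!: exI[of _ "0::nat"])
  qed (auto simp: sets_G)
  then show ?thesis by (simp add: same_law_def)
qed

subsection \<open>Volume estimates\<close>

lemma nn_integral_lborel_swap:
  fixes g :: "'a::euclidean_space \<times> real \<Rightarrow> ennreal"
  assumes "g \<in> borel_measurable borel"
  shows "(\<integral>\<^sup>+p. g p \<partial>lborel) = (\<integral>\<^sup>+h. (\<integral>\<^sup>+v. g (v, h) \<partial>lborel) \<partial>lborel)"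
proof -
  have "g \<in> borel_measurable (lborel \<Otimes>\<^sub>M lborel)"
    using assms by (simp add: lborel_prod)
  from lborel_pair.nn_integral_snd[OF this] show ?thesis by (simp add: lborel_prod)
qed

lemma nn_integral_height_sections:
  fixes B :: "('a::euclidean_space \<times> real) set"
  assumes g: "g \<in> borel_measurable borel" and B: "B \<in> sets borel"
  shows "(\<integral>\<^sup>+p. g (snd p) * indicator B p \<partial>lborel) =
    (\<integral>\<^sup>+h. g h * emeasure lborel {v. (v, h) \<in> B} \<partial>lborel)"
proof -
  have "(\<lambda>p::'a \<times> real. g (snd p)) \<in> borel_measurable borel"
    using measurable_compose[OF measurable_snd_borel g] .
  then have "(\<lambda>p. g (snd p) * indicator B p) \<in> borel_measurable borel" using B by measurable
  then have "(\<integral>\<^sup>+p. g (snd p) * indicator B p \<partial>lborel) =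
      (\<integral>\<^sup>+h. (\<integral>\<^sup>+v. g h * indicator B (v, h) \<partial>lborel) \<partial>lborel)"
    by (subst nn_integral_lborel_swap) auto
  also have "\<dots> = (\<integral>\<^sup>+h. g h * emeasure lborel {v. (v, h) \<in> B} \<partial>lborel)"
  proof (intro nn_integral_cong)
    fix h :: real
    have "(\<lambda>v::'a. (v, h)) \<in> borel_measurable borel"
      by (intro borel_measurable_continuous_onI continuous_intros)
    from measurable_sets[OF this B] have S: "{v. (v, h) \<in> B} \<in> sets borel" by (simp add: vimage_def)
    have "(\<integral>\<^sup>+v. g h * indicator B (v, h) \<partial>lborel) = (\<integral>\<^sup>+v. g h * indicator {v. (v, h) \<in> B} v \<partial>lborel)"
      by (intro nn_integral_cong) (simp add: indicator_def)
    also have "\<dots> = g h * emeasure lborel {v. (v, h) \<in> B}"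
      using S by (subst nn_integral_cmult_indicator) auto
    finally show "(\<integral>\<^sup>+v. g h * indicator B (v, h) \<partial>lborel) = g h * emeasure lborel {v. (v, h) \<in> B}" .
  qed
  finally show ?thesis .
qed

lemma emeasure_intensity_sections:
  fixes B :: "('a::euclidean_space \<times> real) set"
  assumes f: "f \<in> borel_measurable borel" and B: "B \<in> sets borel"
  shows "emeasure (intensity f) B = (\<integral>\<^sup>+h. ennreal (f h) * emeasure lborel {v. (v, h) \<in> B} \<partial>lborel)"
  using emeasure_intensity[OF f B] nn_integral_height_sections[of "\<lambda>h. ennreal (f h)" B] f B by simp

text \<open>The existential over \<open>w\<close> becomes one continuous inequality, since the
  distance to the ball is attained. This makes the region closed and hence Borel.\<close>

lemma influence_region_infdist:
  assumes "0 \<le> R"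
  shows "influence_region R T = {p::'a::euclidean_space \<times> real. (infdist (fst p) (cball 0 R))\<^sup>2 + snd p \<le> T}"
proof (intro set_eqI iffI)
  fix p :: "'a \<times> real" assume "p \<in> influence_region R T"
  then obtain w where w: "w \<in> cball 0 R" "(norm (w - fst p))\<^sup>2 + snd p \<le> T"
    by (auto simp: influence_region_def pow_def)
  have "infdist (fst p) (cball 0 R) \<le> norm (w - fst p)"
    using infdist_le[OF w(1), of "fst p"] by (simp add: dist_norm norm_minus_commute)
  then have "(infdist (fst p) (cball 0 R))\<^sup>2 \<le> (norm (w - fst p))\<^sup>2"
    by (intro power_mono infdist_nonneg)
  then show "p \<in> {p. (infdist (fst p) (cball 0 R))\<^sup>2 + snd p \<le> T}" using w by simp
next
  fix p :: "'a \<times> real" assume p: "p \<in> {p. (infdist (fst p) (cball 0 R))\<^sup>2 + snd p \<le> T}"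
  have "closed (cball (0::'a) R)" "cball (0::'a) R \<noteq> {}" using assms by auto
  then obtain w where "w \<in> cball 0 R" "infdist (fst p) (cball 0 R) = dist (fst p) w"
    using infdist_attains_inf by blast
  then show "p \<in> influence_region R T" using p
    by (auto simp: influence_region_def pow_def dist_norm norm_minus_commute intro!: bexI[of _ w])
qed

lemma sets_influence_region [measurable]:
  assumes "0 \<le> R"
  shows "(influence_region R T :: ('a::euclidean_space \<times> real) set) \<in> sets borel"
proof -
  have "closed {p::'a \<times> real. (infdist (fst p) (cball 0 R))\<^sup>2 + snd p \<le> T}"
    by (intro closed_Collect_le continuous_on_add continuous_on_power continuous_on_infdist
        continuous_on_fst continuous_on_snd continuous_on_id continuous_on_const)
  then show ?thesis unfolding influence_region_infdist[OF assms] by (rule borel_closed)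
qed

lemma influence_region_section:
  "{v::'a::euclidean_space. (v, h) \<in> influence_region R T} \<subseteq> (if h \<le> T then cball 0 (R + sqrt (T - h)) else {})"
proof
  fix v :: 'a assume "v \<in> {v. (v, h) \<in> influence_region R T}"
  then obtain w where w: "norm w \<le> R" "(norm (w - v))\<^sup>2 \<le> T - h"
    by (auto simp: influence_region_def pow_def)
  then have "h \<le> T" using zero_le_power2[of "norm (w - v)"] by linarith
  moreover have "norm (w - v) \<le> sqrt (T - h)" using w(2) by (rule real_le_rsqrt)
  then have "norm v \<le> R + sqrt (T - h)" using w(1) norm_triangle_ineq4[of w "w - v"] by simp
  ultimately show "v \<in> (if h \<le> T then cball 0 (R + sqrt (T - h)) else {})" by simp
qed

text \<open>An upper bound for the volume of the section of the influence region at height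
  \<open>h\<close>: its points have distance at most \<open>sqrt (T - h)\<close> from the ball of
  radius \<open>R\<close>.\<close>

definition region_volume :: "nat \<Rightarrow> real \<Rightarrow> real \<Rightarrow> real \<Rightarrow> real" where
  "region_volume d R T h = (if h \<le> T then unit_ball_vol (real d) * (R + sqrt (T - h)) ^ d else 0)"

lemma region_volume_nonneg: "0 \<le> R \<Longrightarrow> 0 \<le> region_volume d R T h"
  by (simp add: region_volume_def)

lemma measurable_region_volume [measurable]: "region_volume d R T \<in> borel_measurable borel"
  unfolding region_volume_def by measurable

lemma emeasure_influence_region_section:
  assumes "0 \<le> R"
  shows "emeasure lborel {v::'a::euclidean_space. (v, h) \<in> influence_region R T} \<le> ennreal (region_volume DIM('a) R T h)"
proof (cases "h \<le> T")
  case True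
  then have "emeasure lborel {v::'a. (v, h) \<in> influence_region R T} \<le> emeasure lborel (cball (0::'a) (R + sqrt (T - h)))"
    using influence_region_section[of h R T] by (intro emeasure_mono) auto
  also have "\<dots> = ennreal (region_volume DIM('a) R T h)"
    using True assms by (subst emeasure_cball) (auto simp: region_volume_def)
  finally show ?thesis .
next
  case False
  then have "{v::'a. (v, h) \<in> influence_region R T} = {}" using influence_region_section[of h R T] by auto
  then show ?thesis by simp
qed

lemma nn_integral_influence_region_le:
  assumes g: "g \<in> borel_measurable borel" and R: "0 \<le> R"
  shows "(\<integral>\<^sup>+p. g (snd p) * indicator (influence_region R T :: ('a::euclidean_space \<times> real) set) p \<partial>lborel) \<le>
    (\<integral>\<^sup>+h. g h * ennreal (region_volume DIM('a) R T h) \<partial>lborel)"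
  using nn_integral_height_sections[OF g sets_influence_region[OF R], where 'a = 'a]
    emeasure_influence_region_section[OF R, where 'a = 'a]
  by (auto intro!: nn_integral_mono mult_left_mono)

lemma sqrt_power_eq_powr: "0 < x \<Longrightarrow> sqrt x ^ d = x powr (real d / 2)"
  by (simp add: powr_half_sqrt[symmetric] powr_powr flip: powr_realpow)

text \<open>In this form the fractional integral is visible as a mean number of points: up to a
  constant factor, \<open>sqrt (t - h) ^ d\<close> is the volume of the set of \<open>v\<close> with
  \<open>pow u (v, h) \<le> t\<close>.\<close>

lemma frac_integral_half_dimension:
  "frac_integral (real d / 2 + 1) f t =
     ennreal (1 / Gamma (real d / 2 + 1)) * (\<integral>\<^sup>+h\<in>{..<t}. ennreal (f h * sqrt (t - h) ^ d) \<partial>lborel)"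
proof -
  have "(\<integral>\<^sup>+h\<in>{..<t}. ennreal (f h * (t - h) powr (real d / 2)) \<partial>lborel) =
      (\<integral>\<^sup>+h\<in>{..<t}. ennreal (f h * sqrt (t - h) ^ d) \<partial>lborel)"
    by (intro nn_integral_cong) (auto simp: indicator_def sqrt_power_eq_powr)
  then show ?thesis by (simp add: frac_integral_def)
qed

lemma Gamma_half_dimension_pos: "0 < Gamma (real d / 2 + 1)"
  by (intro Gamma_real_pos) simp

lemma frac_integral_finite_iff:
  "frac_integral (real d / 2 + 1) f t < \<infinity> \<longleftrightarrow> (\<integral>\<^sup>+h\<in>{..<t}. ennreal (f h * sqrt (t - h) ^ d) \<partial>lborel) < \<infinity>"
proof -
  have "ennreal (1 / Gamma (real d / 2 + 1)) \<noteq> 0"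
    using Gamma_half_dimension_pos[of d] by (simp add: ennreal_eq_0_iff not_le)
  then show ?thesis
    unfolding frac_integral_half_dimension by (auto simp: ennreal_mult_less_top)
qed

text \<open>Raising the level from \<open>T\<close> to \<open>T'\<close> absorbs the radius: for
  \<open>h \<le> T\<close> one has \<open>sqrt (T' - T) \<le> sqrt (T' - h)\<close>, so
  \<open>R\<close> is at most \<open>R / sqrt (T' - T)\<close> times \<open>sqrt (T' - h)\<close>.
  The remaining kernel is the one that admissibility integrates.\<close>

lemma region_volume_bound:
  assumes "0 \<le> R" "T < T'"
  shows "region_volume d R T h \<le>
    unit_ball_vol (real d) * (R / sqrt (T' - T) + 1) ^ d * (if h < T' then sqrt (T' - h) ^ d else 0)"
proof (cases "h \<le> T")
  case True
  have "R = R / sqrt (T' - T) * sqrt (T' - T)" using assms by simp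
  also have "\<dots> \<le> R / sqrt (T' - T) * sqrt (T' - h)"
    using assms True by (intro mult_left_mono) auto
  finally have "R + sqrt (T - h) \<le> (R / sqrt (T' - T) + 1) * sqrt (T' - h)"
    using assms by (simp add: distrib_right add_mono)
  then have "(R + sqrt (T - h)) ^ d \<le> ((R / sqrt (T' - T) + 1) * sqrt (T' - h)) ^ d"
    using assms True by (intro power_mono) auto
  then have "unit_ball_vol (real d) * (R + sqrt (T - h)) ^ d \<le>
      unit_ball_vol (real d) * ((R / sqrt (T' - T) + 1) * sqrt (T' - h)) ^ d"
    by (intro mult_left_mono) auto
  then show ?thesis using True assms by (simp add: region_volume_def power_mult_distrib mult.assoc)
next
  case False
  then show ?thesis using assms by (simp add: region_volume_def)
qed

lemma admissibleD:
  assumes "admissible d E f"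
  shows "f \<in> borel_measurable borel" "\<And>x. 0 \<le> f x" "\<And>x. x \<notin> E \<Longrightarrow> f x = 0"
    "(\<exists>a. E = {a..}) \<or> (\<exists>b. E = {..<b}) \<or> E = UNIV"
    "\<And>t. t \<in> E \<Longrightarrow> (\<integral>\<^sup>+h\<in>{..<t}. ennreal (f h * sqrt (t - h) ^ d) \<partial>lborel) < \<infinity>"
proof -
  have f: "f \<in> L1_loc_plus E" and E: "(\<exists>a. E = {a..}) \<or> (\<exists>b. E = {..<b}) \<or> E = UNIV"
    and I: "\<forall>t\<in>E. frac_integral (real d / 2 + 1) f t < \<infinity>"
    using assms unfolding admissible_def by blast+
  show "f \<in> borel_measurable borel" "\<And>x. 0 \<le> f x" using f by (simp_all add: L1_loc_plus_def)
  show "f x = 0" if "x \<notin> E" for x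
    using f that interior_subset[of E] unfolding L1_loc_plus_def by blast
  show "(\<integral>\<^sup>+h\<in>{..<t}. ennreal (f h * sqrt (t - h) ^ d) \<partial>lborel) < \<infinity>" if "t \<in> E" for t
    using I that frac_integral_finite_iff by blast
qed (use assms in \<open>auto simp: admissible_def\<close>)

text \<open>None of the three shapes of \<open>E\<close> has a greatest element. The gap between
  \<open>T\<close> and \<open>T'\<close> is spent in \<open>region_volume_bound\<close>.\<close>

lemma admissible_larger:
  assumes "admissible d E f" "T \<in> E"
  obtains T' where "T < T'" "T' \<in> E"
proof -
  consider a where "E = {a..}" | b where "E = {..<b}" | "E = UNIV" using admissibleD(4)[OF assms(1)] by blast
  then show thesis
  proof cases
    case 1
    then show ?thesis using assms(2) by (intro that[of "T + 1"]) auto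
  next
    case 2
    then show ?thesis using assms(2) dense[of T] that by auto
  next
    case 3
    then show ?thesis by (intro that[of "T + 1"]) auto
  qed
qed

lemma admissible_volume_integral_finite:
  assumes f: "admissible d E f" and T: "T \<in> E" and R: "0 \<le> R"
  shows "(\<integral>\<^sup>+h. ennreal (f h) * ennreal (region_volume d R T h) \<partial>lborel) < \<infinity>"
proof -
  obtain T' where T': "T < T'" "T' \<in> E" using admissible_larger[OF f T] .
  note D = admissibleD[OF f]
  note D(1) [measurable]
  define K where "K = unit_ball_vol (real d) * (R / sqrt (T' - T) + 1) ^ d"
  have K: "0 \<le> K" using R T' by (simp add: K_def)
  have "(\<integral>\<^sup>+h. ennreal (f h) * ennreal (region_volume d R T h) \<partial>lborel) \<le>
      (\<integral>\<^sup>+h. ennreal K * (ennreal (f h * sqrt (T' - h) ^ d) * indicator {..<T'} h) \<partial>lborel)"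
  proof (rule nn_integral_mono)
    fix h
    have "ennreal (f h) * ennreal (region_volume d R T h) \<le>
        ennreal (f h) * ennreal (K * (if h < T' then sqrt (T' - h) ^ d else 0))"
      using region_volume_bound[OF R T'(1), of d h] by (intro mult_left_mono ennreal_leI) (auto simp: K_def)
    also have "\<dots> = ennreal K * (ennreal (f h * sqrt (T' - h) ^ d) * indicator {..<T'} h)"
      using D(2) K by (auto simp: ennreal_mult[symmetric] mult_ac)
    finally show "ennreal (f h) * ennreal (region_volume d R T h) \<le>
        ennreal K * (ennreal (f h * sqrt (T' - h) ^ d) * indicator {..<T'} h)" .
  qed
  also have "\<dots> = ennreal K * (\<integral>\<^sup>+h\<in>{..<T'}. ennreal (f h * sqrt (T' - h) ^ d) \<partial>lborel)"
    by (intro nn_integral_cmult) measurable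
  also have "\<dots> < \<infinity>" using D(5)[OF T'(2)] by (simp add: ennreal_mult_less_top)
  finally show ?thesis .
qed

lemma admissible_intensity_finite:
  assumes f: "admissible DIM('a) E f" and T: "T \<in> E" and R: "0 \<le> R"
  shows "emeasure (intensity f) (influence_region R T :: ('a::euclidean_space \<times> real) set) < \<infinity>"
proof -
  note D = admissibleD[OF f]
  have "emeasure (intensity f) (influence_region R T :: ('a \<times> real) set) \<le>
      (\<integral>\<^sup>+h. ennreal (f h) * ennreal (region_volume DIM('a) R T h) \<partial>lborel)"
    using emeasure_intensity[OF D(1) sets_influence_region[OF R, where 'a = 'a]]
      nn_integral_influence_region_le[of "\<lambda>h. ennreal (f h)", OF _ R, where 'a = 'a] D(1) by simp
  then show ?thesis using admissible_volume_integral_finite[OF f T R] by (rule le_less_trans)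
qed

lemma tendsto_0_ennrealI:
  fixes X :: "'i \<Rightarrow> ennreal"
  assumes "\<And>e::real. e > 0 \<Longrightarrow> eventually (\<lambda>n. X n \<le> ennreal e) F"
  shows "(X \<longlongrightarrow> 0) F"
proof (rule order_tendstoI)
  fix a :: ennreal assume "0 < a"
  then obtain x where x: "0 < x" "x < a" using dense by blast
  then have "x < top" by (meson less_le_trans top_greatest)
  then have xe: "ennreal (enn2real x) = x" by simp
  then have "enn2real x > 0" using x(1) by (metis ennreal_less_zero_iff)
  from assms[OF this] show "eventually (\<lambda>n. X n < a) F"
    by eventually_elim (use x xe in auto)
qed simp

text \<open>As \<open>h\<close> tends to minus infinity the section grows like
  \<open>\<bar>h\<bar> powr (d / 2)\<close>, which leaves a factor
  \<open>\<bar>h\<bar> powr \<delta>\<close> of the assumed moment to spare. For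
  \<open>\<bar>h\<bar> \<ge> 1\<close> both \<open>R\<close> and \<open>T\<close> go into the
  constant.\<close>

lemma region_volume_bound_far:
  assumes "0 \<le> R" "h \<le> - 1"
  shows "region_volume d R T h \<le>
    unit_ball_vol (real d) * (R + sqrt (\<bar>T\<bar> + 1)) ^ d * \<bar>h\<bar> powr (real d / 2)"
proof (cases "h \<le> T")
  case True
  have "\<bar>T\<bar> * 1 \<le> \<bar>T\<bar> * \<bar>h\<bar>" using assms(2) by (intro mult_left_mono) auto
  then have "T - h \<le> (\<bar>T\<bar> + 1) * \<bar>h\<bar>" using assms(2) by (simp add: algebra_simps)
  then have "sqrt (T - h) \<le> sqrt (\<bar>T\<bar> + 1) * sqrt \<bar>h\<bar>" by (simp flip: real_sqrt_mult)
  moreover have "R * 1 \<le> R * sqrt \<bar>h\<bar>" using assms by (intro mult_left_mono) auto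
  ultimately have "R + sqrt (T - h) \<le> (R + sqrt (\<bar>T\<bar> + 1)) * sqrt \<bar>h\<bar>"
    by (simp add: distrib_right)
  then have "(R + sqrt (T - h)) ^ d \<le> ((R + sqrt (\<bar>T\<bar> + 1)) * sqrt \<bar>h\<bar>) ^ d"
    using assms True by (intro power_mono) auto
  also have "\<dots> = (R + sqrt (\<bar>T\<bar> + 1)) ^ d * \<bar>h\<bar> powr (real d / 2)"
    using assms(2) by (simp add: power_mult_distrib sqrt_power_eq_powr)
  finally have "unit_ball_vol (real d) * (R + sqrt (T - h)) ^ d \<le>
      unit_ball_vol (real d) * ((R + sqrt (\<bar>T\<bar> + 1)) ^ d * \<bar>h\<bar> powr (real d / 2))"
    by (intro mult_left_mono) auto
  then show ?thesis using True by (simp add: region_volume_def mult.assoc)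
next
  case False
  then show ?thesis using assms by (simp add: region_volume_def)
qed

text \<open>Away from \<open>h = -\<infinity>\<close> the weight is bounded and the convergence in \<open>L\<^sup>1\<close> applies; the moment
  condition makes the contribution of \<open>h < -L\<close> uniformly of order \<open>L\<close> to the power \<open>-\<delta>\<close>.\<close>

lemma weighted_L1_convergence:
  fixes fs :: "nat \<Rightarrow> real \<Rightarrow> real"
  assumes f: "admissible d E f" and fs: "\<And>n. admissible d (Es n) (fs n)"
    and T: "T \<in> E" and R: "0 \<le> R"
    and conv: "(\<lambda>n. \<integral>\<^sup>+h\<in>{..T}. ennreal \<bar>fs n h - f h\<bar> \<partial>lborel) \<longlonglongrightarrow> 0"
    and delta: "\<delta> > 0"
    and moment: "(SUP n. \<integral>\<^sup>+h\<in>{..x0}. ennreal (\<bar>h\<bar> powr (real d / 2 + \<delta>) * fs n h) \<partial>lborel) < \<infinity>"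
  shows "(\<lambda>n. \<integral>\<^sup>+h. ennreal \<bar>fs n h - f h\<bar> * ennreal (region_volume d R T h) \<partial>lborel) \<longlonglongrightarrow> 0"
proof (rule tendsto_0_ennrealI)
  fix e :: real assume e: "e > 0"
  note Df = admissibleD[OF f] and Dfs = admissibleD[OF fs]
  note Df(1) [measurable] Dfs(1) [measurable]
  let ?g = "region_volume d R T"
  note g0 = region_volume_nonneg[OF R]
  define S where "S = (SUP n. \<integral>\<^sup>+h\<in>{..x0}. ennreal (\<bar>h\<bar> powr (real d / 2 + \<delta>) * fs n h) \<partial>lborel)"
  define K where "K = unit_ball_vol (real d) * (R + sqrt (\<bar>T\<bar> + 1)) ^ d"
  have K: "0 \<le> K" using R by (simp add: K_def)
  have S: "ennreal (enn2real S) = S" using moment by (simp add: S_def)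
  \<comment> \<open>The moment condition speaks about \<open>fs\<close>; for the limit
    \<open>f\<close> the far part is controlled by the finiteness of its own volume
    integral.\<close>
  define tail where "tail L = (\<integral>\<^sup>+h. ennreal (f h) * ennreal (?g h) * indicator {..<- real L} h \<partial>lborel)" for L :: nat
  have "tail \<longlonglongrightarrow> 0"
  proof -
    let ?M = "density lborel (\<lambda>h. ennreal (f h) * ennreal (?g h))"
    have em: "emeasure ?M A = (\<integral>\<^sup>+h. ennreal (f h) * ennreal (?g h) * indicator A h \<partial>lborel)" if "A \<in> sets borel" for A
      using that by (subst emeasure_density) auto
    have "(\<lambda>L. emeasure ?M {..<- real L}) \<longlonglongrightarrow> emeasure ?M (\<Inter>L. {..<- real L})"
    proof (rule Lim_emeasure_decseq)
      show "decseq (\<lambda>L. {..<- real L})" by (auto simp: decseq_def)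
      fix L
      have "emeasure ?M {..<- real L} \<le> emeasure ?M UNIV" by (intro emeasure_mono) auto
      also have "\<dots> < \<infinity>" using admissible_volume_integral_finite[OF f T R] by (simp add: em)
      finally show "emeasure ?M {..<- real L} \<noteq> \<infinity>" by simp
    qed auto
    moreover have "(\<Inter>L. {..<- real L}) = {}"
    proof -
      have "\<exists>L. \<not> x < - real L" for x
        using real_arch_simple[of "- x"] by (metis neg_le_iff_le minus_minus not_less)
      then show ?thesis by blast
    qed
    ultimately show ?thesis by (simp add: tail_def[abs_def] em)
  qed
  then have ev1: "\<forall>\<^sub>F L in sequentially. tail L < ennreal (e / 3)"
    using e by (intro order_tendstoD) auto
  have "((\<lambda>L. K * real L powr (- \<delta>) * enn2real S) \<longlongrightarrow> K * 0 * enn2real S) sequentially"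
    using delta by (intro tendsto_intros tendsto_neg_powr filterlim_real_sequentially) auto
  then have ev2: "\<forall>\<^sub>F L in sequentially. K * real L powr (- \<delta>) * enn2real S < e / 3"
    using e by (intro order_tendstoD) auto
  \<comment> \<open>For \<open>L \<ge> - x0\<close> the heights below \<open>- L\<close> lie in the
    range of the moment condition.\<close>
  obtain L0 :: nat where L0: "- x0 \<le> real L0" using real_arch_simple by blast
  have "\<forall>\<^sub>F L in sequentially. tail L < ennreal (e / 3) \<and> K * real L powr (- \<delta>) * enn2real S < e / 3 \<and> L0 \<le> L \<and> 1 \<le> L"
    using ev1 ev2 eventually_ge_at_top[of L0] eventually_ge_at_top[of 1] by eventually_elim auto
  then obtain L where L: "tail L < ennreal (e / 3)" "K * real L powr (- \<delta>) * enn2real S < e / 3"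
    "- x0 \<le> real L" "1 \<le> real L" using L0 by (auto simp: eventually_sequentially)
  define G where "G = unit_ball_vol (real d) * (R + sqrt (\<bar>T\<bar> + real L)) ^ d"
  have G: "0 \<le> G" using R by (simp add: G_def)
  have gG: "?g h \<le> G" if "- real L \<le> h" for h
  proof (cases "h \<le> T")
    case True
    have "(R + sqrt (T - h)) ^ d \<le> (R + sqrt (\<bar>T\<bar> + real L)) ^ d"
      using R that True by (intro power_mono add_left_mono real_sqrt_le_mono) auto
    then have "unit_ball_vol (real d) * (R + sqrt (T - h)) ^ d \<le> unit_ball_vol (real d) * (R + sqrt (\<bar>T\<bar> + real L)) ^ d"
      by (intro mult_left_mono) auto
    then show ?thesis using True by (simp add: region_volume_def G_def)
  qed (use G in \<open>simp add: region_volume_def\<close>)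
  have far: "(\<integral>\<^sup>+h. ennreal (fs n h) * ennreal (?g h) * indicator {..<- real L} h \<partial>lborel) \<le> ennreal (e / 3)" for n
  proof -
    have "(\<integral>\<^sup>+h. ennreal (fs n h) * ennreal (?g h) * indicator {..<- real L} h \<partial>lborel) \<le>
       (\<integral>\<^sup>+h. ennreal (K * real L powr (- \<delta>)) * (ennreal (\<bar>h\<bar> powr (real d / 2 + \<delta>) * fs n h) * indicator {..x0} h) \<partial>lborel)"
    proof (rule nn_integral_mono)
      fix h
      show "ennreal (fs n h) * ennreal (?g h) * indicator {..<- real L} h \<le>
         ennreal (K * real L powr (- \<delta>)) * (ennreal (\<bar>h\<bar> powr (real d / 2 + \<delta>) * fs n h) * indicator {..x0} h)"
      proof (cases "h < - real L")
        case True
        have "?g h \<le> K * \<bar>h\<bar> powr (real d / 2)"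
          using region_volume_bound_far[OF R, of h d T] True L(4) by (simp add: K_def)
        also have "\<dots> = K * (\<bar>h\<bar> powr (- \<delta>) * \<bar>h\<bar> powr (real d / 2 + \<delta>))"
          by (simp flip: powr_add)
        also have "\<dots> \<le> K * (real L powr (- \<delta>) * \<bar>h\<bar> powr (real d / 2 + \<delta>))"
          using True L(4) delta K by (intro mult_left_mono mult_right_mono powr_mono2') auto
        finally have "fs n h * ?g h \<le> fs n h * (K * (real L powr (- \<delta>) * \<bar>h\<bar> powr (real d / 2 + \<delta>)))"
          using Dfs(2) by (intro mult_left_mono)
        then have "ennreal (fs n h * ?g h) \<le> ennreal ((K * real L powr (- \<delta>)) * (\<bar>h\<bar> powr (real d / 2 + \<delta>) * fs n h))"
          by (intro ennreal_leI) (simp add: mult_ac)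
        then show ?thesis using True L(3) K Dfs(2) g0 by (simp add: ennreal_mult)
      qed simp
    qed
    also have "\<dots> = ennreal (K * real L powr (- \<delta>)) * (\<integral>\<^sup>+h\<in>{..x0}. ennreal (\<bar>h\<bar> powr (real d / 2 + \<delta>) * fs n h) \<partial>lborel)"
      by (intro nn_integral_cmult) measurable
    also have "\<dots> \<le> ennreal (K * real L powr (- \<delta>)) * S"
      unfolding S_def by (intro mult_left_mono SUP_upper) auto
    also have "\<dots> = ennreal (K * real L powr (- \<delta>) * enn2real S)"
      using K by (subst S[symmetric], subst ennreal_mult) auto
    also have "\<dots> \<le> ennreal (e / 3)" using L(2) by (intro ennreal_leI) simp
    finally show ?thesis .
  qed
  have "(\<lambda>n. ennreal G * (\<integral>\<^sup>+h\<in>{..T}. ennreal \<bar>fs n h - f h\<bar> \<partial>lborel)) \<longlonglongrightarrow> ennreal G * 0"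
    using conv by (intro tendsto_mult_ennreal tendsto_const) auto
  then have "\<forall>\<^sub>F n in sequentially. ennreal G * (\<integral>\<^sup>+h\<in>{..T}. ennreal \<bar>fs n h - f h\<bar> \<partial>lborel) < ennreal (e / 3)"
    using e by (intro order_tendstoD) auto
  then show "\<forall>\<^sub>F n in sequentially. (\<integral>\<^sup>+h. ennreal \<bar>fs n h - f h\<bar> * ennreal (?g h) \<partial>lborel) \<le> ennreal e"
  proof eventually_elim
    case (elim n)
    have "(\<integral>\<^sup>+h. ennreal \<bar>fs n h - f h\<bar> * ennreal (?g h) \<partial>lborel) \<le>
      (\<integral>\<^sup>+h. ennreal G * (ennreal \<bar>fs n h - f h\<bar> * indicator {..T} h) +
        (ennreal (fs n h) * ennreal (?g h) * indicator {..<- real L} h +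
         ennreal (f h) * ennreal (?g h) * indicator {..<- real L} h) \<partial>lborel)"
    proof (rule nn_integral_mono)
      fix h
      show "ennreal \<bar>fs n h - f h\<bar> * ennreal (?g h) \<le> ennreal G * (ennreal \<bar>fs n h - f h\<bar> * indicator {..T} h) +
        (ennreal (fs n h) * ennreal (?g h) * indicator {..<- real L} h +
         ennreal (f h) * ennreal (?g h) * indicator {..<- real L} h)"
      proof (cases "h < - real L")
        case True
        have "\<bar>fs n h - f h\<bar> \<le> fs n h + f h" using Df(2)[of h] Dfs(2)[of n h] by linarith
        then have "ennreal \<bar>fs n h - f h\<bar> * ennreal (?g h) \<le> (ennreal (fs n h) + ennreal (f h)) * ennreal (?g h)"
          using Df(2) Dfs(2) by (intro mult_right_mono) (auto simp flip: ennreal_plus)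
        then show ?thesis using True by (simp add: distrib_right add_increasing)
      next
        case False
        then have "ennreal \<bar>fs n h - f h\<bar> * ennreal (?g h) \<le> ennreal G * (ennreal \<bar>fs n h - f h\<bar> * indicator {..T} h)"
        proof (cases "h \<le> T")
          case True
          then show ?thesis using gG[of h] False by (simp add: mult.commute[of "ennreal G"] mult_left_mono ennreal_leI)
        qed (simp add: region_volume_def)
        then show ?thesis by (simp add: add_increasing2)
      qed
    qed
    also have "\<dots> = ennreal G * (\<integral>\<^sup>+h\<in>{..T}. ennreal \<bar>fs n h - f h\<bar> \<partial>lborel) +
       ((\<integral>\<^sup>+h. ennreal (fs n h) * ennreal (?g h) * indicator {..<- real L} h \<partial>lborel) + tail L)"
      unfolding tail_def by (subst nn_integral_add, measurable, subst nn_integral_cmult, measurable,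
        subst nn_integral_add, measurable)
    also have "\<dots> \<le> ennreal (e / 3) + (ennreal (e / 3) + ennreal (e / 3))"
      using elim far L(1) by (intro add_mono) auto
    also have "\<dots> = ennreal e" using e by (simp flip: ennreal_plus)
    finally show ?case .
  qed
qed

subsection \<open>Almost sure spreading of the points\<close>

lemma AE_finite_of_poisson_process:
  assumes \<eta>: "poisson_process M \<eta> \<Lambda>" and B: "B \<in> sets borel" and fin: "emeasure \<Lambda> B < \<infinity>"
  shows "AE \<omega> in M. finite (\<eta> \<omega> \<inter> B)"
proof -
  have pc: "poisson_counts M (\<lambda>B \<omega>. num_points (\<eta> \<omega>) B) \<Lambda>" using \<eta> by (simp add: poisson_process_iff_counts)
  note D = poisson_countsD[OF pc]
  interpret prob_space M by (rule D(1))
  note D(2)[OF B, measurable]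
  have "(\<lambda>k. prob {\<omega>\<in>space M. num_points (\<eta> \<omega>) B = of_nat k}) sums prob (\<Union>k. {\<omega>\<in>space M. num_points (\<eta> \<omega>) B = of_nat k})"
    by (rule finite_measure_UNION) (auto simp: disjoint_family_on_def)
  moreover have "(\<lambda>k. prob {\<omega>\<in>space M. num_points (\<eta> \<omega>) B = of_nat k}) sums 1"
    unfolding D(3)[OF B fin] by (rule poisson_density_sums)
  ultimately have "prob (\<Union>k. {\<omega>\<in>space M. num_points (\<eta> \<omega>) B = of_nat k}) = 1"
    by (rule sums_unique2)
  then have "AE \<omega> in M. \<omega> \<in> (\<Union>k. {\<omega>\<in>space M. num_points (\<eta> \<omega>) B = of_nat k})" by (subst (asm) prob_eq_1) auto
  then show ?thesis
  proof eventually_elim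
    case (elim \<omega>)
    then obtain k :: nat where "num_points (\<eta> \<omega>) B = of_nat k" by auto
    then show ?case
      by (cases "finite (\<eta> \<omega> \<inter> B)") (simp_all add: num_points_def)
  qed
qed

lemma AE_nonempty_of_poisson_process:
  assumes \<eta>: "poisson_process M \<eta> \<Lambda>" and B: "B \<in> sets borel" and inf: "emeasure \<Lambda> B = \<infinity>"
  shows "AE \<omega> in M. \<eta> \<omega> \<inter> B \<noteq> {}"
proof -
  have pc: "poisson_counts M (\<lambda>B \<omega>. num_points (\<eta> \<omega>) B) \<Lambda>" using \<eta> by (simp add: poisson_process_iff_counts)
  show ?thesis using poisson_countsD(4)[OF pc B inf]
    by eventually_elim (auto simp: num_points_def)
qed

lemma void_probability:
  assumes \<eta>: "poisson_process M \<eta> \<Lambda>" and B: "B \<in> sets borel" and fin: "emeasure \<Lambda> B < \<infinity>"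
  shows "{\<omega>\<in>space M. \<eta> \<omega> \<inter> B = {}} \<in> sets M"
    "measure M {\<omega>\<in>space M. \<eta> \<omega> \<inter> B = {}} = exp (- measure \<Lambda> B)"
proof -
  have pc: "poisson_counts M (\<lambda>B \<omega>. num_points (\<eta> \<omega>) B) \<Lambda>" using \<eta> by (simp add: poisson_process_iff_counts)
  note D = poisson_countsD[OF pc]
  have eq: "\<eta> \<omega> \<inter> B = {} \<longleftrightarrow> num_points (\<eta> \<omega>) B = of_nat 0" for \<omega>
    by (simp add: num_points_def emeasure_count_space_eq_0)
  show "measure M {\<omega>\<in>space M. \<eta> \<omega> \<inter> B = {}} = exp (- measure \<Lambda> B)"
    unfolding eq using D(3)[OF B fin, of 0] by (simp add: poisson_density_def)
  show "{\<omega>\<in>space M. \<eta> \<omega> \<inter> B = {}} \<in> sets M"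
    unfolding eq using D(2)[OF B] by measurable
qed

definition orthant_region :: "real \<Rightarrow> 'a::euclidean_space set \<Rightarrow> real \<Rightarrow> ('a \<times> real) set" where
  "orthant_region K s T = {p. snd p \<le> T \<and> (\<forall>i\<in>Basis. if i \<in> s then K \<le> fst p \<bullet> i else fst p \<bullet> i \<le> - K)}"

lemma sets_orthant_region: "(orthant_region K s T :: ('a::euclidean_space \<times> real) set) \<in> sets borel"
proof -
  have "orthant_region K s T = {p. snd p \<le> T} \<inter> (\<Inter>i\<in>Basis. {p. if i \<in> s then K \<le> fst p \<bullet> i else fst p \<bullet> i \<le> - K})"
    by (auto simp: orthant_region_def)
  moreover have "closed ({p. snd p \<le> T} \<inter> (\<Inter>i\<in>Basis. {p::'a \<times> real. if i \<in> s then K \<le> fst p \<bullet> i else fst p \<bullet> i \<le> - K}))"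
  proof (intro closed_Int closed_INT ballI)
    show "closed {p::'a \<times> real. snd p \<le> T}"
      by (intro closed_Collect_le continuous_on_snd continuous_on_id continuous_on_const)
    show "closed {p::'a \<times> real. if i \<in> s then K \<le> fst p \<bullet> i else fst p \<bullet> i \<le> - K}" for i
      by (cases "i \<in> s") (simp_all add: closed_Collect_le continuous_on_inner continuous_on_fst)
  qed
  ultimately show ?thesis by (simp only: borel_closed)
qed

text \<open>The orthant contains boxes with all sides equal to \<open>n\<close>, of volume at least
  \<open>n\<close>.\<close>

lemma emeasure_orthant:
  "emeasure lborel {v::'a::euclidean_space. \<forall>i\<in>Basis. if i \<in> s then K \<le> v \<bullet> i else v \<bullet> i \<le> - K} = \<infinity>"
  (is "emeasure lborel ?O = _")
proof -
  have "of_nat n \<le> emeasure lborel ?O" if n: "1 \<le> n" for n :: nat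
  proof -
    define l :: 'a where "l = (\<Sum>i\<in>Basis. (if i \<in> s then K else - K - real n) *\<^sub>R i)"
    define u :: 'a where "u = (\<Sum>i\<in>Basis. (if i \<in> s then K + real n else - K) *\<^sub>R i)"
    have lu: "l \<bullet> i = (if i \<in> s then K else - K - real n)" "u \<bullet> i = (if i \<in> s then K + real n else - K)"
      if "i \<in> Basis" for i using that by (auto simp: l_def u_def)
    have "emeasure lborel (cbox l u) = ennreal (\<Prod>i\<in>Basis. (u - l) \<bullet> i)"
      by (rule emeasure_lborel_cbox) (simp add: lu)
    also have "(\<Prod>i\<in>Basis. (u - l) \<bullet> i) = (\<Prod>i\<in>(Basis::'a set). real n)"
      by (rule prod.cong) (auto simp: inner_diff_left lu)
    also have "\<dots> = real n ^ DIM('a)" by simp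
    also have "ennreal (real n) \<le> ennreal (real n ^ DIM('a))"
      using n self_le_power[of "real n" "DIM('a)"] by (intro ennreal_leI) auto
    finally have "of_nat n \<le> emeasure lborel (cbox l u)" by (simp add: ennreal_of_nat_eq_real_of_nat)
    also have "\<dots> \<le> emeasure lborel ?O"
    proof (rule emeasure_mono)
      show "cbox l u \<subseteq> ?O" by (auto simp: mem_box lu split: if_splits)
      have "?O = (\<Inter>i\<in>Basis. {v. if i \<in> s then K \<le> v \<bullet> i else v \<bullet> i \<le> - K})" by auto
      moreover have "closed {v::'a. if i \<in> s then K \<le> v \<bullet> i else v \<bullet> i \<le> - K}" for i
        by (cases "i \<in> s") (auto intro!: closed_Collect_le continuous_intros)
      ultimately have "closed ?O" by (simp only:) (intro closed_INT ballI, auto)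
      then show "?O \<in> sets lborel" by simp
    qed
    finally show ?thesis .
  qed
  note ge = this
  show ?thesis
  proof (rule ccontr)
    assume "emeasure lborel ?O \<noteq> \<infinity>"
    then obtain n :: nat where n: "emeasure lborel ?O < of_nat n"
      using ennreal_Ex_less_of_nat[of "emeasure lborel ?O"] by (auto simp: less_top)
    then have "1 \<le> n" by (cases n) auto
    then show False using ge[of n] n by simp
  qed
qed

text \<open>Every height below \<open>T\<close> that carries mass contributes a whole orthant of
  infinite volume. So the process almost surely has points there, which are those that surround
  \<open>u\<close> in \<open>simplex_centre_bound\<close>.\<close>

lemma emeasure_intensity_orthant:
  assumes f: "f \<in> borel_measurable borel" and pos: "(\<integral>\<^sup>+h\<in>{..T}. ennreal (f h) \<partial>lborel) > 0"
  shows "emeasure (intensity f) (orthant_region K s T :: ('a::euclidean_space \<times> real) set) = \<infinity>"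
proof -
  note f [measurable]
  have "emeasure (intensity f) (orthant_region K s T :: ('a \<times> real) set) =
      (\<integral>\<^sup>+h. ennreal (f h) * emeasure lborel {v::'a. (v, h) \<in> orthant_region K s T} \<partial>lborel)"
    by (rule emeasure_intensity_sections[OF f sets_orthant_region])
  also have "\<dots> = (\<integral>\<^sup>+h. \<infinity> * (ennreal (f h) * indicator {..T} h) \<partial>lborel)"
  proof (rule nn_integral_cong)
    fix h
    show "ennreal (f h) * emeasure lborel {v::'a. (v, h) \<in> orthant_region K s T} = \<infinity> * (ennreal (f h) * indicator {..T} h)"
    proof (cases "h \<le> T")
      case True
      then have "{v::'a. (v, h) \<in> orthant_region K s T} = {v. \<forall>i\<in>Basis. if i \<in> s then K \<le> v \<bullet> i else v \<bullet> i \<le> - K}"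
        by (simp add: orthant_region_def)
      then show ?thesis using True emeasure_orthant[of s K] by (simp add: mult.commute)
    qed (simp add: orthant_region_def)
  qed
  also have "\<dots> = \<infinity> * (\<integral>\<^sup>+h\<in>{..T}. ennreal (f h) \<partial>lborel)"
    by (intro nn_integral_cmult) measurable
  also have "\<dots> = \<infinity>" using pos by (simp add: ennreal_top_mult)
  finally show ?thesis .
qed

lemma AE_orthants:
  fixes \<eta> :: "'w \<Rightarrow> ('a::euclidean_space \<times> real) set"
  assumes \<eta>: "poisson_process M \<eta> (intensity f)" and f: "f \<in> borel_measurable borel"
    and pos: "(\<integral>\<^sup>+h\<in>{..T}. ennreal (f h) \<partial>lborel) > 0"
  shows "AE \<omega> in M. \<forall>K::nat. \<forall>s. s \<subseteq> Basis \<longrightarrow>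
    (\<exists>p\<in>\<eta> \<omega>. snd p \<le> T \<and> (\<forall>i\<in>Basis. if i \<in> s then real K \<le> fst p \<bullet> i else fst p \<bullet> i \<le> - real K))"
proof -
  have "AE \<omega> in M. \<eta> \<omega> \<inter> orthant_region (real K) s T \<noteq> {}" for K :: nat and s
    by (rule AE_nonempty_of_poisson_process[OF \<eta> sets_orthant_region emeasure_intensity_orthant[OF f pos]])
  then have "AE \<omega> in M. \<forall>s\<in>Pow Basis. \<eta> \<omega> \<inter> orthant_region (real K) s T \<noteq> {}" for K :: nat
    by (intro AE_finite_allI) auto
  then have "AE \<omega> in M. \<forall>K::nat. \<forall>s\<in>Pow Basis. \<eta> \<omega> \<inter> orthant_region (real K) s T \<noteq> {}"
    by (simp add: AE_all_countable)
  then show ?thesis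
  proof eventually_elim
    case (elim \<omega>)
    show ?case
    proof (intro allI impI)
      fix K :: nat and s :: "'a set" assume "s \<subseteq> Basis"
      then have "\<eta> \<omega> \<inter> orthant_region (real K) s T \<noteq> {}" using elim by blast
      then obtain p where "p \<in> \<eta> \<omega>" "p \<in> orthant_region (real K) s T" by blast
      then show "\<exists>p\<in>\<eta> \<omega>. snd p \<le> T \<and> (\<forall>i\<in>Basis. if i \<in> s then real K \<le> fst p \<bullet> i else fst p \<bullet> i \<le> - real K)"
        by (intro bexI[of _ p]) (auto simp: orthant_region_def)
    qed
  qed
qed

text \<open>A grid of mesh \<open>1 / (m * d)\<close> suffices because the norm is at most the sum
  of the \<open>d\<close> coordinate errors. What matters later is that the cardinality is
  polynomial in \<open>m\<close>.\<close>

lemma lattice_net: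
  fixes R m :: nat
  assumes m: "m \<ge> 1"
  obtains F :: "'a::euclidean_space set" where "finite F"
    "real (card F) \<le> (2 * real R * real m * real DIM('a) + 3) ^ DIM('a)"
    "\<And>w. w \<in> cball 0 (real R) \<Longrightarrow> \<exists>u\<in>F. norm (w - u) \<le> 1 / real m"
proof -
  define d where "d = real DIM('a)"
  have d: "d > 0" by (simp add: d_def)
  \<comment> \<open>Each coordinate takes \<open>2 * L + 1 = 2 * R * m * d + 3\<close> values; the 1
    in \<open>L\<close> is slack for rounding down.\<close>
  define L :: int where "L = int R * int m * int DIM('a) + 1"
  let ?Z = "PiE (Basis :: 'a set) (\<lambda>_. {-L..L})"
  define pt where "pt z = (\<Sum>b\<in>Basis. (real_of_int (z b) / (real m * d)) *\<^sub>R b)" for z :: "'a \<Rightarrow> int"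
  have L0: "0 \<le> L" by (simp add: L_def)
  have fin: "finite ?Z" by (intro finite_PiE) auto
  have "card ?Z = (nat (2 * L + 1)) ^ DIM('a)" by (simp add: card_PiE)
  moreover have "real (nat (2 * L + 1)) = 2 * real R * real m * d + 3"
    using L0 by (simp add: L_def d_def)
  ultimately have card: "real (card ?Z) = (2 * real R * real m * d + 3) ^ DIM('a)" by simp
  show thesis
  proof (rule that[of "pt ` ?Z"])
    show "finite (pt ` ?Z)" using fin by simp
    have "real (card (pt ` ?Z)) \<le> real (card ?Z)" using card_image_le[OF fin] by simp
    then show "real (card (pt ` ?Z)) \<le> (2 * real R * real m * real DIM('a) + 3) ^ DIM('a)"
      using card by (simp add: d_def)
    fix w :: 'a assume w: "w \<in> cball 0 (real R)"
    define z where "z = restrict (\<lambda>b. \<lfloor>(w \<bullet> b) * (real m * d)\<rfloor>) Basis"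
    have "z \<in> ?Z"
    proof (rule PiE_I)
      fix b :: 'a assume b: "b \<in> Basis"
      have "\<bar>w \<bullet> b\<bar> \<le> real R" using w Basis_le_norm[OF b, of w] by simp
      then have "\<bar>(w \<bullet> b) * (real m * d)\<bar> \<le> real R * (real m * d)"
        using d by (simp add: abs_mult mult_right_mono)
      moreover have "real R * (real m * d) = of_int (L - 1)" by (simp add: L_def d_def)
      ultimately have "- of_int (L - 1) \<le> (w \<bullet> b) * (real m * d)" "(w \<bullet> b) * (real m * d) \<le> of_int (L - 1)"
        by linarith+
      then have "- L \<le> \<lfloor>(w \<bullet> b) * (real m * d)\<rfloor>" "\<lfloor>(w \<bullet> b) * (real m * d)\<rfloor> \<le> L" by linarith+
      then show "z b \<in> {-L..L}" using b by (simp add: z_def)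
    qed (simp add: z_def)
    moreover have "norm (w - pt z) \<le> 1 / real m"
    proof -
      have "norm (w - pt z) \<le> (\<Sum>b\<in>Basis. \<bar>(w - pt z) \<bullet> b\<bar>)" by (rule norm_le_l1)
      also have "\<dots> \<le> (\<Sum>b\<in>(Basis::'a set). 1 / (real m * d))"
      proof (rule sum_mono)
        fix b :: 'a assume b: "b \<in> Basis"
        have "(w - pt z) \<bullet> b = ((w \<bullet> b) * (real m * d) - real_of_int \<lfloor>(w \<bullet> b) * (real m * d)\<rfloor>) / (real m * d)"
          using b m d by (simp add: inner_diff_left pt_def z_def diff_divide_distrib)
        moreover have "\<bar>(w \<bullet> b) * (real m * d) - real_of_int \<lfloor>(w \<bullet> b) * (real m * d)\<rfloor>\<bar> \<le> 1" by linarith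
        ultimately show "\<bar>(w - pt z) \<bullet> b\<bar> \<le> 1 / (real m * d)"
          using m d by (simp add: divide_right_mono)
      qed
      also have "\<dots> = 1 / real m" using d m by (simp add: d_def)
      finally show ?thesis .
    qed
    ultimately show "\<exists>u\<in>pt ` ?Z. norm (w - u) \<le> 1 / real m" by blast
  qed
qed

text \<open>The lower bound \<open>c\<close> on the height, later \<open>b - 1\<close>, keeps the
  points within distance 1 of \<open>u\<close>. This limits how much their power changes when
  \<open>u\<close> moves to a nearby point.\<close>

definition low_region :: "'a::euclidean_space \<Rightarrow> real \<Rightarrow> real \<Rightarrow> ('a \<times> real) set" where
  "low_region u c t = {p. c \<le> snd p \<and> pow u p \<le> t}"

lemma sets_low_region: "low_region u c t \<in> sets borel"
proof -
  have "low_region u c t = {p. c \<le> snd p} \<inter> {p. pow u p \<le> t}" by (auto simp: low_region_def)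
  moreover have "closed {p::'a \<times> real. c \<le> snd p}" "closed {p. pow u p \<le> t}"
    unfolding pow_def by (auto intro!: closed_Collect_le continuous_intros)
  ultimately show ?thesis by simp
qed

lemma emeasure_intensity_low_region:
  fixes u :: "'a::euclidean_space"
  assumes f: "f \<in> borel_measurable borel" "\<And>h. 0 \<le> f h"
  shows "emeasure (intensity f) (low_region u c t) =
    ennreal (unit_ball_vol (real DIM('a))) * (\<integral>\<^sup>+h\<in>{c..<t}. ennreal (f h * sqrt (t - h) ^ DIM('a)) \<partial>lborel)"
proof -
  note f(1) [measurable]
  have "emeasure (intensity f) (low_region u c t) =
      (\<integral>\<^sup>+h. ennreal (f h) * emeasure lborel {v. (v, h) \<in> low_region u c t} \<partial>lborel)"
    by (rule emeasure_intensity_sections[OF f(1) sets_low_region])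
  also have "\<dots> = (\<integral>\<^sup>+h. ennreal (unit_ball_vol (real DIM('a))) * (ennreal (f h * sqrt (t - h) ^ DIM('a)) * indicator {c..<t} h) \<partial>lborel)"
  proof -
    have "ennreal (f h) * emeasure lborel {v. (v, h) \<in> low_region u c t} =
      ennreal (unit_ball_vol (real DIM('a))) * (ennreal (f h * sqrt (t - h) ^ DIM('a)) * indicator {c..<t} h)"
      if ht: "h \<noteq> t" for h
    proof (cases "c \<le> h \<and> h < t")
      case True
      have le_iff: "(norm (u - v))\<^sup>2 + h \<le> t \<longleftrightarrow> norm (u - v) \<le> sqrt (t - h)" for v
      proof -
        have "norm (u - v) \<le> sqrt (t - h) \<longleftrightarrow> (norm (u - v))\<^sup>2 \<le> t - h"
          using real_sqrt_le_iff[of "(norm (u - v))\<^sup>2" "t - h"] by (simp only: real_sqrt_abs abs_norm_cancel)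
        then show ?thesis by (simp only: le_diff_eq)
      qed
      have "(v, h) \<in> low_region u c t \<longleftrightarrow> v \<in> cball u (sqrt (t - h))" for v
        unfolding low_region_def pow_def mem_Collect_eq fst_conv snd_conv mem_cball dist_norm le_iff
        using True by blast
      then have "{v. (v, h) \<in> low_region u c t} = cball u (sqrt (t - h))" by blast
      then have "emeasure lborel {v. (v, h) \<in> low_region u c t} = ennreal (unit_ball_vol (real DIM('a)) * sqrt (t - h) ^ DIM('a))"
        using True by (simp add: emeasure_cball)
      then show ?thesis using True f(2)[of h] by (simp add: ennreal_mult mult_ac)
    next
      case False
      have "{v. (v, h) \<in> low_region u c t} = {}"
      proof -
        have "\<not> (c \<le> h \<and> (norm (u - v))\<^sup>2 + h \<le> t)" for v
          using False ht zero_le_power2[of "norm (u - v)"] by linarith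
        then show ?thesis by (auto simp: low_region_def pow_def)
      qed
      then show ?thesis using False by simp
    qed
    moreover have "AE h in lborel. h \<noteq> t" by (rule AE_lborel_singleton)
    ultimately have "AE h in lborel. ennreal (f h) * emeasure lborel {v. (v, h) \<in> low_region u c t} =
      ennreal (unit_ball_vol (real DIM('a))) * (ennreal (f h * sqrt (t - h) ^ DIM('a)) * indicator {c..<t} h)"
      by (auto elim: AE_mp)
    then show ?thesis by (rule nn_integral_cong_AE)
  qed
  also have "\<dots> = ennreal (unit_ball_vol (real DIM('a))) * (\<integral>\<^sup>+h\<in>{c..<t}. ennreal (f h * sqrt (t - h) ^ DIM('a)) \<partial>lborel)"
    by (intro nn_integral_cmult) measurable
  finally show ?thesis .
qed

lemma AE_ex_not_in_vanishing:
  assumes "prob_space M" "\<And>n. S n \<in> sets M" "(\<lambda>n. measure M (S n)) \<longlonglongrightarrow> 0"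
  shows "AE \<omega> in M. \<exists>n::nat. \<omega> \<notin> S n"
proof -
  interpret prob_space M by fact
  have "prob (\<Inter>n. S n) \<le> prob (S n)" for n using assms(2) by (intro finite_measure_mono) auto
  then have "prob (\<Inter>n. S n) \<le> 0" using assms(3) by (intro LIMSEQ_le_const) auto
  then have "prob (\<Inter>n. S n) = 0" using measure_nonneg[of M "\<Inter>n. S n"] by linarith
  then have "AE \<omega> in M. \<omega> \<notin> (\<Inter>n. S n)" using assms(2) by (subst prob_eq_0[symmetric]) auto
  then show ?thesis by eventually_elim auto
qed

text \<open>With \<open>\<rho> = 1 / (6 * n)\<close> and a distance \<open>a \<le> 1\<close>, moving
  the centre adds at most \<open>\<rho> * \<rho> + 2 * \<rho> * a \<le> 3 * \<rho> = 1 / (2 *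
  n)\<close> to the power. That is half of the gap \<open>1 / n\<close>, so the level stays below
  \<open>b\<close>.\<close>

lemma low_region_neighbour:
  assumes n: "n \<ge> 1" and w: "norm (w - u) \<le> 1 / (6 * real n)"
    and p: "p \<in> low_region u (b - 1) (b - 1 / real n)"
  shows "pow w p \<le> b - 1 / (2 * real n)"
proof -
  define a where "a = norm (u - fst p)"
  define \<rho> where "\<rho> = 1 / (6 * real n)"
  have p': "b - 1 \<le> snd p" "a\<^sup>2 + snd p \<le> b - 1 / real n"
    using p by (auto simp: low_region_def pow_def a_def)
  have "0 \<le> 1 / real n" by simp
  then have "a\<^sup>2 \<le> 1" using p' by linarith
  then have a: "0 \<le> a" "a \<le> 1" using abs_square_le_1[of a] by (auto simp: a_def)
  have \<rho>: "0 \<le> \<rho>" "\<rho> \<le> 1" "3 * \<rho> = 1 / (2 * real n)" using n by (auto simp: \<rho>_def field_simps)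
  have "norm (w - fst p) \<le> norm (w - u) + norm (u - fst p)"
    using norm_triangle_ineq[of "w - u" "u - fst p"] by simp
  then have "norm (w - fst p) \<le> \<rho> + a" using w by (simp add: a_def \<rho>_def)
  then have "(norm (w - fst p))\<^sup>2 \<le> (\<rho> + a)\<^sup>2" by (intro power_mono) auto
  also have "\<dots> = a\<^sup>2 + \<rho> * \<rho> + 2 * (\<rho> * a)" by (simp add: power2_eq_square algebra_simps)
  also have "\<dots> \<le> a\<^sup>2 + 3 * \<rho>"
    using mult_left_le[OF \<rho>(2,1)] mult_left_le[OF a(2) \<rho>(1)] by linarith
  finally have "pow w p \<le> a\<^sup>2 + snd p + 1 / (2 * real n)" using \<rho>(3) by (simp add: pow_def)
  moreover have "1 / real n = 1 / (2 * real n) + 1 / (2 * real n)" using n by (simp add: field_simps)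
  ultimately show ?thesis using p'(2) by linarith
qed

text \<open>Heights below \<open>b - 1\<close> contribute at most a constant \<open>c\<close>: there
  the kernel at level \<open>b - 1 / n\<close> is at most \<open>sqrt 2 ^ d\<close> times the kernel
  at the fixed level \<open>b - 1 / 2\<close>, whose integral is finite by admissibility. Hence the
  growth survives the truncation to heights from \<open>b - 1\<close> on.\<close>

lemma low_region_mass_growth:
  assumes f: "admissible d {..<b} f"
  obtains \<epsilon> c :: real and n0 :: nat where "\<epsilon> > 0" "0 \<le> c"
    "\<And>n. n > n0 \<Longrightarrow> n \<ge> 1 \<Longrightarrow> (\<integral>\<^sup>+h\<in>{b - 1..<b - 1 / real n}. ennreal (f h * sqrt (b - 1 / real n - h) ^ d) \<partial>lborel) < \<infinity>"
    "\<And>n. n > n0 \<Longrightarrow> n \<ge> 1 \<Longrightarrow> Gamma (real d / 2 + 1) * real n powr \<epsilon> - c \<le>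
      enn2real (\<integral>\<^sup>+h\<in>{b - 1..<b - 1 / real n}. ennreal (f h * sqrt (b - 1 / real n - h) ^ d) \<partial>lborel)"
proof -
  note D = admissibleD[OF f]
  note D(1) [measurable]
  let ?G = "Gamma (real d / 2 + 1)"
  have G: "?G > 0" by (rule Gamma_half_dimension_pos)
  obtain \<epsilon> n0 where \<epsilon>: "\<epsilon> > 0" and grow: "\<And>n::nat. n > n0 \<Longrightarrow> ennreal (real n powr \<epsilon>) \<le> frac_integral (real d / 2 + 1) f (b - 1 / real n)"
    using f unfolding admissible_def by blast
  define C0 where "C0 = (\<integral>\<^sup>+h\<in>{..<b - 1 / 2}. ennreal (f h * sqrt (b - 1 / 2 - h) ^ d) \<partial>lborel)"
  have C0: "C0 < \<infinity>" unfolding C0_def by (rule D(5)) simp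
  define c where "c = sqrt 2 ^ d * enn2real C0"
  have c: "0 \<le> c" by (simp add: c_def)
  define X where "X n = (\<integral>\<^sup>+h\<in>{b - 1..<b - 1 / real n}. ennreal (f h * sqrt (b - 1 / real n - h) ^ d) \<partial>lborel)" for n
  define Y where "Y n = (\<integral>\<^sup>+h\<in>{..<b - 1}. ennreal (f h * sqrt (b - 1 / real n - h) ^ d) \<partial>lborel)" for n
  have Y: "Y n \<le> ennreal c" for n
  proof -
    have "Y n \<le> (\<integral>\<^sup>+h. ennreal (sqrt 2 ^ d) * (ennreal (f h * sqrt (b - 1 / 2 - h) ^ d) * indicator {..<b - 1 / 2} h) \<partial>lborel)"
      unfolding Y_def
    proof (rule nn_integral_mono)
      fix h
      show "ennreal (f h * sqrt (b - 1 / real n - h) ^ d) * indicator {..<b - 1} h \<le>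
        ennreal (sqrt 2 ^ d) * (ennreal (f h * sqrt (b - 1 / 2 - h) ^ d) * indicator {..<b - 1 / 2} h)"
      proof (cases "h < b - 1")
        case True
        have "b - 1 / real n - h \<le> b - h" by simp
        \<comment> \<open>This inequality is equivalent to \<open>h \<le> b - 1\<close>, which is
          where the factor \<open>sqrt 2\<close> comes from.\<close>
        also have "\<dots> \<le> 2 * (b - 1 / 2 - h)" using True by (simp add: algebra_simps)
        finally have "b - 1 / real n - h \<le> 2 * (b - 1 / 2 - h)" .
        then have "sqrt (b - 1 / real n - h) \<le> sqrt 2 * sqrt (b - 1 / 2 - h)"
          by (simp only: real_sqrt_mult[symmetric] real_sqrt_le_iff)
        moreover have "0 \<le> sqrt (b - 1 / real n - h)"
        proof -
          have "1 / real n \<le> 1" by (cases "n = 0") auto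
          then show ?thesis using True by (intro real_sqrt_ge_zero) linarith
        qed
        ultimately have "sqrt (b - 1 / real n - h) ^ d \<le> (sqrt 2 * sqrt (b - 1 / 2 - h)) ^ d"
          by (intro power_mono)
        then have "f h * sqrt (b - 1 / real n - h) ^ d \<le> f h * (sqrt 2 * sqrt (b - 1 / 2 - h)) ^ d"
          using D(2) by (intro mult_left_mono)
        then have "f h * sqrt (b - 1 / real n - h) ^ d \<le> sqrt 2 ^ d * (f h * sqrt (b - 1 / 2 - h) ^ d)"
          by (simp only: power_mult_distrib mult_ac)
        then have "ennreal (f h * sqrt (b - 1 / real n - h) ^ d) \<le> ennreal (sqrt 2 ^ d) * ennreal (f h * sqrt (b - 1 / 2 - h) ^ d)"
          by (subst ennreal_mult'[symmetric]) (auto intro: ennreal_leI)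
        then show ?thesis using True by simp
      qed simp
    qed
    also have "\<dots> = ennreal (sqrt 2 ^ d) * C0" unfolding C0_def by (intro nn_integral_cmult) measurable
    also have "\<dots> = ennreal (sqrt 2 ^ d) * ennreal (enn2real C0)" using C0 by simp
    also have "\<dots> = ennreal c" unfolding c_def by (rule ennreal_mult'[symmetric]) simp
    finally show ?thesis .
  qed
  have split: "(\<integral>\<^sup>+h\<in>{..<b - 1 / real n}. ennreal (f h * sqrt (b - 1 / real n - h) ^ d) \<partial>lborel) = Y n + X n"
    if n: "n \<ge> 1" for n
  proof -
    have "1 / real n \<le> 1" using n by simp
    then have "(\<integral>\<^sup>+h\<in>{..<b - 1 / real n}. ennreal (f h * sqrt (b - 1 / real n - h) ^ d) \<partial>lborel) =
        (\<integral>\<^sup>+h. ennreal (f h * sqrt (b - 1 / real n - h) ^ d) * indicator {..<b - 1} h +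
          ennreal (f h * sqrt (b - 1 / real n - h) ^ d) * indicator {b - 1..<b - 1 / real n} h \<partial>lborel)"
      by (intro nn_integral_cong) (simp add: indicator_def)
    also have "\<dots> = Y n + X n" unfolding X_def Y_def by (rule nn_integral_add) measurable
    finally show ?thesis .
  qed
  have X_fin: "X n < \<infinity>" if n: "n \<ge> 1" for n
  proof -
    have "b - 1 / real n \<in> {..<b}" using n by simp
    from D(5)[OF this] show ?thesis unfolding split[OF n] by (simp add: less_top)
  qed
  show thesis
  proof (rule that[OF \<epsilon> c])
    fix n assume n: "n > n0" "n \<ge> 1"
    show "(\<integral>\<^sup>+h\<in>{b - 1..<b - 1 / real n}. ennreal (f h * sqrt (b - 1 / real n - h) ^ d) \<partial>lborel) < \<infinity>"
      using X_fin[OF n(2)] by (simp add: X_def)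
    have "ennreal (real n powr \<epsilon>) \<le> ennreal (1 / ?G) * (Y n + X n)"
      using grow[OF n(1)] unfolding frac_integral_half_dimension split[OF n(2)] .
    also have "\<dots> \<le> ennreal (1 / ?G) * (ennreal c + ennreal (enn2real (X n)))"
      using Y X_fin[OF n(2)] by (intro mult_left_mono add_mono) auto
    also have "\<dots> = ennreal (1 / ?G) * ennreal (c + enn2real (X n))"
      by (simp only: ennreal_plus[OF c enn2real_nonneg])
    also have "\<dots> = ennreal (1 / ?G * (c + enn2real (X n)))"
      by (rule ennreal_mult'[symmetric]) (use G in simp)
    finally have "real n powr \<epsilon> \<le> 1 / ?G * (c + enn2real (X n))"
      using G c by (subst (asm) ennreal_le_iff) auto
    then have "?G * real n powr \<epsilon> \<le> c + enn2real (X n)" using G by (simp add: field_simps)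
    then show "?G * real n powr \<epsilon> - c \<le>
        enn2real (\<integral>\<^sup>+h\<in>{b - 1..<b - 1 / real n}. ennreal (f h * sqrt (b - 1 / real n - h) ^ d) \<partial>lborel)"
      by (simp add: X_def)
  qed
qed

lemma tendsto_power_times_exp_neg_powr:
  fixes A B K \<epsilon> :: real
  assumes "B > 0" "\<epsilon> > 0"
  shows "(\<lambda>n::nat. (K * real n) ^ d * exp (A - B * real n powr \<epsilon>)) \<longlonglongrightarrow> 0"
proof -
  have "((\<lambda>x::real. x powr real d * exp (A - B * x powr \<epsilon>)) \<longlongrightarrow> 0) at_top"
    using assms by real_asymp
  then have "(\<lambda>n::nat. real n powr real d * exp (A - B * real n powr \<epsilon>)) \<longlonglongrightarrow> 0"
    by (rule filterlim_compose[OF _ filterlim_real_sequentially])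
  then have "(\<lambda>n::nat. K ^ d * (real n powr real d * exp (A - B * real n powr \<epsilon>))) \<longlonglongrightarrow> K ^ d * 0"
    by (intro tendsto_mult tendsto_const)
  moreover have "\<forall>\<^sub>F n::nat in sequentially. K ^ d * (real n powr real d * exp (A - B * real n powr \<epsilon>)) =
      (K * real n) ^ d * exp (A - B * real n powr \<epsilon>)"
    using eventually_gt_at_top[of 0]
    by eventually_elim (simp add: powr_realpow power_mult_distrib)
  ultimately show ?thesis by (simp add: tendsto_cong)
qed

text \<open>A union bound. The net for \<open>n\<close> has polynomially many points, and each has
  an empty \<open>low_region\<close> with probability at most \<open>exp\<close> of a constant minus
  a multiple of \<open>n powr \<epsilon>\<close>. So almost surely some \<open>n\<close> leaves no
  region empty, and \<open>low_region_neighbour\<close> turns this into a cover at a level below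
  \<open>b\<close>.\<close>

lemma AE_cover_bounded_heights:
  fixes \<eta> :: "'w \<Rightarrow> ('a::euclidean_space \<times> real) set" and R :: nat
  assumes \<eta>: "poisson_process M \<eta> (intensity f)" and f: "admissible DIM('a) {..<b} f"
  shows "AE \<omega> in M. \<exists>t<b. \<forall>w\<in>cball 0 (real R). \<exists>p\<in>\<eta> \<omega>. pow w p \<le> t"
proof -
  note D = admissibleD[OF f]
  let ?d = "DIM('a)"
  obtain \<epsilon> c :: real and n0 :: nat where \<epsilon>: "\<epsilon> > 0" and c: "0 \<le> c"
    and fin: "\<And>n. n > n0 \<Longrightarrow> n \<ge> 1 \<Longrightarrow> (\<integral>\<^sup>+h\<in>{b - 1..<b - 1 / real n}. ennreal (f h * sqrt (b - 1 / real n - h) ^ ?d) \<partial>lborel) < \<infinity>"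
    and grow: "\<And>n. n > n0 \<Longrightarrow> n \<ge> 1 \<Longrightarrow> Gamma (real ?d / 2 + 1) * real n powr \<epsilon> - c \<le>
      enn2real (\<integral>\<^sup>+h\<in>{b - 1..<b - 1 / real n}. ennreal (f h * sqrt (b - 1 / real n - h) ^ ?d) \<partial>lborel)"
    by (rule low_region_mass_growth[OF f]) (rule that)
  have "prob_space M" using \<eta> by (simp add: poisson_process_def point_process_def)
  then interpret prob_space M .
  let ?v = "unit_ball_vol (real ?d)" and ?G = "Gamma (real ?d / 2 + 1)"
  define V where "V u n = low_region u (b - 1) (b - 1 / real n)" for u :: 'a and n :: nat
  have V_fin: "emeasure (intensity f) (V u n) < \<infinity>" if "n > n0" "n \<ge> 1" for u n
    unfolding V_def emeasure_intensity_low_region[OF D(1,2)] using fin[OF that] by (simp add: ennreal_mult_less_top)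
  have V_mass: "?v * (?G * real n powr \<epsilon> - c) \<le> measure (intensity f) (V u n)" if "n > n0" "n \<ge> 1" for u n
    unfolding V_def measure_def emeasure_intensity_low_region[OF D(1,2)] enn2real_mult
    using grow[OF that] by (simp add: mult_left_mono)
  have net: "\<exists>F :: 'a set. finite F \<and> real (card F) \<le> (2 * real R * real (6 * n) * real ?d + 3) ^ ?d \<and>
      (\<forall>w\<in>cball 0 (real R). \<exists>u\<in>F. norm (w - u) \<le> 1 / real (6 * n))" if n: "n \<ge> 1" for n
  proof -
    have n6: "6 * n \<ge> 1" using n by simp
    obtain G :: "'a set" where G: "finite G" "real (card G) \<le> (2 * real R * real (6 * n) * real ?d + 3) ^ ?d"
      "\<And>w. w \<in> cball 0 (real R) \<Longrightarrow> \<exists>u\<in>G. norm (w - u) \<le> 1 / real (6 * n)"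
      by (rule lattice_net[OF n6, of R]) (rule that)
    show ?thesis by (intro exI[of _ G] conjI ballI G)
  qed
  have "\<forall>n::nat. \<exists>F :: 'a set. n \<ge> 1 \<longrightarrow> finite F \<and> real (card F) \<le> (2 * real R * real (6 * n) * real ?d + 3) ^ ?d \<and>
      (\<forall>w\<in>cball 0 (real R). \<exists>u\<in>F. norm (w - u) \<le> 1 / real (6 * n))"
    using net by blast
  from choice[OF this] obtain F :: "nat \<Rightarrow> 'a set" where F: "\<And>n. n \<ge> 1 \<Longrightarrow> finite (F n)"
    "\<And>n. n \<ge> 1 \<Longrightarrow> real (card (F n)) \<le> (2 * real R * real (6 * n) * real ?d + 3) ^ ?d"
    "\<And>n w. n \<ge> 1 \<Longrightarrow> w \<in> cball 0 (real R) \<Longrightarrow> \<exists>u\<in>F n. norm (w - u) \<le> 1 / real (6 * n)"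
    by blast
  \<comment> \<open>The shift by \<open>Suc n0\<close> makes the growth condition available for
    every index.\<close>
  define S where "S n = (\<Union>u\<in>F (n + Suc n0). {\<omega>\<in>space M. \<eta> \<omega> \<inter> V u (n + Suc n0) = {}})" for n
  have V_sets: "V u n \<in> sets borel" for u n unfolding V_def by (rule sets_low_region)
  have S_sets: "S n \<in> events" for n
    unfolding S_def using F(1) V_fin
    by (intro sets.finite_UN void_probability(1)[OF \<eta> V_sets]) auto
  \<comment> \<open>For \<open>m \<ge> 1\<close> the size bound of the net obeys
    \<open>2 * R * (6 * m) * d + 3 \<le> (12 * R * d + 3) * m\<close>.\<close>
  define K where "K = 12 * real R * real ?d + 3"
  have K: "0 \<le> K" by (simp add: K_def)
  have S_prob: "prob (S n) \<le> (K * real (n + Suc n0)) ^ ?d * exp (?v * c - ?v * ?G * real (n + Suc n0) powr \<epsilon>)" for n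
  proof -
    define m where "m = n + Suc n0"
    have m: "m > n0" "m \<ge> 1" by (auto simp: m_def)
    have "prob (S n) \<le> (\<Sum>u\<in>F m. prob {\<omega>\<in>space M. \<eta> \<omega> \<inter> V u m = {}})"
      unfolding S_def m_def[symmetric] using F(1)[OF m(2)] V_fin[OF m]
      by (intro measure_UNION_le void_probability(1)[OF \<eta> V_sets])
    also have "\<dots> \<le> (\<Sum>u\<in>F m. exp (?v * c - ?v * ?G * real m powr \<epsilon>))"
    proof (rule sum_mono)
      fix u
      show "prob {\<omega>\<in>space M. \<eta> \<omega> \<inter> V u m = {}} \<le> exp (?v * c - ?v * ?G * real m powr \<epsilon>)"
        unfolding void_probability(2)[OF \<eta> V_sets V_fin[OF m]]
        using V_mass[OF m, of u] by (simp add: algebra_simps)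
    qed
    also have "\<dots> = real (card (F m)) * exp (?v * c - ?v * ?G * real m powr \<epsilon>)" by simp
    also have "\<dots> \<le> (K * real m) ^ ?d * exp (?v * c - ?v * ?G * real m powr \<epsilon>)"
    proof (rule mult_right_mono)
      have "real (card (F m)) \<le> (2 * real R * real (6 * m) * real ?d + 3) ^ ?d" by (rule F(2)[OF m(2)])
      also have "\<dots> \<le> (K * real m) ^ ?d"
        using m(2) by (intro power_mono) (auto simp: K_def algebra_simps)
      finally show "real (card (F m)) \<le> (K * real m) ^ ?d" .
    qed simp
    finally show ?thesis by (simp add: m_def)
  qed
  have lim: "(\<lambda>n. prob (S n)) \<longlonglongrightarrow> 0"
  proof (rule tendsto_sandwich[OF _ _ tendsto_const])
    show "\<forall>\<^sub>F n in sequentially. 0 \<le> prob (S n)" by simp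
    show "\<forall>\<^sub>F n in sequentially. prob (S n) \<le>
        (K * real (n + Suc n0)) ^ ?d * exp (?v * c - ?v * ?G * real (n + Suc n0) powr \<epsilon>)"
      by (intro always_eventually allI S_prob)
    have "(\<lambda>n::nat. (K * real n) ^ ?d * exp (?v * c - (?v * ?G) * real n powr \<epsilon>)) \<longlonglongrightarrow> 0"
      using Gamma_half_dimension_pos[of ?d] \<epsilon> by (intro tendsto_power_times_exp_neg_powr) (auto intro!: mult_pos_pos)
    then show "(\<lambda>n. (K * real (n + Suc n0)) ^ ?d * exp (?v * c - ?v * ?G * real (n + Suc n0) powr \<epsilon>)) \<longlonglongrightarrow> 0"
      by (rule LIMSEQ_ignore_initial_segment)
  qed
  have "AE \<omega> in M. \<exists>n. \<omega> \<notin> S n"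
    by (rule AE_ex_not_in_vanishing[OF _ S_sets lim]) unfold_locales
  then show ?thesis
    using AE_space
  proof eventually_elim
    case (elim \<omega>)
    then obtain n where n: "\<omega> \<notin> S n" by blast
    define m where "m = n + Suc n0"
    have m: "m \<ge> 1" by (simp add: m_def)
    have "\<exists>p\<in>\<eta> \<omega>. pow w p \<le> b - 1 / (2 * real m)" if w: "w \<in> cball 0 (real R)" for w
    proof -
      obtain u where u: "u \<in> F m" "norm (w - u) \<le> 1 / (6 * real m)" using F(3)[OF m w] by auto
      have "\<eta> \<omega> \<inter> V u m \<noteq> {}" using n u(1) elim(2) by (auto simp: S_def m_def)
      then obtain p where "p \<in> \<eta> \<omega>" "p \<in> V u m" by blast
      then show ?thesis using low_region_neighbour[OF m u(2)] unfolding V_def by blast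
    qed
    moreover have "b - 1 / (2 * real m) < b" using m by simp
    ultimately show ?case by blast
  qed
qed

lemma admissible_heights:
  assumes f: "admissible d E f"
  obtains T :: "nat \<Rightarrow> real" where "incseq T" "\<And>k. T k \<in> E" "\<And>t. t \<in> E \<Longrightarrow> \<exists>k. t \<le> T k"
proof -
  consider a where "E = {a..}" | b where "E = {..<b}" | "E = UNIV" using admissibleD(4)[OF f] by blast
  then show thesis
  proof cases
    case 1
    have "\<exists>k::nat. t \<le> a + real k" for t using real_arch_simple[of "t - a"] by (auto simp: algebra_simps)
    then show ?thesis using 1 by (intro that[of "\<lambda>k. a + real k"]) (auto simp: incseq_def)
  next
    case 2
    have "\<exists>k::nat. t \<le> b - 1 / real (Suc k)" if tb: "t < b" for t
    proof -
      have "0 < b - t" using tb by simp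
      then obtain k where "1 / real (Suc k) < b - t" by (rule nat_approx_posE)
      then show ?thesis by (intro exI[of _ k]) linarith
    qed
    moreover have "incseq (\<lambda>k. b - 1 / real (Suc k))"
      by (auto simp: incseq_def intro!: divide_left_mono)
    ultimately show ?thesis using 2 by (intro that[of "\<lambda>k. b - 1 / real (Suc k)"]) auto
  next
    case 3
    then show ?thesis by (intro that[of real]) (auto simp: incseq_def intro: real_arch_simple)
  qed
qed

text \<open>Otherwise \<open>f\<close> would vanish almost everywhere, since the levels
  \<open>T k\<close> are cofinal in \<open>E\<close>, and the intensity would be trivial. The level
  found here is the one used for the orthants.\<close>

lemma nontrivial_mass_below:
  assumes f: "admissible d E f" and nt: "emeasure (intensity f :: ('a::euclidean_space \<times> real) measure) (cbox 0 One \<times> UNIV) > 0"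
    and T: "\<And>t. t \<in> E \<Longrightarrow> \<exists>k::nat. t \<le> T k"
  shows "\<exists>k. (\<integral>\<^sup>+h\<in>{..T k}. ennreal (f h) \<partial>lborel) > 0"
proof (rule ccontr)
  note D = admissibleD[OF f]
  note D(1) [measurable]
  assume "\<not> ?thesis"
  then have "(\<integral>\<^sup>+h\<in>{..T k}. ennreal (f h) \<partial>lborel) = 0" for k by (simp add: not_gr_zero)
  then have "AE h in lborel. ennreal (f h) * indicator {..T k} h = 0" for k
    by (subst (asm) nn_integral_0_iff_AE) auto
  then have "AE h in lborel. \<forall>k. ennreal (f h) * indicator {..T k} h = 0"
    unfolding AE_all_countable by (rule allI)
  then have ae: "AE h in lborel. ennreal (f h) = 0"
  proof eventually_elim
    case (elim h)
    show ?case
    proof (cases "h \<in> E")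
      case True
      then obtain k where "h \<le> T k" using T by blast
      then show ?thesis using elim[rule_format, of k] by simp
    qed (simp add: D(3))
  qed
  have B: "(cbox 0 One \<times> UNIV :: ('a \<times> real) set) \<in> sets borel"
    by (intro borel_closed closed_Times) auto
  have "emeasure (intensity f) (cbox 0 One \<times> UNIV :: ('a \<times> real) set) =
      (\<integral>\<^sup>+h. ennreal (f h) * emeasure lborel {v. (v, h) \<in> (cbox 0 One \<times> UNIV :: ('a \<times> real) set)} \<partial>lborel)"
    by (rule emeasure_intensity_sections[OF D(1) B])
  also have "\<dots> = (\<integral>\<^sup>+h. 0 \<partial>(lborel :: real measure))"
    by (rule nn_integral_cong_AE) (use ae in \<open>auto elim: AE_mp\<close>)
  finally show False using nt by simp
qed

text \<open>Finiteness and the orthants follow from finite and infinite intensity. For the cover, if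
  \<open>E\<close> is unbounded above, a single point of the process covers every ball at some level
  of \<open>E\<close>; the growth condition enters for \<open>E = {..<b}\<close>.\<close>

lemma AE_well_spread:
  fixes \<eta> :: "'w \<Rightarrow> ('a::euclidean_space \<times> real) set"
  assumes \<eta>: "poisson_process M \<eta> (intensity f)" and f: "admissible DIM('a) E f"
    and nt: "emeasure (intensity f :: ('a \<times> real) measure) (cbox 0 One \<times> UNIV) > 0"
    and T: "incseq T" "\<And>k. T k \<in> E" "\<And>t. t \<in> E \<Longrightarrow> \<exists>k. t \<le> T k"
  shows "AE \<omega> in M. well_spread T (\<eta> \<omega>)"
proof -
  note D = admissibleD[OF f]
  have "AE \<omega> in M. finite (\<eta> \<omega> \<inter> influence_region (real k) (T k))" for k :: nat
    by (rule AE_finite_of_poisson_process[OF \<eta>])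
      (auto intro!: sets_influence_region admissible_intensity_finite[OF f T(2), unfolded infinity_ennreal_def])
  then have fin: "AE \<omega> in M. \<forall>k::nat. finite (\<eta> \<omega> \<inter> influence_region (real k) (T k))"
    by (simp add: AE_all_countable)
  obtain k0 where k0: "(\<integral>\<^sup>+h\<in>{..T k0}. ennreal (f h) \<partial>lborel) > 0"
    using nontrivial_mass_below[OF f nt T(3)] by blast
  note orth = AE_orthants[OF \<eta> D(1) k0]
  have cover: "AE \<omega> in M. \<forall>R::nat. \<exists>t\<in>E. \<forall>w\<in>cball 0 (real R). \<exists>p\<in>\<eta> \<omega>. pow w p \<le> t"
  proof (cases "\<exists>b. E = {..<b}")
    case True
    then obtain b where b: "E = {..<b}" by blast
    have "AE \<omega> in M. \<exists>t<b. \<forall>w\<in>cball 0 (real R). \<exists>p\<in>\<eta> \<omega>. pow w p \<le> t" for R :: nat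
      by (rule AE_cover_bounded_heights[OF \<eta> f[unfolded b]])
    then show ?thesis unfolding b by (simp add: AE_all_countable Bex_def)
  next
    case False
    then have E: "\<exists>t'\<in>E. t \<le> t'" for t
    proof -
      consider a where "E = {a..}" | "E = UNIV" using D(4) False by blast
      then show ?thesis
      proof cases
        case 1
        then show ?thesis by (intro bexI[of _ "max t a"]) auto
      qed auto
    qed
    show ?thesis using orth
    proof eventually_elim
      case (elim \<omega>)
      then obtain p where p: "p \<in> \<eta> \<omega>" by blast
      show ?case
      proof
        fix R :: nat
        obtain t where t: "t \<in> E" "(real R + norm (fst p))\<^sup>2 + snd p \<le> t" using E by blast
        have "pow w p \<le> t" if "w \<in> cball 0 (real R)" for w
        proof -
          have "norm (w - fst p) \<le> real R + norm (fst p)"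
            using that norm_triangle_ineq4[of w "fst p"] by simp
          then have "(norm (w - fst p))\<^sup>2 \<le> (real R + norm (fst p))\<^sup>2" by (intro power_mono) auto
          then show ?thesis using t(2) unfolding pow_def by linarith
        qed
        then show "\<exists>t\<in>E. \<forall>w\<in>cball 0 (real R). \<exists>p\<in>\<eta> \<omega>. pow w p \<le> t" using p t(1) by blast
      qed
    qed
  qed
  show ?thesis using fin orth cover
  proof eventually_elim
    case (elim \<omega>)
    have "\<exists>k. \<forall>w\<in>cball 0 R. \<exists>p\<in>\<eta> \<omega>. pow w p \<le> T k" for R
    proof -
      obtain R' :: nat where R': "R \<le> real R'" using real_arch_simple by blast
      obtain t where t: "t \<in> E" "\<forall>w\<in>cball 0 (real R'). \<exists>p\<in>\<eta> \<omega>. pow w p \<le> t" using elim(3) by blast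
      obtain k where "t \<le> T k" using T(3)[OF t(1)] by blast
      have "\<exists>p\<in>\<eta> \<omega>. pow w p \<le> T k" if "w \<in> cball 0 R" for w
      proof -
        have "w \<in> cball 0 (real R')" using that R' by simp
        then obtain p where "p \<in> \<eta> \<omega>" "pow w p \<le> t" using t(2) by blast
        then show ?thesis using \<open>t \<le> T k\<close> by (intro bexI[of _ p]) auto
      qed
      then show ?thesis by blast
    qed
    then show ?case using elim(1,2) unfolding well_spread_def by blast
  qed
qed

subsection \<open>Convergence of the coupled skeletons\<close>

text \<open>A property that holds almost surely need not define a measurable set; removing a
  measurable null set that contains all exceptions gives an event.\<close>

lemma AE_obtain_set:
  assumes "AE \<omega> in M. Q \<omega>"
  obtains G where "G \<in> sets M" "AE \<omega> in M. \<omega> \<in> G" "\<And>\<omega>. \<omega> \<in> G \<Longrightarrow> Q \<omega>"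
proof -
  obtain N where N: "{\<omega> \<in> space M. \<not> Q \<omega>} \<subseteq> N" "emeasure M N = 0" "N \<in> sets M"
    using AE_E[OF assms] by blast
  show thesis
  proof (rule that[of "space M - N"])
    show "space M - N \<in> sets M" using N(3) by auto
    have "AE \<omega> in M. \<omega> \<notin> N" using N by (intro AE_not_in) (auto simp: null_sets_def)
    then show "AE \<omega> in M. \<omega> \<in> space M - N" using AE_space by eventually_elim auto
    show "\<And>\<omega>. \<omega> \<in> space M - N \<Longrightarrow> Q \<omega>" using N(1) by auto
  qed
qed

text \<open>The good events need not be measurable: along a subsequence on which the probabilities of the
  exceptional events are summable, Borel-Cantelli applies pointwise.\<close>

lemma tendsto_prob_if_eventually_dominated:
  assumes "prob_space P" and B: "\<And>n. B n \<in> sets P" and D: "\<And>n k. D n k \<in> sets P"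
    and lim: "\<And>k. (\<lambda>n. measure P (D n k)) \<longlonglongrightarrow> 0"
    and dom: "AE \<omega> in P. \<exists>k0::nat. \<forall>k\<ge>k0. \<forall>n::nat. \<omega> \<in> B n \<longrightarrow> \<omega> \<in> D n k"
  shows "(\<lambda>n. measure P (B n)) \<longlonglongrightarrow> 0"
proof (rule ccontr)
  interpret prob_space P by fact
  assume "\<not> (\<lambda>n. prob (B n)) \<longlonglongrightarrow> 0"
  then obtain e where e: "e > 0" "\<And>N. \<exists>n\<ge>N. e \<le> prob (B n)"
    by (auto simp: LIMSEQ_iff not_less)
  have "\<exists>n. e \<le> prob (B n) \<and> prob (D n k) < (1 / 2) ^ k" for k
  proof -
    have "\<forall>\<^sub>F n in sequentially. prob (D n k) < (1 / 2) ^ k"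
      using lim[of k] by (intro order_tendstoD) auto
    then obtain N where "\<And>n. n \<ge> N \<Longrightarrow> prob (D n k) < (1 / 2) ^ k" by (auto simp: eventually_sequentially)
    then show ?thesis using e(2)[of N] by blast
  qed
  then have "\<forall>k. \<exists>n. e \<le> prob (B n) \<and> prob (D n k) < (1 / 2) ^ k" by blast
  from choice[OF this] obtain r where r: "\<And>k. e \<le> prob (B (r k))" "\<And>k. prob (D (r k) k) < (1 / 2) ^ k" by blast
  have "summable (\<lambda>k. prob (D (r k) k))"
    by (rule summable_comparison_test'[where g = "\<lambda>k. (1 / 2) ^ k" and N = 0])
      (use r(2) in \<open>auto intro: less_imp_le\<close>)
  then have "AE \<omega> in P. \<forall>\<^sub>F k in sequentially. \<omega> \<in> space P - D (r k) k"
    using D by (intro borel_cantelli_AE1) (auto simp: emeasure_eq_measure)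
  then have AE: "AE \<omega> in P. \<exists>m. \<forall>k\<ge>m. \<omega> \<notin> B (r k)"
    using dom
  proof eventually_elim
    case (elim \<omega>)
    obtain m where m: "\<And>k. k \<ge> m \<Longrightarrow> \<omega> \<notin> D (r k) k" using elim(1) by (auto simp: eventually_sequentially)
    obtain k0 where k0: "\<And>k n. k \<ge> k0 \<Longrightarrow> \<omega> \<in> B n \<Longrightarrow> \<omega> \<in> D n k" using elim(2) by blast
    have "\<omega> \<notin> B (r k)" if "k \<ge> max m k0" for k using m[of k] k0[of k "r k"] that by auto
    then show ?case by blast
  qed
  \<comment> \<open>The decreasing sets \<open>S m\<close> contain \<open>B (r m)\<close> and so
    keep probability at least \<open>e\<close>, yet almost every \<open>\<omega>\<close> eventually
    leaves them.\<close>
  define S where "S m = (\<Union>k\<in>{m..}. B (r k))" for m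
  have S: "S m \<in> events" for m using B by (auto simp: S_def)
  have "(\<lambda>m. prob (S m)) \<longlonglongrightarrow> prob (\<Inter>m. S m)"
  proof (rule finite_Lim_measure_decseq)
    show "decseq S" unfolding decseq_def S_def by (intro allI impI UN_mono) auto
  qed (use S in auto)
  moreover have "prob (\<Inter>m. S m) = 0"
  proof -
    have "AE \<omega> in P. \<omega> \<notin> (\<Inter>m. S m)" using AE by eventually_elim (auto simp: S_def)
    then show ?thesis using S by (subst prob_eq_0) auto
  qed
  moreover have "e \<le> prob (S m)" for m
  proof -
    have "e \<le> prob (B (r m))" by (rule r(1))
    also have "\<dots> \<le> prob (S m)" using S by (intro finite_measure_mono) (auto simp: S_def)
    finally show ?thesis .
  qed
  ultimately have "e \<le> 0" by (intro LIMSEQ_le_const[of "\<lambda>m. prob (S m)"]) auto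
  then show False using e(1) by simp
qed

text \<open>The probability of at least one point is \<open>1 - exp (- measure \<Lambda> B)\<close>,
  which is at most the mean.\<close>

lemma prob_hit_le_measure:
  assumes counts: "poisson_counts P (\<lambda>B \<omega>. \<Sum>k. if act k \<omega> \<and> x k \<omega> \<in> B then 1 else 0) \<Lambda>"
    and B: "B \<in> sets borel" and fin: "emeasure \<Lambda> B < \<infinity>"
  shows "{\<omega>\<in>space P. \<exists>k. act k \<omega> \<and> x k \<omega> \<in> B} \<in> sets P"
    "measure P {\<omega>\<in>space P. \<exists>k. act k \<omega> \<and> x k \<omega> \<in> B} \<le> measure \<Lambda> B"
proof -
  note D = poisson_countsD[OF counts]
  interpret prob_space P by (rule D(1))
  let ?N = "\<lambda>\<omega>. \<Sum>k. if act k \<omega> \<and> x k \<omega> \<in> B then 1 else 0 :: ennreal"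
  have N0: "(\<exists>k. act k \<omega> \<and> x k \<omega> \<in> B) \<longleftrightarrow> ?N \<omega> \<noteq> of_nat 0" for \<omega>
  proof
    assume "\<exists>k. act k \<omega> \<and> x k \<omega> \<in> B"
    then obtain k where k: "act k \<omega> \<and> x k \<omega> \<in> B" by blast
    have "(\<Sum>k\<in>{k}. if act k \<omega> \<and> x k \<omega> \<in> B then 1 else 0 :: ennreal) \<le> ?N \<omega>"
      by (intro sum_le_suminf) auto
    then show "?N \<omega> \<noteq> of_nat 0" using k by auto
  next
    assume "?N \<omega> \<noteq> of_nat 0"
    then show "\<exists>k. act k \<omega> \<and> x k \<omega> \<in> B"
    proof (rule contrapos_np)
      assume "\<not> (\<exists>k. act k \<omega> \<and> x k \<omega> \<in> B)"
      then have "(\<lambda>k. if act k \<omega> \<and> x k \<omega> \<in> B then 1 else 0 :: ennreal) = (\<lambda>_. 0)" by auto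
      then show "?N \<omega> = of_nat 0" by simp
    qed
  qed
  have [measurable]: "?N \<in> borel_measurable P" using D(2)[OF B] .
  show "{\<omega>\<in>space P. \<exists>k. act k \<omega> \<and> x k \<omega> \<in> B} \<in> sets P"
    unfolding N0 by measurable
  have "prob {\<omega>\<in>space P. \<exists>k. act k \<omega> \<and> x k \<omega> \<in> B} = prob (space P - {\<omega>\<in>space P. ?N \<omega> = of_nat 0})"
    unfolding N0 by (intro arg_cong[where f = prob]) auto
  also have "\<dots> = 1 - prob {\<omega>\<in>space P. ?N \<omega> = of_nat 0}" by (intro prob_compl) measurable
  also have "\<dots> = 1 - exp (- measure \<Lambda> B)" using D(3)[OF B fin, of 0] by (simp add: poisson_density_def)
  also have "\<dots> \<le> measure \<Lambda> B" using exp_ge_add_one_self[of "- measure \<Lambda> B"] by simp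
  finally show "prob {\<omega>\<in>space P. \<exists>k. act k \<omega> \<and> x k \<omega> \<in> B} \<le> measure \<Lambda> B" .
qed

definition hypograph_difference :: "(real \<Rightarrow> real) \<Rightarrow> (real \<Rightarrow> real) \<Rightarrow> ('a::euclidean_space \<times> real) set \<Rightarrow>
    (('a \<times> real) \<times> real) set" where
  "hypograph_difference f g W = {q. fst q \<in> W \<and> (q \<in> hypograph f \<longleftrightarrow> q \<notin> hypograph g)}"

lemma sets_hypograph_difference:
  assumes "f \<in> borel_measurable borel" "g \<in> borel_measurable borel" "W \<in> sets borel"
  shows "hypograph_difference f g W \<in> sets borel"
proof -
  have "fst -` W \<inter> space borel \<in> sets borel" by (rule measurable_sets[OF measurable_fst_borel assms(3)])
  then have "(fst -` W \<inter> space borel) \<inter> ((hypograph f - hypograph g) \<union> (hypograph g - hypograph f)) \<in> sets borel"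
    using sets_hypograph[OF assms(1), where 'a = 'a] sets_hypograph[OF assms(2), where 'a = 'a] by blast
  moreover have "hypograph_difference f g W = (fst -` W \<inter> space borel) \<inter> ((hypograph f - hypograph g) \<union> (hypograph g - hypograph f))"
    by (auto simp: hypograph_difference_def)
  ultimately show ?thesis by simp
qed

text \<open>Over a point of the region the fibre is the interval between the smaller and the larger
  of the two densities, so its length is their distance at that height.\<close>

lemma emeasure_hypograph_difference:
  fixes R T :: real
  assumes f: "f \<in> borel_measurable borel" "\<And>h. 0 \<le> f h" and g: "g \<in> borel_measurable borel" "\<And>h. 0 \<le> g h"
    and R: "0 \<le> R"
  shows "emeasure lborel (hypograph_difference f g (influence_region R T :: ('a::euclidean_space \<times> real) set)) \<le>
    (\<integral>\<^sup>+h. ennreal \<bar>f h - g h\<bar> * ennreal (region_volume DIM('a) R T h) \<partial>lborel)"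
proof -
  let ?W = "influence_region R T :: ('a \<times> real) set"
  note f(1) [measurable] g(1) [measurable]
  have "emeasure lborel (hypograph_difference f g ?W) =
      (\<integral>\<^sup>+p. emeasure lborel {t. (p, t) \<in> hypograph_difference f g ?W} \<partial>lborel)"
    by (intro emeasure_lborel_sections sets_hypograph_difference f g sets_influence_region R)
  also have "\<dots> = (\<integral>\<^sup>+p. ennreal \<bar>f (snd p) - g (snd p)\<bar> * indicator ?W p \<partial>lborel)"
  proof (rule nn_integral_cong)
    fix p :: "'a \<times> real"
    have "{t. (p, t) \<in> hypograph_difference f g ?W} =
        (if p \<in> ?W then {min (f (snd p)) (g (snd p))..<max (f (snd p)) (g (snd p))} else {})"
      using f(2)[of "snd p"] g(2)[of "snd p"] by (auto simp: hypograph_difference_def hypograph_def)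
    then show "emeasure lborel {t. (p, t) \<in> hypograph_difference f g ?W} = ennreal \<bar>f (snd p) - g (snd p)\<bar> * indicator ?W p"
      by (auto simp: max_def min_def)
  qed
  also have "\<dots> \<le> (\<integral>\<^sup>+h. ennreal \<bar>f h - g h\<bar> * ennreal (region_volume DIM('a) R T h) \<partial>lborel)"
    using nn_integral_influence_region_le[of "\<lambda>h. ennreal \<bar>f h - g h\<bar>", OF _ R, where 'a = 'a] by simp
  finally show ?thesis .
qed

text \<open>Configurations are made empty outside the good event, and the skeletons are then closed
  there as well.\<close>

lemma skel_empty: "skel (laguerre {}) = {}" "skel (dual_laguerre ({} :: ('a::euclidean_space \<times> real) set)) = {}"
proof -
  show "skel (laguerre {}) = {}" by (simp add: skel_def laguerre_def)
  have "dual_laguerre ({} :: ('a \<times> real) set) = {}" by (auto simp: dual_laguerre_def)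
  then show "skel (dual_laguerre ({} :: ('a \<times> real) set)) = {}" by (simp add: skel_def)
qed

theorem theorem3p3:
  fixes f :: "real \<Rightarrow> real" and fs :: "nat \<Rightarrow> real \<Rightarrow> real"
    and E :: "real set" and Es :: "nat \<Rightarrow> real set"
    and x0 \<delta> :: real
    and N :: "'u measure" and \<eta> :: "'u \<Rightarrow> ('a::euclidean_space \<times> real) set"
    and Ns :: "nat \<Rightarrow> 'w measure" and \<eta>s :: "nat \<Rightarrow> 'w \<Rightarrow> ('a \<times> real) set"
  assumes dim: "DIM('a) \<ge> 2"
    and adm_fs: "\<And>n. admissible (DIM('a)) (Es n) (fs n)"
    and Es: "incseq Es" "(\<Union>n. Es n) = E"
    and adm_f: "admissible (DIM('a)) E f"
    and f_pos: "frac_integral 1 f (1/2) > 0"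
    and conv: "\<And>x. x \<in> E \<Longrightarrow>
          (\<lambda>n. \<integral>\<^sup>+h\<in>{..x}. ennreal \<bar>fs n h - f h\<bar> \<partial>lborel) \<longlonglongrightarrow> 0"
    and delta: "\<delta> > 0"
    and moment: "(SUP n. \<integral>\<^sup>+h\<in>{..x0}. ennreal (\<bar>h\<bar> powr (real DIM('a) / 2 + \<delta>) * fs n h) \<partial>lborel) < \<infinity>"
    and nontrivial_fs:
          "\<And>n. emeasure (intensity (fs n) :: ('a \<times> real) measure) (cbox 0 One \<times> UNIV) > 0"
    and nontrivial_f: "emeasure (intensity f :: ('a \<times> real) measure) (cbox 0 One \<times> UNIV) > 0"
    and poisson_\<eta>s: "\<And>n. poisson_process (Ns n) (\<eta>s n) (intensity (fs n))"
    and poisson_\<eta>: "poisson_process N \<eta> (intensity f)"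
  shows "\<exists>(P :: (nat \<Rightarrow> real) measure) \<eta>t \<eta>ts.
      prob_space P \<and> point_process P \<eta>t \<and> (\<forall>n. point_process P (\<eta>ts n)) \<and>
      same_law P \<eta>t N \<eta> \<and> (\<forall>n. same_law P (\<eta>ts n) (Ns n) (\<eta>s n)) \<and>
      converges_locally_whp P (\<lambda>n \<omega>. skel (laguerre (\<eta>ts n \<omega>))) (\<lambda>\<omega>. skel (laguerre (\<eta>t \<omega>))) \<and>
      converges_locally_whp P (\<lambda>n \<omega>. skel (dual_laguerre (\<eta>ts n \<omega>)))
        (\<lambda>\<omega>. skel (dual_laguerre (\<eta>t \<omega>)))"
proof -
  note Df = admissibleD[OF adm_f] and Dfs = admissibleD[OF adm_fs]
  obtain P :: "(nat \<Rightarrow> real) measure" and act and x :: "nat \<Rightarrow> (nat \<Rightarrow> real) \<Rightarrow> ('a \<times> real) \<times> real"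
    where P: "prob_space P" and act: "\<And>k. Measurable.pred P (act k)" and x: "\<And>k. x k \<in> borel_measurable P"
      and counts: "poisson_counts P (\<lambda>B \<omega>. \<Sum>k. if act k \<omega> \<and> x k \<omega> \<in> B then 1 else 0) lborel"
      and inj: "AE \<omega> in P. inj (\<lambda>k. fst (x k \<omega>))"
    by (rule poisson_enumeration_lborel[OF measurable_fst_borel emeasure_lborel_fst_fibre]) (rule that)
  interpret P: prob_space P by (rule P)
  obtain T :: "nat \<Rightarrow> real" where T: "incseq T" "\<And>k. T k \<in> E" "\<And>t. t \<in> E \<Longrightarrow> \<exists>k. t \<le> T k"
    by (rule admissible_heights[OF adm_f]) (rule that)
  have "\<exists>T::nat \<Rightarrow> real. incseq T \<and> (\<forall>k. T k \<in> Es n) \<and> (\<forall>t\<in>Es n. \<exists>k. t \<le> T k)" for n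
  proof -
    obtain T :: "nat \<Rightarrow> real" where "incseq T" "\<And>k. T k \<in> Es n" "\<And>t. t \<in> Es n \<Longrightarrow> \<exists>k. t \<le> T k"
      by (rule admissible_heights[OF adm_fs[of n]]) (rule that)
    then show ?thesis by blast
  qed
  then have "\<forall>n. \<exists>T::nat \<Rightarrow> real. incseq T \<and> (\<forall>k. T k \<in> Es n) \<and> (\<forall>t\<in>Es n. \<exists>k. t \<le> T k)" by blast
  from choice[OF this] obtain Ts :: "nat \<Rightarrow> nat \<Rightarrow> real"
    where Ts: "\<And>n. incseq (Ts n)" "\<And>n k. Ts n k \<in> Es n" "\<And>n t. t \<in> Es n \<Longrightarrow> \<exists>k. t \<le> Ts n k" by blast
  \<comment> \<open>All processes share the same points; only the hypograph depends on the density.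
    The event \<open>G\<close> is a parameter because the good event is found in two passes.\<close>
  define A where "A G g = active_points (\<lambda>k \<omega>. act k \<omega> \<and> x k \<omega> \<in> hypograph g \<and> \<omega> \<in> G) (\<lambda>k \<omega>. fst (x k \<omega>))"
    for G :: "(nat \<Rightarrow> real) set" and g
  have pp: "poisson_process P (A G g) (intensity g)"
    if "G \<in> sets P" "AE \<omega> in P. \<omega> \<in> G" "\<And>\<omega>. \<omega> \<in> G \<Longrightarrow> inj (\<lambda>k. fst (x k \<omega>))" "g \<in> borel_measurable borel" for G g
    unfolding A_def by (rule thinned_poisson_process[OF P act x counts that])
  \<comment> \<open>The first pass secures distinct points, which makes the thinnings Poisson
    processes. Only then are their configurations known to be almost surely well spread, and the
    event on which this holds, a part of \<open>G1\<close>, becomes \<open>G\<close>.\<close>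
  obtain G1 where G1: "G1 \<in> sets P" "AE \<omega> in P. \<omega> \<in> G1" "\<And>\<omega>. \<omega> \<in> G1 \<Longrightarrow> inj (\<lambda>k. fst (x k \<omega>))"
    by (rule AE_obtain_set[OF inj]) (rule that)
  have "AE \<omega> in P. well_spread T (A G1 f \<omega>)"
    by (rule AE_well_spread[OF pp[OF G1 Df(1)] adm_f nontrivial_f T])
  \<comment> \<open>For the approximating processes spreading serves to make their skeletons closed;
    the local agreement rests on the limit process alone.\<close>
  moreover have "AE \<omega> in P. \<forall>n. well_spread (Ts n) (A G1 (fs n) \<omega>)"
    unfolding AE_all_countable
    by (intro allI AE_well_spread[OF pp[OF G1 Dfs(1)] adm_fs nontrivial_fs Ts])
  ultimately have "AE \<omega> in P. \<omega> \<in> G1 \<and> well_spread T (A G1 f \<omega>) \<and> (\<forall>n. well_spread (Ts n) (A G1 (fs n) \<omega>))"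
    using G1(2) by eventually_elim auto
  note good = this
  obtain G where G: "G \<in> sets P" "AE \<omega> in P. \<omega> \<in> G" and
    G_good: "\<And>\<omega>. \<omega> \<in> G \<Longrightarrow> \<omega> \<in> G1 \<and> well_spread T (A G1 f \<omega>) \<and> (\<forall>n. well_spread (Ts n) (A G1 (fs n) \<omega>))"
    by (rule AE_obtain_set[OF good]) (rule that)
  have GG1: "\<And>\<omega>. \<omega> \<in> G \<Longrightarrow> \<omega> \<in> G1" and ws1: "\<And>\<omega>. \<omega> \<in> G \<Longrightarrow> well_spread T (A G1 f \<omega>)"
      "\<And>\<omega> n. \<omega> \<in> G \<Longrightarrow> well_spread (Ts n) (A G1 (fs n) \<omega>)" using G_good by blast+
  have A_G: "A G g \<omega> = A G1 g \<omega>" if "\<omega> \<in> G" for g \<omega>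
    using that GG1 by (auto simp: A_def active_points_def)
  have A_notG: "A G g \<omega> = {}" if "\<omega> \<notin> G" for g \<omega>
    using that by (auto simp: A_def active_points_def)
  have ws: "well_spread T (A G f \<omega>)" "well_spread (Ts n) (A G (fs n) \<omega>)" if "\<omega> \<in> G" for \<omega> n
    using ws1 A_G that by simp_all
  have Ginj: "inj (\<lambda>k. fst (x k \<omega>))" if "\<omega> \<in> G" for \<omega> using G1(3) GG1 that by blast
  have ppG: "poisson_process P (A G g) (intensity g)" if "g \<in> borel_measurable borel" for g
    by (rule pp[OF G Ginj that])
  have law: "same_law P (A G g) M \<xi>" if "poisson_process M \<xi> (intensity g)" "g \<in> borel_measurable borel"
    for g and M :: "'v measure" and \<xi> :: "'v \<Rightarrow> ('a \<times> real) set"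
    using ppG[OF that(2)] that(1)
    by (intro poisson_process_same_law) (auto simp: poisson_process_iff_counts point_process_def)

  let ?W = "\<lambda>k::nat. influence_region (real k) (T k) :: ('a \<times> real) set"
  define \<Delta> where "\<Delta> n k = hypograph_difference (fs n) f (?W k)" for n k
  have \<Delta>_sets: "\<Delta> n k \<in> sets borel" for n k
    unfolding \<Delta>_def by (intro sets_hypograph_difference Df(1) Dfs(1) sets_influence_region) simp
  have \<Delta>_lim: "(\<lambda>n. emeasure lborel (\<Delta> n k)) \<longlonglongrightarrow> 0" for k
  proof (rule tendsto_sandwich[OF _ _ tendsto_const])
    show "(\<lambda>n. \<integral>\<^sup>+h. ennreal \<bar>fs n h - f h\<bar> * ennreal (region_volume DIM('a) (real k) (T k) h) \<partial>lborel) \<longlonglongrightarrow> 0"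
      by (rule weighted_L1_convergence[OF adm_f adm_fs T(2) _ conv[OF T(2)] delta moment]) simp
    show "\<forall>\<^sub>F n in sequentially. emeasure lborel (\<Delta> n k) \<le>
        (\<integral>\<^sup>+h. ennreal \<bar>fs n h - f h\<bar> * ennreal (region_volume DIM('a) (real k) (T k) h) \<partial>lborel)"
      unfolding \<Delta>_def by (intro always_eventually allI emeasure_hypograph_difference Df(1,2) Dfs(1,2)) simp
  qed simp
  define D where "D n k = {\<omega>\<in>space P. \<exists>j. act j \<omega> \<and> x j \<omega> \<in> \<Delta> n k}" for n k
  have D_sets: "D n k \<in> sets P" for n k
  proof -
    note act [measurable] x [measurable] \<Delta>_sets [measurable]
    show ?thesis unfolding D_def by measurable
  qed
  have D_lim: "(\<lambda>n. measure P (D n k)) \<longlonglongrightarrow> 0" for k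
  proof (rule tendsto_sandwich[OF _ _ tendsto_const])
    show "(\<lambda>n. measure lborel (\<Delta> n k)) \<longlonglongrightarrow> 0"
      unfolding measure_def using \<Delta>_lim[of k] by (intro tendsto_enn2real) simp_all
    have "\<forall>\<^sub>F n in sequentially. emeasure lborel (\<Delta> n k) < \<infinity>"
      using \<Delta>_lim[of k] by (intro order_tendstoD) auto
    then show "\<forall>\<^sub>F n in sequentially. measure P (D n k) \<le> measure lborel (\<Delta> n k)"
      by eventually_elim (use prob_hit_le_measure(2)[OF counts \<Delta>_sets] in \<open>simp add: D_def\<close>)
  qed simp
  have agree: "A G (fs n) \<omega> \<inter> ?W k = A G f \<omega> \<inter> ?W k" if "\<omega> \<in> G" "\<omega> \<in> space P" "\<omega> \<notin> D n k" for \<omega> n k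
  proof -
    have "x j \<omega> \<in> hypograph (fs n) \<longleftrightarrow> x j \<omega> \<in> hypograph f" if "act j \<omega>" "fst (x j \<omega>) \<in> ?W k" for j
      using that \<open>\<omega> \<notin> D n k\<close> \<open>\<omega> \<in> space P\<close> by (auto simp: D_def \<Delta>_def hypograph_difference_def)
    then show ?thesis by (auto simp: A_def active_points_def)
  qed

  \<comment> \<open>The argument is the same for both skeletons, so it is carried out for any map
    \<open>S\<close> that is closed on well spread sets, empty on the empty set, has measurable
    hitting events and is determined locally at all large levels.\<close>
  have whp: "converges_locally_whp P (\<lambda>n \<omega>. S (A G (fs n) \<omega>)) (\<lambda>\<omega>. S (A G f \<omega>))"
    if cl: "\<And>A T. well_spread T A \<Longrightarrow> incseq T \<Longrightarrow> closed (S A)" and S0: "S {} = {}"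
      and hit: "\<And>g K. g \<in> borel_measurable borel \<Longrightarrow> compact K \<Longrightarrow> Measurable.pred P (\<lambda>\<omega>. S (A G g \<omega>) \<inter> K \<noteq> {})"
      and loc: "\<And>A R. well_spread T A \<Longrightarrow> \<exists>k. \<forall>l\<ge>k. \<forall>A'. A' \<inter> ?W l = A \<inter> ?W l \<longrightarrow>
        S A' \<inter> cball 0 R = S A \<inter> cball 0 R"
    for S :: "('a \<times> real) set \<Rightarrow> 'a set"
  proof -
    \<comment> \<open>Closedness holds for every \<open>\<omega>\<close>, also outside
      \<open>G\<close>, as \<open>pred_hits_differ\<close> requires.\<close>
    have clf: "closed (S (A G f \<omega>))" and clfs: "closed (S (A G (fs n) \<omega>))" for \<omega> n
      using cl[OF ws(1) T(1), of \<omega>] cl[OF ws(2) Ts(1), of \<omega> n] by (cases "\<omega> \<in> G"; simp add: A_notG S0)+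
    define B where "B R n = {\<omega>\<in>space P. S (A G (fs n) \<omega>) \<inter> cball 0 R \<noteq> S (A G f \<omega>) \<inter> cball 0 R}" for R n
    have differ: "B R n \<in> sets P" for n R
      unfolding B_def using pred_hits_differ[OF clfs clf hit[OF Dfs(1)] hit[OF Df(1)] compact_cball, of n 0 R]
      by (simp add: pred_def)
    have sub: "\<omega> \<in> D n k"
      if "\<omega> \<in> G" "\<omega> \<in> B R n" "A G (fs n) \<omega> \<inter> ?W k = A G f \<omega> \<inter> ?W k \<Longrightarrow>
        S (A G (fs n) \<omega>) \<inter> cball 0 R = S (A G f \<omega>) \<inter> cball 0 R" for \<omega> n k R
    proof (rule ccontr)
      assume "\<omega> \<notin> D n k"
      moreover have "\<omega> \<in> space P" "S (A G (fs n) \<omega>) \<inter> cball 0 R \<noteq> S (A G f \<omega>) \<inter> cball 0 R"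
        using that(2) by (simp_all add: B_def)
      ultimately show False using agree[of \<omega> n k] that(1,3) by simp
    qed
    \<comment> \<open>The threshold \<open>k0\<close> depends on \<open>\<omega>\<close> but not on
      \<open>n\<close>: locality is a property of the limit configuration and holds against every
      competitor \<open>A'\<close>.\<close>
    have dom: "\<exists>k0. \<forall>k\<ge>k0. \<forall>n. \<omega> \<in> B R n \<longrightarrow> \<omega> \<in> D n k" if \<omega>: "\<omega> \<in> G" for R \<omega>
    proof -
      obtain k0 where k0: "\<forall>l\<ge>k0. \<forall>A'. A' \<inter> ?W l = A G f \<omega> \<inter> ?W l \<longrightarrow>
          S A' \<inter> cball 0 R = S (A G f \<omega>) \<inter> cball 0 R"
        using loc[OF ws(1)[OF \<omega>], of R] by (rule exE)
      show ?thesis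
      proof (intro exI[of _ k0] allI impI)
        fix k n assume k: "k0 \<le> k" and B: "\<omega> \<in> B R n"
        show "\<omega> \<in> D n k"
          using k0[rule_format, OF k, of "A G (fs n) \<omega>"] by (rule sub[OF \<omega> B])
      qed
    qed
    have lim: "(\<lambda>n. measure P (B R n)) \<longlonglongrightarrow> 0" for R
    proof (rule tendsto_prob_if_eventually_dominated[where B = "B R" and D = D, OF P differ D_sets D_lim])
      show "AE \<omega> in P. \<exists>k0. \<forall>k\<ge>k0. \<forall>n. \<omega> \<in> B R n \<longrightarrow> \<omega> \<in> D n k"
        by (rule AE_mp[OF G(2)]) (intro AE_I2 impI dom)
    qed
    have rcs: "random_closed_set P (\<lambda>\<omega>. S (A G g \<omega>))" if "\<And>\<omega>. closed (S (A G g \<omega>))" "g \<in> borel_measurable borel" for g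
      using that hit[OF that(2)] by (simp add: random_closed_set_def pred_def)
    show ?thesis
      unfolding converges_locally_whp_def
      by (intro conjI allI impI P rcs clf clfs Df(1) Dfs(1) differ[unfolded B_def] lim[unfolded B_def])
  qed

  have actm: "Measurable.pred P (\<lambda>\<omega>. act k \<omega> \<and> x k \<omega> \<in> hypograph g \<and> \<omega> \<in> G)"
    if "g \<in> borel_measurable borel" for g k
  proof -
    note act [measurable] x [measurable] G(1) [measurable] sets_hypograph[OF that, measurable]
    show ?thesis by measurable
  qed
  have Xm: "(\<lambda>\<omega>. fst (x k \<omega>)) \<in> borel_measurable P" for k
    using measurable_compose[OF x measurable_fst_borel] .
  have inj_act: "inj_on (\<lambda>k. fst (x k \<omega>)) {k. act k \<omega> \<and> x k \<omega> \<in> hypograph g \<and> \<omega> \<in> G}" for \<omega> g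
    using Ginj[of \<omega>] by (cases "\<omega> \<in> G") (auto intro: inj_on_subset)
  have whp1: "converges_locally_whp P (\<lambda>n \<omega>. skel (laguerre (A G (fs n) \<omega>))) (\<lambda>\<omega>. skel (laguerre (A G f \<omega>)))"
  proof (rule whp[of "\<lambda>A. skel (laguerre A)"])
    show "Measurable.pred P (\<lambda>\<omega>. skel (laguerre (A G g \<omega>)) \<inter> K \<noteq> {})"
      if "g \<in> borel_measurable borel" "compact K" for g K
      unfolding A_def by (rule pred_skel_laguerre_hits[OF actm[OF that(1)] Xm that(2)])
    show "\<exists>k. \<forall>l\<ge>k. \<forall>A'. A' \<inter> ?W l = A \<inter> ?W l \<longrightarrow>
        skel (laguerre A') \<inter> cball 0 R = skel (laguerre A) \<inter> cball 0 R" if spread: "well_spread T A" for A R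
    proof -
      obtain k where k: "\<forall>l\<ge>k. \<forall>A'. A' \<inter> ?W l = A \<inter> ?W l \<longrightarrow>
          skel (laguerre A') \<inter> cball 0 R = skel (laguerre A) \<inter> cball 0 R \<and>
          skel (dual_laguerre A') \<inter> cball 0 R = skel (dual_laguerre A) \<inter> cball 0 R"
        using well_spread_skel(3)[OF spread T(1), of R] by (rule exE)
      show ?thesis
        by (intro exI[of _ k] allI impI) (erule (1) conjunct1[OF k[rule_format]])
    qed
  qed (use well_spread_skel(1) skel_empty in auto)
  have whp2: "converges_locally_whp P (\<lambda>n \<omega>. skel (dual_laguerre (A G (fs n) \<omega>))) (\<lambda>\<omega>. skel (dual_laguerre (A G f \<omega>)))"
  proof (rule whp[of "\<lambda>A. skel (dual_laguerre A)"])
    show "Measurable.pred P (\<lambda>\<omega>. skel (dual_laguerre (A G g \<omega>)) \<inter> K \<noteq> {})"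
      if "g \<in> borel_measurable borel" "compact K" for g K
      unfolding A_def by (rule pred_skel_dual_laguerre_hits[OF actm[OF that(1)] Xm that(2) inj_act])
    show "\<exists>k. \<forall>l\<ge>k. \<forall>A'. A' \<inter> ?W l = A \<inter> ?W l \<longrightarrow>
        skel (dual_laguerre A') \<inter> cball 0 R = skel (dual_laguerre A) \<inter> cball 0 R" if spread: "well_spread T A" for A R
    proof -
      obtain k where k: "\<forall>l\<ge>k. \<forall>A'. A' \<inter> ?W l = A \<inter> ?W l \<longrightarrow>
          skel (laguerre A') \<inter> cball 0 R = skel (laguerre A) \<inter> cball 0 R \<and>
          skel (dual_laguerre A') \<inter> cball 0 R = skel (dual_laguerre A) \<inter> cball 0 R"
        using well_spread_skel(3)[OF spread T(1), of R] by (rule exE)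
      show ?thesis
        by (intro exI[of _ k] allI impI) (erule (1) conjunct2[OF k[rule_format]])
    qed
  qed (use well_spread_skel(2) skel_empty in auto)
  have point: "point_process P (A G g)" if "g \<in> borel_measurable borel" for g
    using ppG[OF that] by (simp add: poisson_process_def)
  show ?thesis
    by (intro exI[of _ P] exI[of _ "A G f"] exI[of _ "\<lambda>n. A G (fs n)"] conjI allI P whp1 whp2
      point[OF Df(1)] point[OF Dfs(1)] law[OF poisson_\<eta> Df(1)] law[OF poisson_\<eta>s Dfs(1)])
qed

end
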